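(* Let $n\ge 3$ and $p=(0,1)\in\mathbb S^2\subset\mathbb C\oplus\mathbb R$. For every $h>0$ there exists a unique (up to reparametrization and up to a rotation $(z,b)\mapsto(e^{i\phi}z,b)$ of $\mathbb S^2$ fixing $p$) global complete $(-h)$-curve passing through $p$. Consequently, the family of Delaunay hypersurfaces of constant mean curvature $-h$ in $\mathbb S^n$ contains a further type (the flower type), namely the hypersurface generated by this curve; its local pieces are the local $(-h)$-curves with parameter $C=\frac{h}{n-1}$, which is the transition value joining the unduloid type ($C\in(\frac{h}{n-1},C_{-h})$) and the nodoid type ($C\in(0,\frac{h}{n-1})$) of constant mean curvature $-h$.
   Context: $\mathbb S^n$ is the unit sphere of $\mathbb C\oplus\mathbb R^{n-1}$, $\mathbb S^2$ the unit sphere of $\mathbb C\oplus\mathbb R$, $S^{n-2}$ the unit sphere of $\mathbb R^{n-1}$. A regular $C^2$ curve $\gamma=(z,b):I\to\mathbb S^2$ with $b>0$ generates the immersed hypersurface (Delaunay hypersurface, when it has constant mean curvature) $G_\gamma:I\times S^{n-2}\to\mathbb S^n$, $G_\gamma(t,x)=(z(t),b(t)x)$. Mean curvature is unnormalized (trace of the second fundamental form), with sign such that the boundary of a small geodesic ball has positive mean curvature with respect to the unit normal pointing into the ball. A $k$-curve ($k\in\mathbb R$) is such a $\gamma$ for which $G_\gamma$ has constant mean curvature $k$ with respect to a continuous unit normal field $N$. It is complete if it is defined on $\mathbb R$ and has infinite length in both directions. Local curves: for $k,C\in\mathbb R$ put $L(s)=\cos s\,\sin^{n-2}s$ and $R(s,C,k)=C+\frac{k}{n-1}\sin^{n-1}s$,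 $s\in(0,\frac{\pi}{2})$, and let $J(C,k)$ be the interval $\{s\in(0,\frac{\pi}{2}):|R(s,C,k)|<L(s)\}$. The local $k$-curve with parameter $C$ is $\gamma(s)=(\cos s\,e^{is_1(s)},\sin s)$, $s\in J(C,k)$, with $\frac{ds_1}{ds}=\dfrac{R}{\cos s\sqrt{L^2-R^2}}$; the normal used on it is $N=\big[\cos s\,\dot s_1\,(\sin s\,e^{is_1},-\cos s\,x)+(ie^{is_1},0)\big]\big/\sqrt{1+\cos^2 s\,\dot s_1^2}$. For $k\in\mathbb R$, $s_k\in(0,\frac{\pi}{2})$ is the unique solution of $-\tan s_k+(n-2)\cot s_k=k$, and $C_k:=L(s_k)-\frac{k}{n-1}\sin^{n-1}s_k$. Unduloid and nodoid types of constant mean curvature $-h$ are the hypersurfaces generated by the complete curves obtained from the local $(-h)$-curves with the indicated values of $C$ by repeated reflection $(z,b)\mapsto(e^{2i\theta}\bar z,b)$ at endpoints ($\theta$ being the phase $s_1$ at the endpoint). *)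

theory Defs
  imports "HOL-Analysis.Analysis"
begin

text \<open>
  Throughout, \<open>\<real>^(n-1)\<close> is rendered as \<open>real ^ 'm\<close>, so that \<open>n = CARD('m) + 1\<close>; the sphere
  \<open>S^n\<close> is the unit sphere of \<open>complex \<times> (real ^ 'm)\<close> and \<open>S^2\<close> that of \<open>complex \<times> real\<close>.
\<close>

section \<open>Hypersurfaces of the sphere and their mean curvature\<close>

text \<open>
  \<open>M\<close> is a submanifold of a Euclidean space with tangent spaces \<open>T q\<close>, and \<open>G\<close> maps \<open>M\<close> into a
  unit sphere as a hypersurface. Derivatives are taken within \<open>M\<close>; only their values on \<open>T q\<close>,
  where they are uniquely determined, are ever used.
\<close>

definition unit_normal_field ::
  "'a::euclidean_space set \<Rightarrow> ('a \<Rightarrow> 'a set) \<Rightarrow> ('a \<Rightarrow> 'b::euclidean_space) \<Rightarrow> ('a \<Rightarrow> 'b) \<Rightarrow> bool"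
where
  "unit_normal_field M T G N \<longleftrightarrow>
     continuous_on M N \<and>
     (\<forall>q\<in>M. norm (N q) = 1 \<and> N q \<bullet> G q = 0 \<and>
        (\<exists>DG. (G has_derivative DG) (at q within M) \<and> (\<forall>u\<in>T q. N q \<bullet> DG u = 0)))"

text \<open>
  Unnormalized mean curvature: the trace, over a basis \<open>E\<close> of \<open>T q\<close> that is orthonormal for the
  induced metric, of \<open>II(u,v) = \<langle>\<nabla>\<^sub>u dG(v), N\<rangle> = - \<langle>dN(u), dG(v)\<rangle>\<close>. The boundary of a small ball has
  positive mean curvature with respect to the normal pointing into the ball.
\<close>

definition second_fundamental_form ::
  "('a \<Rightarrow> 'b::real_inner) \<Rightarrow> ('a \<Rightarrow> 'b) \<Rightarrow> 'a \<Rightarrow> 'a \<Rightarrow> real"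
where
  "second_fundamental_form DG DN u v = - (DN u \<bullet> DG v)"

definition has_mean_curvature ::
  "'a::euclidean_space set \<Rightarrow> ('a \<Rightarrow> 'a set) \<Rightarrow> ('a \<Rightarrow> 'b::euclidean_space) \<Rightarrow> ('a \<Rightarrow> 'b) \<Rightarrow> 'a \<Rightarrow> real \<Rightarrow> bool"
where
  "has_mean_curvature M T G N q H \<longleftrightarrow>
     (\<exists>DG DN E. (G has_derivative DG) (at q within M) \<and> (N has_derivative DN) (at q within M) \<and>
        finite E \<and> E \<subseteq> T q \<and> span E = T q \<and>
        (\<forall>u\<in>E. \<forall>v\<in>E. DG u \<bullet> DG v = (if u = v then 1 else 0)) \<and>
        H = (\<Sum>u\<in>E. second_fundamental_form DG DN u u))"


section \<open>Curves in the two-sphere and the hypersurfaces they generate\<close>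

definition param_domain :: "real set \<Rightarrow> (real \<times> (real ^ 'm)) set" where
  "param_domain I = I \<times> sphere 0 1"

definition param_tangent :: "real \<times> (real ^ 'm) \<Rightarrow> (real \<times> (real ^ 'm)) set" where
  "param_tangent q = {u. snd q \<bullet> snd u = 0}"

definition rot_hyp :: "(real \<Rightarrow> complex \<times> real) \<Rightarrow> real \<times> (real ^ 'm) \<Rightarrow> complex \<times> (real ^ 'm)" where
  "rot_hyp \<gamma> = (\<lambda>(t, x). (fst (\<gamma> t), snd (\<gamma> t) *\<^sub>R x))"

definition generated_hypersurface ::
  "real set \<Rightarrow> (real \<Rightarrow> complex \<times> real) \<Rightarrow> (complex \<times> (real ^ 'm)) set"
where
  "generated_hypersurface I \<gamma> = rot_hyp \<gamma> ` param_domain I"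

definition regular_C2_curve :: "real set \<Rightarrow> (real \<Rightarrow> 'a::real_normed_vector) \<Rightarrow> bool" where
  "regular_C2_curve I \<gamma> \<longleftrightarrow>
     (\<exists>D. (\<forall>t\<in>I. (\<gamma> has_vector_derivative D t) (at t) \<and> D t \<noteq> 0) \<and> D C1_differentiable_on I)"

text \<open>Intervals of definition are open. The type argument fixes the dimension \<open>n = CARD('m) + 1\<close>.\<close>

definition k_curve ::
  "'m::finite itself \<Rightarrow> real \<Rightarrow> real set \<Rightarrow> (real \<Rightarrow> complex \<times> real) \<Rightarrow> bool"
where
  "k_curve TYPE('m) k I \<gamma> \<longleftrightarrow>
     open I \<and> is_interval I \<and> I \<noteq> {} \<and>
     regular_C2_curve I \<gamma> \<and> (\<forall>t\<in>I. \<gamma> t \<in> sphere 0 1 \<and> snd (\<gamma> t) > 0) \<and>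
     (\<exists>N :: real \<times> (real ^ 'm) \<Rightarrow> complex \<times> (real ^ 'm).
        unit_normal_field (param_domain I) param_tangent (rot_hyp \<gamma>) N \<and>
        (\<forall>q\<in>param_domain I.
           has_mean_curvature (param_domain I) param_tangent (rot_hyp \<gamma>) N q k))"

definition complete_k_curve ::
  "'m::finite itself \<Rightarrow> real \<Rightarrow> (real \<Rightarrow> complex \<times> real) \<Rightarrow> bool"
where
  "complete_k_curve TYPE('m) k \<gamma> \<longleftrightarrow>
     k_curve TYPE('m) k UNIV \<gamma> \<and>
     filterlim (\<lambda>r. integral {0..r} (\<lambda>t. norm (vector_derivative \<gamma> (at t)))) at_top at_top \<and>
     filterlim (\<lambda>r. integral {-r..0} (\<lambda>t. norm (vector_derivative \<gamma> (at t)))) at_top at_top"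

text \<open>Reparametrizations may reverse the orientation.\<close>

definition reparametrization :: "real set \<Rightarrow> real set \<Rightarrow> (real \<Rightarrow> real) \<Rightarrow> bool" where
  "reparametrization I I' \<phi> \<longleftrightarrow> bij_betw \<phi> I I' \<and> regular_C2_curve I \<phi>"

definition rotate_curve :: "real \<Rightarrow> complex \<times> real \<Rightarrow> complex \<times> real" where
  "rotate_curve a p = (cis a * fst p, snd p)"

definition reflect :: "real \<Rightarrow> complex \<times> real \<Rightarrow> complex \<times> real" where
  "reflect \<theta> p = (cis (2 * \<theta>) * cnj (fst p), snd p)"

definition equivalent_curves ::
  "(real \<Rightarrow> complex \<times> real) \<Rightarrow> (real \<Rightarrow> complex \<times> real) \<Rightarrow> bool"
where
  "equivalent_curves \<gamma> \<delta> \<longleftrightarrow>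
     (\<exists>a \<phi>. reparametrization UNIV UNIV \<phi> \<and> (\<forall>t. \<delta> t = rotate_curve a (\<gamma> (\<phi> t))))"


section \<open>Local curves\<close>

definition L_fun :: "nat \<Rightarrow> real \<Rightarrow> real" where
  "L_fun n s = cos s * sin s ^ (n - 2)"

definition R_fun :: "nat \<Rightarrow> real \<Rightarrow> real \<Rightarrow> real \<Rightarrow> real" where
  "R_fun n s C k = C + k / (real n - 1) * sin s ^ (n - 1)"

definition J_set :: "nat \<Rightarrow> real \<Rightarrow> real \<Rightarrow> real set" where
  "J_set n C k = {s \<in> {0<..<pi/2}. \<bar>R_fun n s C k\<bar> < L_fun n s}"

text \<open>\<open>s\<^sub>1\<close> is determined up to an additive constant, i.e. the curve up to a rotation.\<close>

definition local_k_curve :: "nat \<Rightarrow> real \<Rightarrow> real \<Rightarrow> (real \<Rightarrow> complex \<times> real) \<Rightarrow> bool" where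
  "local_k_curve n k C \<gamma> \<longleftrightarrow>
     (\<exists>s\<^sub>1. \<forall>s\<in>J_set n C k.
        (s\<^sub>1 has_real_derivative
           R_fun n s C k / (cos s * sqrt ((L_fun n s)\<^sup>2 - (R_fun n s C k)\<^sup>2))) (at s) \<and>
        \<gamma> s = (of_real (cos s) * cis (s\<^sub>1 s), sin s))"

definition s_crit :: "nat \<Rightarrow> real \<Rightarrow> real" where
  "s_crit n k = (THE s. s \<in> {0<..<pi/2} \<and> - tan s + (real n - 2) * cot s = k)"

definition C_crit :: "nat \<Rightarrow> real \<Rightarrow> real" where
  "C_crit n k = L_fun n (s_crit n k) - k / (real n - 1) * sin (s_crit n k) ^ (n - 1)"

definition local_piece ::
  "nat \<Rightarrow> real \<Rightarrow> real \<Rightarrow> (real \<Rightarrow> complex \<times> real) \<Rightarrow> real set \<Rightarrow> bool"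
where
  "local_piece n k C \<gamma> K \<longleftrightarrow>
     (\<exists>\<gamma>\<^sub>0 \<phi>. local_k_curve n k C \<gamma>\<^sub>0 \<and> reparametrization K (J_set n C k) \<phi> \<and>
        (\<forall>t\<in>K. \<gamma> t = \<gamma>\<^sub>0 (\<phi> t)))"


section \<open>Unduloid and nodoid types\<close>

definition subdivision :: "(int \<Rightarrow> real) \<Rightarrow> bool" where
  "subdivision \<tau> \<longleftrightarrow> strict_mono \<tau> \<and> (\<Union>j. {\<tau> j..\<tau> (j + 1)}) = UNIV"

text \<open>
  The endpoints of the pieces are the points \<open>\<gamma> (\<tau> j)\<close>; as long as the curve does not meet
  \<open>(0, 1)\<close> there, the phase of the piece at the endpoint is the argument of the \<open>\<complex>\<close>-component.
\<close>

definition repeated_reflection ::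
  "nat \<Rightarrow> real \<Rightarrow> real \<Rightarrow> (real \<Rightarrow> complex \<times> real) \<Rightarrow> bool"
where
  "repeated_reflection n k C \<gamma> \<longleftrightarrow>
     continuous_on UNIV \<gamma> \<and>
     (\<exists>\<tau>. subdivision \<tau> \<and> local_piece n k C \<gamma> {\<tau> 0<..<\<tau> 1} \<and>
        (\<forall>j. \<exists>\<phi>. reparametrization {\<tau> j<..<\<tau> (j + 1)} {\<tau> (j - 1)<..<\<tau> j} \<phi> \<and>
           (\<forall>t\<in>{\<tau> j<..<\<tau> (j + 1)}. \<gamma> t = reflect (Arg (fst (\<gamma> (\<tau> j)))) (\<gamma> (\<phi> t)))))"

definition unduloid_params :: "nat \<Rightarrow> real \<Rightarrow> real set" where
  "unduloid_params n h = {h / (real n - 1)<..<C_crit n (-h)}"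

definition nodoid_params :: "nat \<Rightarrow> real \<Rightarrow> real set" where
  "nodoid_params n h = {0<..<h / (real n - 1)}"

definition delaunay_hypersurfaces :: "real \<Rightarrow> (complex \<times> (real ^ 'm)) set set" where
  "delaunay_hypersurfaces k = {generated_hypersurface I \<gamma> | I \<gamma>. k_curve TYPE('m) k I \<gamma>}"

text \<open>Hypersurfaces of constant mean curvature \<open>-h\<close> whose local pieces have parameter in \<open>P\<close>.\<close>

definition reflected_type :: "real \<Rightarrow> real set \<Rightarrow> (complex \<times> (real ^ 'm)) set set" where
  "reflected_type h P =
     {generated_hypersurface UNIV \<gamma> | \<gamma>.
        complete_k_curve TYPE('m) (-h) \<gamma> \<and>
        (\<exists>C\<in>P. repeated_reflection (CARD('m) + 1) (-h) C \<gamma>)}"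

definition unduloid_type :: "real \<Rightarrow> (complex \<times> (real ^ 'm)) set set" where
  "unduloid_type h = reflected_type h (unduloid_params (CARD('m) + 1) h)"

definition nodoid_type :: "real \<Rightarrow> (complex \<times> (real ^ 'm)) set set" where
  "nodoid_type h = reflected_type h (nodoid_params (CARD('m) + 1) h)"


section \<open>The flower type\<close>

definition flower_curve :: "'m::finite itself \<Rightarrow> real \<Rightarrow> (real \<Rightarrow> complex \<times> real) \<Rightarrow> bool" where
  "flower_curve TYPE('m) h \<gamma> \<longleftrightarrow> complete_k_curve TYPE('m) (-h) \<gamma> \<and> (0, 1) \<in> range \<gamma>"

text \<open>
  Consecutive pieces of a complete curve are mirror images of each other (up to a rotation), also
  when the curve runs through \<open>(0, 1)\<close>, so every other piece is a mirrored local curve.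
\<close>

definition has_local_pieces ::
  "nat \<Rightarrow> real \<Rightarrow> real \<Rightarrow> (real \<Rightarrow> complex \<times> real) \<Rightarrow> bool"
where
  "has_local_pieces n k C \<gamma> \<longleftrightarrow>
     (\<exists>\<tau>. subdivision \<tau> \<and>
        (\<forall>j. local_piece n k C (if even j then \<gamma> else (\<lambda>t. reflect 0 (\<gamma> t)))
               {\<tau> j<..<\<tau> (j + 1)}))"

text \<open>
  The local \<open>k\<close>-curves, normalized by prescribing the phase \<open>0\<close> at a point \<open>s\<^sub>0\<close>, and the
  endpoints of their domains depend continuously on the parameter at \<open>C\<^sub>0\<close>.
\<close>

definition local_curves_continuous_at :: "nat \<Rightarrow> real \<Rightarrow> real \<Rightarrow> bool" where
  "local_curves_continuous_at n k C\<^sub>0 \<longleftrightarrow>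
     ((\<lambda>C. Inf (J_set n C k)) \<longlongrightarrow> Inf (J_set n C\<^sub>0 k)) (at C\<^sub>0) \<and>
     ((\<lambda>C. Sup (J_set n C k)) \<longlongrightarrow> Sup (J_set n C\<^sub>0 k)) (at C\<^sub>0) \<and>
     (\<forall>s\<^sub>0\<in>J_set n C\<^sub>0 k. \<forall>\<Lambda>.
        (\<forall>C. local_k_curve n k C (\<Lambda> C) \<and>
             (s\<^sub>0 \<in> J_set n C k \<longrightarrow> \<Lambda> C s\<^sub>0 = (of_real (cos s\<^sub>0), sin s\<^sub>0))) \<longrightarrow>
        (\<forall>s\<in>J_set n C\<^sub>0 k. ((\<lambda>C. \<Lambda> C s) \<longlongrightarrow> \<Lambda> C\<^sub>0 s) (at C\<^sub>0)))"

end

theory Submission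
  imports Defs
begin

text \<open>
  In terms of the unit tangent \<open>T\<close> of a curve \<open>\<gamma>\<close> in the two-sphere and of \<open>\<nu> = \<gamma> \<times> T\<close>, the generated
  hypersurface has constant mean curvature \<open>-h\<close> with respect to \<open>-\<nu>\<close> iff \<open>(\<gamma>, T)\<close> solves an autonomous
  first-order system that is smooth wherever \<open>b > 0\<close>. Working with \<open>(\<gamma>, T)\<close> in Euclidean space instead of
  polar coordinates removes the singularity at the pole \<open>p\<close>, so uniqueness of the flower curve is
  uniqueness for this system up to a rotation.

  The quantity \<open>b\<^sup>\<mu> \<nu>\<^sub>b + h/(\<mu>+1) b\<^sup>\<mu>\<^sup>+\<^sup>1\<close> with \<open>\<mu> = n - 2\<close> is conserved; its value is the parameter \<open>C\<close>, and it is
  \<open>h/(n-1)\<close> exactly for the curves through \<open>p\<close>. For \<open>C > 0\<close> it keeps \<open>b\<close> away from \<open>0\<close>, which gives global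
  solutions. The height \<open>b\<close> then oscillates like a particle in a potential well between two turning
  points, where the velocity is horizontal; uniqueness makes the curve symmetric under reflection there.
\<close>

section \<open>Ordinary differential equations\<close>

text \<open>At unit speed \<open>T' = - \<gamma> + \<kappa> \<nu>\<close>. With the normal
  \<open>- \<nu>\<close> the principal curvatures are \<open>- \<kappa>\<close> once and
  \<open>\<nu>\<^sub>b / b\<close> with multiplicity \<open>\<mu>\<close>, so mean curvature
  \<open>- h\<close> means \<open>\<kappa> = h + \<mu> \<nu>\<^sub>b / b\<close>. At
  \<open>p\<close> every unit tangent is horizontal, and rotations act transitively on horizontal
  unit vectors; hence all initial data at \<open>p\<close> are equivalent, and since
  \<open>b = 1\<close> and \<open>\<nu>\<^sub>b = 0\<close> there, the flux is
  \<open>h / (\<mu> + 1)\<close>. A competing curve comes with unknown speed, orientation and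
  normal. All three are stored in one nonvanishing factor \<open>v\<close>; an antiderivative of
  \<open>v\<close> is the reparametrization, and infinite length in both directions makes it
  bijective. That the flower hypersurface is of neither other type cannot be read off a chosen
  parametrization, since one set may be generated by several curves. What separates them is the set
  \<open>{0} \<times> S^(n-2)\<close>: the strict condition \<open>|R| < L\<close> is weakened to a
  closed, reflection-invariant inequality in \<open>(|z|, b)\<close>, which at \<open>p\<close>
  forces \<open>C = h / (n - 1)\<close>.\<close>

lemma has_vector_derivative_affine:
  assumes "(y has_vector_derivative y') (at (a + s * t))"
  shows "((\<lambda>t. y (a + s * t)) has_vector_derivative s *\<^sub>R y') (at t)"
proof -
  have "((\<lambda>t. a + s * t) has_vector_derivative s) (at t)"
    unfolding has_real_derivative_iff_has_vector_derivative[symmetric]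
    by (rule derivative_eq_intros refl | simp)+
  from vector_diff_chain_at[OF this assms] show ?thesis by (simp add: o_def)
qed

lemma continuous_on_if_derivative:
  "(\<And>t. (f has_vector_derivative f' t) (at t)) \<Longrightarrow> continuous_on S f"
  by (meson continuous_at_imp_continuous_on has_vector_derivative_continuous)

lemma antiderivative_exists:
  fixes f :: "real \<Rightarrow> 'a::euclidean_space"
  assumes "continuous_on UNIV f"
  shows "\<exists>F. F t0 = c \<and> (\<forall>t. (F has_vector_derivative f t) (at t))"
proof -
  obtain F where F: "\<And>t. (F has_vector_derivative f t) (at t)"
    using einterval_antiderivative[of "-\<infinity>" "\<infinity>" f] assms
    by (auto simp: continuous_on_eq_continuous_at)
  have "((\<lambda>t. F t - F t0 + c) has_vector_derivative f t) (at t)" for t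
    using has_vector_derivative_diff[OF F[of t] has_vector_derivative_const[of "F t0 - c"]]
    by (simp add: algebra_simps)
  then show ?thesis
    by (intro exI[of _ "\<lambda>t. F t - F t0 + c"]) auto
qed

text \<open>Integrating the bound once raises the exponent and supplies the factor
  \<open>1/(k+1)\<close>. This is the induction step for the differences of Picard iterates;
  negative times are reduced to positive ones by \<open>t \<mapsto> - t\<close>.\<close>

lemma norm_le_power_fact_step:
  fixes d d' :: "real \<Rightarrow> 'a::euclidean_space"
  assumes d: "\<And>t. (d has_vector_derivative d' t) (at t)" and d0: "d 0 = 0"
    and bound: "\<And>t. norm (d' t) \<le> K * \<bar>t\<bar> ^ k / fact k"
  shows "norm (d t) \<le> K * \<bar>t\<bar> ^ Suc k / fact (Suc k)"
proof -
  have half: "norm (e t) \<le> K * t ^ Suc k / fact (Suc k)"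
    if e: "\<And>t. (e has_vector_derivative e' t) (at t)" "e 0 = 0"
      and eb: "\<And>t. norm (e' t) \<le> K * \<bar>t\<bar> ^ k / fact k" and t: "t \<ge> 0"
    for e e' :: "real \<Rightarrow> 'a" and t
  proof (cases "t = 0")
    case False
    then have t: "0 < t" using t by simp
    have "norm (e t - e 0) \<le> K * t ^ Suc k / fact (Suc k) - K * 0 ^ Suc k / fact (Suc k)"
    proof (rule differentiable_bound_general[OF t])
      show "continuous_on {0..t} e"
        using e(1) by (rule continuous_on_if_derivative)
      show "continuous_on {0..t} (\<lambda>t. K * t ^ Suc k / fact (Suc k))"
        by (intro continuous_intros) simp
      show "((\<lambda>t. K * t ^ Suc k / fact (Suc k)) has_vector_derivative K * s ^ k / fact k) (at s)" for s
        unfolding has_real_derivative_iff_has_vector_derivative[symmetric]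
        by (rule derivative_eq_intros refl | simp add: field_simps del: of_nat_Suc)+
      show "norm (e' s) \<le> K * s ^ k / fact k" if "0 < s" "s < t" for s
        using eb[of s] that by simp
    qed (use e in auto)
    then show ?thesis using e by simp
  qed (use e in auto)
  show ?thesis
  proof (cases "t \<ge> 0")
    case True
    then show ?thesis using half[OF d d0 bound, of t] by simp
  next
    case False
    have "((\<lambda>t. d (- t)) has_vector_derivative - d' (- t)) (at t)" for t
      using has_vector_derivative_affine[of d "d' (- t)" 0 "-1" t] d[of "- t"] by simp
    from half[OF this _ _, of "- t"] show ?thesis
      using False d0 bound[of "- _"] by simp
  qed
qed

text \<open>Picard iteration on the whole line: the factorials in the bound for successive
  differences give uniform convergence on every bounded interval, so no short-time solutions have to
  be glued. The derivatives \<open>F (x n t)\<close> converge uniformly as well, hence the limit may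
  be differentiated.\<close>

theorem lipschitz_ode_solution_exists:
  fixes F :: "'a::euclidean_space \<Rightarrow> 'a"
  assumes lip: "L-lipschitz_on UNIV F"
  shows "\<exists>y. y 0 = y0 \<and> (\<forall>t. (y has_vector_derivative F (y t)) (at t))"
proof -
  have L: "L \<ge> 0" using lip by (rule lipschitz_on_nonneg)
  \<comment> \<open>\<open>A f\<close> is some antiderivative of \<open>f\<close> with value
    \<open>y0\<close> at 0, so \<open>A (F \<circ> f)\<close> is the Picard operator applied to
    \<open>f\<close>.\<close>
  define A :: "(real \<Rightarrow> 'a) \<Rightarrow> real \<Rightarrow> 'a" where
    "A f = (SOME G. G 0 = y0 \<and> (\<forall>t. (G has_vector_derivative f t) (at t)))" for f
  have A: "A f 0 = y0 \<and> (\<forall>t. (A f has_vector_derivative f t) (at t))" if "continuous_on UNIV f" for f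
    unfolding A_def
    by (rule someI_ex[where P = "\<lambda>G. G 0 = y0 \<and> (\<forall>t. (G has_vector_derivative f t) (at t))"],
        rule antiderivative_exists[OF that])
  define x where "x n = ((\<lambda>f. A (F \<circ> f)) ^^ n) (\<lambda>_. y0)" for n
  have contF: "continuous_on UNIV F" using lip by (rule lipschitz_on_continuous_on)
  have x_Suc: "x (Suc n) = A (F \<circ> x n)" for n by (simp add: x_def)
  have contx: "continuous_on UNIV (x n)" for n
  proof (induction n)
    case 0 then show ?case by (simp add: x_def)
  next
    case (Suc n)
    have "continuous_on UNIV (F \<circ> x n)"
      using Suc contF by (intro continuous_on_compose) (auto intro: continuous_on_subset)
    then show ?case unfolding x_Suc
      using A continuous_on_if_derivative by blast
  qed
  have contFx: "continuous_on UNIV (F \<circ> x n)" for n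
    using contx contF by (intro continuous_on_compose) (auto intro: continuous_on_subset)
  have x0: "x n 0 = y0" for n
    by (cases n) (use A[OF contFx] in \<open>auto simp: x_Suc x_def[of 0]\<close>)
  have dx: "(x (Suc n) has_vector_derivative F (x n t)) (at t)" for n t
    using A[OF contFx[of n]] by (simp add: x_Suc)
  define M where "M = norm (F y0)"
  have M: "M \<ge> 0" by (simp add: M_def)
  have step: "norm (x (Suc n) t - x n t) \<le> M * L ^ n * \<bar>t\<bar> ^ Suc n / fact (Suc n)" for n t
  proof (induction n arbitrary: t)
    case 0
    show ?case
    proof (rule norm_le_power_fact_step[where d' = "\<lambda>_. F y0"])
      show "((\<lambda>t. x (Suc 0) t - x 0 t) has_vector_derivative F y0) (at t)" for t
        using has_vector_derivative_diff[OF dx[of 0 t] has_vector_derivative_const[of y0]]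
        by (simp add: x_def[of 0])
    qed (auto simp: x0 M_def)
  next
    case (Suc n)
    show ?case
    proof (rule norm_le_power_fact_step)
      show "((\<lambda>t. x (Suc (Suc n)) t - x (Suc n) t) has_vector_derivative F (x (Suc n) t) - F (x n t)) (at t)" for t
        by (rule has_vector_derivative_diff[OF dx dx])
      show "norm (F (x (Suc n) t) - F (x n t)) \<le> M * L ^ Suc n * \<bar>t\<bar> ^ Suc n / fact (Suc n)" for t
      proof -
        have "norm (F (x (Suc n) t) - F (x n t)) \<le> L * norm (x (Suc n) t - x n t)"
          using lipschitz_on_normD[OF lip] by blast
        also have "\<dots> \<le> L * (M * L ^ n * \<bar>t\<bar> ^ Suc n / fact (Suc n))"
          by (rule mult_left_mono[OF Suc L])
        finally show ?thesis by (simp add: mult_ac)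
      qed
    qed (simp add: x0)
  qed
  have unif: "uniformly_convergent_on {-r..r} x" for r
  proof -
    have eq: "(\<Sum>i<n. x (Suc i) t - x i t) = x n t - y0" for n t
      using sum_lessThan_telescope[of "\<lambda>i. x i t" n] by (simp add: x_def[of 0])
    have "uniformly_convergent_on {-r..r} (\<lambda>n t. \<Sum>i<n. x (Suc i) t - x i t)"
    proof (rule Weierstrass_m_test')
      show "norm (x (Suc n) t - x n t) \<le> M * \<bar>r\<bar> * ((L * \<bar>r\<bar>) ^ n / fact n)" if "t \<in> {-r..r}" for n t
      proof -
        have "\<bar>t\<bar> ^ Suc n / fact (Suc n) \<le> \<bar>r\<bar> ^ Suc n / fact n"
          using that by (intro frac_le power_mono fact_mono) auto
        from mult_left_mono[OF this, of "M * L ^ n"] step[of n t] show ?thesis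
          using M L by (simp add: power_mult_distrib mult_ac)
      qed
      show "summable (\<lambda>n. M * \<bar>r\<bar> * ((L * \<bar>r\<bar>) ^ n / fact n))"
        using summable_exp[of "L * \<bar>r\<bar>"] by (intro summable_mult) (simp add: field_simps)
    qed
    then have "uniformly_convergent_on {-r..r} (\<lambda>n t. x n t - y0)" by (simp only: eq)
    then obtain l where "uniform_limit {-r..r} (\<lambda>n t. x n t - y0) l sequentially"
      by (auto simp: uniformly_convergent_on_def)
    from uniform_limit_add[OF this uniform_limit_const[of "\<lambda>_. y0"]]
    have "uniform_limit {-r..r} x (\<lambda>t. l t + y0) sequentially" by simp
    then show ?thesis by (auto simp: uniformly_convergent_on_def)
  qed
  define y where "y t = lim (\<lambda>n. x n t)" for t
  have uy: "uniform_limit {-r..r} x y sequentially" for r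
    using unif[of r] by (simp add: y_def[abs_def] uniformly_convergent_uniform_limit_iff)
  have y0: "y 0 = y0" by (simp add: y_def x0)
  have lim: "(\<lambda>n. x n t) \<longlonglongrightarrow> y t" for t
    by (rule tendsto_uniform_limitI[OF uy[of "\<bar>t\<bar>"]]) auto
  have "(y has_vector_derivative F (y t)) (at t)" for t
  proof -
    \<comment> \<open>This makes \<open>t\<close> an interior point of \<open>{-r..r}\<close>, so
      that the derivative within the interval becomes a full derivative.\<close>
    define r where "r = \<bar>t\<bar> + 1"
    have "\<exists>g. \<forall>s\<in>{-r..r}. (\<lambda>n. x (Suc n) s) \<longlonglongrightarrow> g s \<and>
        (g has_derivative (\<lambda>u. u *\<^sub>R F (y s))) (at s within {-r..r})"
    proof (rule has_derivative_sequence[where f' = "\<lambda>n s u. u *\<^sub>R F (x n s)" and ?x0.0 = 0])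
      show "(x (Suc n) has_derivative (\<lambda>u. u *\<^sub>R F (x n s))) (at s within {-r..r})" for n s
        using dx[of n s] unfolding has_vector_derivative_def by (rule has_derivative_at_withinI)
      show "\<forall>\<^sub>F n in sequentially. \<forall>s\<in>{-r..r}. \<forall>h. norm (h *\<^sub>R F (x n s) - h *\<^sub>R F (y s)) \<le> e * norm h"
        if "e > 0" for e
      proof -
        have "e / (L + 1) > 0" using that L by simp
        from uniform_limitD[OF uy[of r] this] show ?thesis
        proof eventually_elim
          case (elim n)
          show ?case
          proof (intro ballI allI)
            fix s h :: real assume s: "s \<in> {-r..r}"
            have "norm (F (x n s) - F (y s)) \<le> L * norm (x n s - y s)"
              using lipschitz_on_normD[OF lip] by blast
            also have "\<dots> \<le> (L + 1) * norm (x n s - y s)" by (intro mult_right_mono) auto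
            also have "\<dots> \<le> (L + 1) * (e / (L + 1))"
              using elim s L by (intro mult_left_mono) (auto simp: dist_norm less_imp_le)
            also have "\<dots> = e" using L by (simp add: divide_simps)
            finally have "norm (F (x n s) - F (y s)) \<le> e" .
            from mult_left_mono[OF this, of "\<bar>h\<bar>"]
            show "norm (h *\<^sub>R F (x n s) - h *\<^sub>R F (y s)) \<le> e * norm h"
              by (simp add: scaleR_diff_right[symmetric] mult.commute)
          qed
        qed
      qed
    qed (auto simp: r_def x0)
    then obtain g where g: "\<And>s. s \<in> {-r..r} \<Longrightarrow> (\<lambda>n. x (Suc n) s) \<longlonglongrightarrow> g s"
        "\<And>s. s \<in> {-r..r} \<Longrightarrow> (g has_derivative (\<lambda>u. u *\<^sub>R F (y s))) (at s within {-r..r})"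
      by blast
    have gy: "g s = y s" if "s \<in> {-r..r}" for s
      using LIMSEQ_unique[OF g(1)[OF that] LIMSEQ_Suc[OF lim]] by simp
    have tr: "t \<in> {-r<..<r}" by (auto simp: r_def)
    have "(g has_vector_derivative F (y t)) (at t within {-r<..<r})"
      unfolding has_vector_derivative_def
      by (rule has_derivative_subset[OF g(2)]) (use tr in auto)
    then have "(g has_vector_derivative F (y t)) (at t)"
      using tr by (simp add: at_within_open[of t "{-r<..<r}"])
    then show ?thesis
      by (rule has_vector_derivative_transform_within_open[of _ _ _ "{-r<..<r}"]) (use tr gy in auto)
  qed
  with y0 show ?thesis by blast
qed

text \<open>Gronwall's inequality in differential form: the weighted energy
  \<open>exp (- 2 M t) |d t|^2\<close> cannot increase, because
  \<open>d \<bullet> d' \<le> M |d|^2\<close>, and it starts at 0.\<close>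

lemma gronwall_zero:
  fixes d d' :: "real \<Rightarrow> 'a::euclidean_space"
  assumes d: "\<And>t. t \<in> {0..r} \<Longrightarrow> (d has_vector_derivative d' t) (at t)" and d0: "d 0 = 0"
    and bound: "\<And>t. t \<in> {0..r} \<Longrightarrow> norm (d' t) \<le> M * norm (d t)" and r: "r \<ge> 0"
  shows "d r = 0"
proof -
  let ?e = "\<lambda>t. exp (- 2 * M * t) * (d t \<bullet> d t)"
  have "?e r \<le> ?e 0"
  proof (rule DERIV_nonpos_imp_nonincreasing[OF r])
    fix t assume t: "0 \<le> t" "t \<le> r"
    have D: "((\<lambda>t. d t \<bullet> d t) has_real_derivative 2 * (d t \<bullet> d' t)) (at t)"
      using bounded_bilinear.has_vector_derivative[OF bounded_bilinear_inner d d] t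
      unfolding has_real_derivative_iff_has_vector_derivative
      by (simp add: inner_commute)
    have E: "(?e has_real_derivative exp (- 2 * M * t) * (2 * (d t \<bullet> d' t) - 2 * M * (d t \<bullet> d t))) (at t)"
      by (rule derivative_eq_intros D refl | simp add: algebra_simps)+
    have "d t \<bullet> d' t \<le> norm (d t) * norm (d' t)" by (rule norm_cauchy_schwarz)
    also have "\<dots> \<le> norm (d t) * (M * norm (d t))" using bound t by (intro mult_left_mono) auto
    finally have "d t \<bullet> d' t \<le> M * (d t \<bullet> d t)" by (simp add: dot_square_norm power2_eq_square mult_ac)
    then show "\<exists>y. (?e has_real_derivative y) (at t) \<and> y \<le> 0"
      by (intro exI[of _ "exp (- 2 * M * t) * (2 * (d t \<bullet> d' t) - 2 * M * (d t \<bullet> d t))"] conjI E)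
        (simp add: mult_nonneg_nonpos)
  qed
  then have "d r \<bullet> d r \<le> 0" using d0 by (simp add: mult_le_0_iff)
  then show ?thesis using inner_ge_zero[of "d r"] by (simp add: antisym)
qed

text \<open>The factor \<open>v\<close> allows a curve of variable speed to be compared with a unit-speed one without
  inverting its arc length.\<close>

theorem time_changed_ode_unique:
  fixes F :: "'a::euclidean_space \<Rightarrow> 'a" and v :: "real \<Rightarrow> real"
  assumes y1: "\<And>t. (y1 has_vector_derivative v t *\<^sub>R F (y1 t)) (at t)"
    and y2: "\<And>t. (y2 has_vector_derivative v t *\<^sub>R F (y2 t)) (at t)"
    and v: "continuous_on UNIV v" and init: "y1 t0 = y2 t0"
    and lip: "\<And>X1. compact X1 \<Longrightarrow> X1 \<subseteq> U \<Longrightarrow> \<exists>L. L-lipschitz_on X1 F"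
    and U: "\<And>t. y1 t \<in> U" "\<And>t. y2 t \<in> U"
  shows "y1 = y2"
proof
  have half: "z1 r = z2 r"
    if z1: "\<And>t. (z1 has_vector_derivative w t *\<^sub>R F (z1 t)) (at t)"
      and z2: "\<And>t. (z2 has_vector_derivative w t *\<^sub>R F (z2 t)) (at t)"
      and w: "continuous_on UNIV w" and "z1 0 = z2 0" and r: "r \<ge> 0"
      and U: "\<And>t. z1 t \<in> U" "\<And>t. z2 t \<in> U"
    for z1 z2 :: "real \<Rightarrow> 'a" and w :: "real \<Rightarrow> real" and r
  proof -
    have cont: "continuous_on {0..r} z1" "continuous_on {0..r} z2"
      using z1 z2 has_vector_derivative_continuous by (blast intro: continuous_at_imp_continuous_on)+
    \<comment> \<open>The field is Lipschitz only on compact subsets of \<open>U\<close>; the traces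
      of both solutions over \<open>{0..r}\<close> together form one, which yields a common
      constant.\<close>
    have "compact (z1 ` {0..r} \<union> z2 ` {0..r})"
      using cont by (intro compact_Un compact_continuous_image) auto
    with lip[of "z1 ` {0..r} \<union> z2 ` {0..r}"] U
    obtain L where L: "L-lipschitz_on (z1 ` {0..r} \<union> z2 ` {0..r}) F" by auto
    have "compact (w ` {0..r})"
      using w by (intro compact_continuous_image) (auto intro: continuous_on_subset)
    then obtain V where V: "\<And>t. t \<in> {0..r} \<Longrightarrow> \<bar>w t\<bar> \<le> V"
      by (fastforce dest!: compact_imp_bounded simp: bounded_iff)
    have "z1 r - z2 r = 0"
    proof (rule gronwall_zero[where d = "\<lambda>t. z1 t - z2 t"])
      show "((\<lambda>t. z1 t - z2 t) has_vector_derivative w t *\<^sub>R F (z1 t) - w t *\<^sub>R F (z2 t)) (at t)" for t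
        by (rule has_vector_derivative_diff[OF z1 z2])
      show "norm (w t *\<^sub>R F (z1 t) - w t *\<^sub>R F (z2 t)) \<le> V * L * norm (z1 t - z2 t)"
        if t: "t \<in> {0..r}" for t
      proof -
        have "norm (w t *\<^sub>R F (z1 t) - w t *\<^sub>R F (z2 t)) = \<bar>w t\<bar> * norm (F (z1 t) - F (z2 t))"
          by (simp add: scaleR_diff_right[symmetric])
        also have "\<dots> \<le> V * (L * norm (z1 t - z2 t))"
          using V[OF t] lipschitz_on_normD[OF L, of "z1 t" "z2 t"] t
          by (intro mult_mono) auto
        finally show ?thesis by (simp add: mult.assoc)
      qed
    qed (use that in auto)
    then show ?thesis by simp
  qed
  fix t
  show "y1 t = y2 t"
  proof (cases "t \<ge> t0")
    case True
    have sh: "((\<lambda>s. y (t0 + s)) has_vector_derivative v (t0 + s) *\<^sub>R F (y (t0 + s))) (at s)"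
      if "\<And>t. (y has_vector_derivative v t *\<^sub>R F (y t)) (at t)" for y s
      using has_vector_derivative_affine[of y _ t0 1 s] that[of "t0 + s"] by simp
    have "continuous_on UNIV (\<lambda>s. v (t0 + s))"
      by (intro continuous_on_compose2[OF v] continuous_intros) auto
    from half[OF sh[OF y1] sh[OF y2] this, of "t - t0"] show ?thesis
      using True init U by simp
  next
    case False
    \<comment> \<open>Running time backwards from \<open>t0\<close> replaces \<open>v\<close> by
      \<open>- v\<close>; \<open>half\<close> covers this, since it puts no sign condition on its
      factor \<open>w\<close>.\<close>
    have sh: "((\<lambda>s. y (t0 - s)) has_vector_derivative (- v (t0 - s)) *\<^sub>R F (y (t0 - s))) (at s)"
      if "\<And>t. (y has_vector_derivative v t *\<^sub>R F (y t)) (at t)" for y s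
      using has_vector_derivative_affine[of y _ t0 "-1" s] that[of "t0 - s"] by simp
    have "continuous_on UNIV (\<lambda>s. - v (t0 - s))"
      by (intro continuous_intros continuous_on_compose2[OF v]) auto
    from half[OF sh[OF y1] sh[OF y2] this, of "t0 - t"] show ?thesis
      using False init U by simp
  qed
qed

section \<open>Frames and the Frenet field\<close>

text \<open>The usual vector product of three-space, after identifying
  \<open>complex \<times> real\<close> with triples (real part, imaginary part, height).\<close>

definition cross :: "complex \<times> real \<Rightarrow> complex \<times> real \<Rightarrow> complex \<times> real" where
  "cross p q = (\<i> * (of_real (snd p) * fst q - of_real (snd q) * fst p), Im (cnj (fst p) * fst q))"

lemma inner_cross_self [simp]: "cross p q \<bullet> p = 0" "cross p q \<bullet> q = 0" "p \<bullet> cross p q = 0" "q \<bullet> cross p q = 0"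
  by (auto simp: cross_def inner_prod_def inner_complex_def algebra_simps)

lemma cross_inner_cross: "cross p q \<bullet> cross p q = (p \<bullet> p) * (q \<bullet> q) - (p \<bullet> q)\<^sup>2"
  by (auto simp: cross_def inner_prod_def inner_complex_def algebra_simps power2_eq_square)

lemma cross_self [simp]: "cross p p = 0"
  by (auto simp: cross_def prod_eq_iff complex_eq_iff)

lemma bounded_bilinear_cross: "bounded_bilinear cross"
proof -
  have eq: "cross = (\<lambda>p q. (\<i> * (snd p *\<^sub>R fst q - snd q *\<^sub>R fst p), Im (cnj (fst p) * fst q)))"
    by (auto simp: cross_def scaleR_conv_of_real fun_eq_iff)
  show ?thesis
    unfolding bilinear_conv_bounded_bilinear[symmetric] bilinear_def eq
    by (auto intro!: linearI simp: algebra_simps prod_eq_iff complex_eq_iff)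
qed

lemmas cross_add_right = bounded_bilinear.add_right[OF bounded_bilinear_cross]
  and cross_scaleR_left = bounded_bilinear.scaleR_left[OF bounded_bilinear_cross]
  and cross_scaleR_right = bounded_bilinear.scaleR_right[OF bounded_bilinear_cross]
  and cross_minus_right = bounded_bilinear.minus_right[OF bounded_bilinear_cross]
  and has_vector_derivative_cross = bounded_bilinear.has_vector_derivative[OF bounded_bilinear_cross]

lemma cross_cross_right: "cross p (cross p q) = (p \<bullet> q) *\<^sub>R p - (p \<bullet> p) *\<^sub>R q"
  by (auto simp: cross_def inner_prod_def inner_complex_def algebra_simps prod_eq_iff complex_eq_iff)

text \<open>\<open>p\<close>, \<open>q\<close> and their product are three orthonormal vectors in a
  space of dimension 3, hence span it. The remainder \<open>y\<close> is orthogonal to all three and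
  therefore to itself.\<close>

lemma orthonormal_frame_expansion:
  assumes "p \<bullet> p = 1" "q \<bullet> q = 1" "p \<bullet> q = 0"
  shows "x = (x \<bullet> p) *\<^sub>R p + (x \<bullet> q) *\<^sub>R q + (x \<bullet> cross p q) *\<^sub>R cross p q"
proof -
  let ?B = "{p, q, cross p q}"
  define y where "y = x - ((x \<bullet> p) *\<^sub>R p + (x \<bullet> q) *\<^sub>R q + (x \<bullet> cross p q) *\<^sub>R cross p q)"
  have nu: "cross p q \<bullet> cross p q = 1" using assms by (simp add: cross_inner_cross)
  have ne: "p \<noteq> q" "p \<noteq> cross p q" "q \<noteq> cross p q"
    using assms inner_cross_self by (metis zero_neq_one)+
  have nz: "0 \<notin> ?B" using assms nu by auto
  have "pairwise orthogonal ?B"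
    using assms by (auto simp: pairwise_def orthogonal_def inner_commute)
  then have "independent ?B" using nz by (rule pairwise_orthogonal_independent)
  then have "UNIV \<subseteq> span ?B"
    by (rule card_ge_dim_independent[OF subset_UNIV])
      (use ne in \<open>simp add: dim_UNIV\<close>)
  then have "y \<in> span ?B" by auto
  moreover have "orthogonal y b" if "b \<in> ?B" for b
    using that assms nu by (auto simp: y_def orthogonal_def inner_diff_left inner_add_left inner_commute[of q p])
  ultimately have "orthogonal y y" by (meson orthogonal_to_span)
  then show ?thesis by (simp add: y_def orthogonal_self)
qed

text \<open>This is the expansion of \<open>(0, 1)\<close> in the frame, read in the third
  coordinate. Along a trajectory it becomes the energy identity
  \<open>b^2 + b'^2 + \<nu>\<^sub>b^2 = 1\<close> for the height.\<close>

lemma orthonormal_frame_third_coordinate: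
  assumes "p \<bullet> p = 1" "q \<bullet> q = 1" "p \<bullet> q = 0"
  shows "(snd p)\<^sup>2 + (snd q)\<^sup>2 + (snd (cross p q))\<^sup>2 = 1"
  using arg_cong[OF orthonormal_frame_expansion[OF assms, of "(0,1)"], of snd]
  by (simp add: inner_prod_def power2_eq_square)

text \<open>Frenet's equations on the unit sphere for a unit-speed curve \<open>p\<close> with
  tangent \<open>q\<close>: the term \<open>- p\<close> keeps the curve on the sphere, and the
  coefficient of \<open>cross p q\<close> is the geodesic curvature that the mean curvature equation
  prescribes.\<close>

definition curve_field :: "real \<Rightarrow> real \<Rightarrow> (complex \<times> real) \<times> (complex \<times> real) \<Rightarrow> (complex \<times> real) \<times> (complex \<times> real)" where
  "curve_field h \<mu> = (\<lambda>(p, q). (q, - p + (h + \<mu> * snd (cross p q) / snd p) *\<^sub>R cross p q))"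

text \<open>Products of Lipschitz functions need not be Lipschitz, but products of bounded ones are.
  Carrying the bound along lets the field be assembled factor by factor.\<close>

definition bounded_lipschitz :: "'a::metric_space set \<Rightarrow> ('a \<Rightarrow> 'b::real_normed_vector) \<Rightarrow> bool" where
  "bounded_lipschitz K f \<longleftrightarrow> (\<exists>L. L-lipschitz_on K f) \<and> (\<exists>B\<ge>0. \<forall>x\<in>K. norm (f x) \<le> B)"

lemma bounded_lipschitz_bounded_linear:
  assumes "bounded_linear f" "bounded K"
  shows "bounded_lipschitz K f"
proof -
  have "bounded (f ` K)" using bounded_linear_image[OF assms(2,1)] .
  then obtain B where "\<forall>x\<in>f ` K. norm x \<le> B" by (auto simp: bounded_iff)
  then have "\<forall>x\<in>K. norm (f x) \<le> max B 0" by (simp add: max.coboundedI1)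
  moreover obtain L where "L-lipschitz_on K f"
    using bounded_linear.lipschitz_boundE[OF assms(1)] by blast
  ultimately show ?thesis unfolding bounded_lipschitz_def by (meson max.cobounded2)
qed

lemma bounded_lipschitz_const: "bounded_lipschitz K (\<lambda>_. c)"
  unfolding bounded_lipschitz_def using lipschitz_on_constant[of K c] by (auto intro: exI[of _ "norm c"])

lemma bounded_lipschitz_bilinear:
  assumes f: "bounded_lipschitz K f" and g: "bounded_lipschitz K g" and b: "bounded_bilinear b"
  shows "bounded_lipschitz K (\<lambda>x. b (f x) (g x))"
proof -
  interpret bounded_bilinear b by fact
  obtain L1 B1 where f: "L1-lipschitz_on K f" "B1 \<ge> 0" "\<And>x. x \<in> K \<Longrightarrow> norm (f x) \<le> B1"
    using f by (auto simp: bounded_lipschitz_def)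
  obtain L2 B2 where g: "L2-lipschitz_on K g" "B2 \<ge> 0" "\<And>x. x \<in> K \<Longrightarrow> norm (g x) \<le> B2"
    using g by (auto simp: bounded_lipschitz_def)
  obtain C where C: "C \<ge> 0" "\<And>x y. norm (b x y) \<le> norm x * norm y * C"
    using nonneg_bounded by blast
  have L: "L1 \<ge> 0" "L2 \<ge> 0" using f g lipschitz_on_nonneg by blast+
  have "(L1 * B2 * C + B1 * L2 * C)-lipschitz_on K (\<lambda>x. b (f x) (g x))"
  proof (rule lipschitz_onI)
    fix x y assume xy: "x \<in> K" "y \<in> K"
    have "norm (b (f x) (g x) - b (f y) (g y)) = norm (b (f x - f y) (g x) + b (f y) (g x - g y))"
      by (simp add: diff_left diff_right)
    also have "\<dots> \<le> norm (f x - f y) * norm (g x) * C + norm (f y) * norm (g x - g y) * C"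
      by (intro norm_triangle_le add_mono C)
    also have "\<dots> \<le> (L1 * dist x y) * B2 * C + B1 * (L2 * dist x y) * C"
      using f g xy C L lipschitz_onD[OF f(1) xy] lipschitz_onD[OF g(1) xy]
      by (intro add_mono mult_mono mult_right_mono) (auto simp: dist_norm)
    finally show "dist (b (f x) (g x)) (b (f y) (g y)) \<le> (L1 * B2 * C + B1 * L2 * C) * dist x y"
      by (simp add: dist_norm algebra_simps)
  qed (use L f g C in simp)
  moreover have "norm (b (f x) (g x)) \<le> B1 * B2 * C" if "x \<in> K" for x
  proof -
    have "norm (b (f x) (g x)) \<le> norm (f x) * norm (g x) * C" by (rule C)
    also have "\<dots> \<le> B1 * B2 * C" using f g that C by (intro mult_mono mult_right_mono) auto
    finally show ?thesis .
  qed
  moreover have "B1 * B2 * C \<ge> 0" using f g C by simp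
  ultimately show ?thesis unfolding bounded_lipschitz_def by blast
qed

lemma bounded_lipschitz_add:
  assumes "bounded_lipschitz K f" "bounded_lipschitz K g"
  shows "bounded_lipschitz K (\<lambda>x. f x + g x)"
proof -
  obtain L1 B1 L2 B2 where *: "L1-lipschitz_on K f" "B1 \<ge> 0" "\<forall>x\<in>K. norm (f x) \<le> B1"
      "L2-lipschitz_on K g" "B2 \<ge> 0" "\<forall>x\<in>K. norm (g x) \<le> B2"
    using assms by (auto simp: bounded_lipschitz_def)
  have "\<forall>x\<in>K. norm (f x + g x) \<le> B1 + B2" using * by (meson norm_triangle_mono)
  then show ?thesis unfolding bounded_lipschitz_def
    using lipschitz_on_add[OF *(1,4)] *(2,5) by (meson add_nonneg_nonneg)
qed

lemma bounded_lipschitz_Pair: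
  assumes "bounded_lipschitz K f" "bounded_lipschitz K g"
  shows "bounded_lipschitz K (\<lambda>x. (f x, g x))"
proof -
  obtain L1 B1 L2 B2 where *: "L1-lipschitz_on K f" "B1 \<ge> 0" "\<forall>x\<in>K. norm (f x) \<le> B1"
      "L2-lipschitz_on K g" "B2 \<ge> 0" "\<forall>x\<in>K. norm (g x) \<le> B2"
    using assms by (auto simp: bounded_lipschitz_def)
  have "\<forall>x\<in>K. norm (f x, g x) \<le> B1 + B2" using * by (meson norm_Pair_le add_mono order_trans)
  then show ?thesis unfolding bounded_lipschitz_def
    using lipschitz_on_Pair[OF *(1,4)] *(2,5) by (meson add_nonneg_nonneg)
qed

lemma bounded_lipschitz_inverse:
  fixes f :: "'a::metric_space \<Rightarrow> real"
  assumes f: "bounded_lipschitz K f" and \<beta>: "\<beta> > 0" "\<And>x. x \<in> K \<Longrightarrow> f x \<ge> \<beta>"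
  shows "bounded_lipschitz K (\<lambda>x. inverse (f x))"
proof -
  obtain L where L: "L-lipschitz_on K f" using f by (auto simp: bounded_lipschitz_def)
  then have L0: "L \<ge> 0" by (rule lipschitz_on_nonneg)
  have inv: "0 < inverse (f x)" "inverse (f x) \<le> inverse \<beta>" if "x \<in> K" for x
    using \<beta>(1) \<beta>(2)[OF that] by (auto intro: le_imp_inverse_le)
  have "(inverse \<beta> * L * inverse \<beta>)-lipschitz_on K (\<lambda>x. inverse (f x))"
  proof (rule lipschitz_onI)
    fix x y assume xy: "x \<in> K" "y \<in> K"
    have nz: "f x \<noteq> 0" "f y \<noteq> 0" using \<beta>(2)[OF xy(1)] \<beta>(2)[OF xy(2)] \<beta>(1) by auto
    have "dist (inverse (f x)) (inverse (f y)) = inverse (f x) * dist (f x) (f y) * inverse (f y)"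
      using inv[OF xy(1)] inv[OF xy(2)] by (simp add: dist_real_def inverse_diff_inverse[OF nz] abs_mult)
    also have "\<dots> \<le> inverse \<beta> * (L * dist x y) * inverse \<beta>"
      using inv[OF xy(1)] inv[OF xy(2)] lipschitz_onD[OF L xy] \<beta>(1) L0 by (intro mult_mono) auto
    finally show "dist (inverse (f x)) (inverse (f y)) \<le> inverse \<beta> * L * inverse \<beta> * dist x y"
      by (simp add: mult_ac)
  qed (use \<beta>(1) L0 in simp)
  moreover have "\<forall>x\<in>K. norm (inverse (f x)) \<le> inverse \<beta>" using inv by (force simp: abs_if)
  moreover have "inverse \<beta> \<ge> 0" using \<beta>(1) by simp
  ultimately show ?thesis unfolding bounded_lipschitz_def by blast
qed

text \<open>Everything in the field is built from linear and bilinear maps except the factor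
  \<open>1/b\<close>, which the lower bound \<open>\<beta>\<close> controls.\<close>

lemma curve_field_lipschitz:
  assumes K: "bounded K" and \<beta>: "\<beta> > 0" "\<And>Y. Y \<in> K \<Longrightarrow> snd (fst Y) \<ge> \<beta>"
  shows "\<exists>L. L-lipschitz_on K (curve_field h \<mu>)"
proof -
  have lin: "bounded_lipschitz K f" if "linear f" for f :: "(complex \<times> real) \<times> (complex \<times> real) \<Rightarrow> 'c::euclidean_space"
    using that K by (intro bounded_lipschitz_bounded_linear) (auto simp: linear_conv_bounded_linear)
  have 1: "bounded_lipschitz K fst" "bounded_lipschitz K snd"
      "bounded_lipschitz K (\<lambda>Y. snd (fst Y))" "bounded_lipschitz K (\<lambda>Y. - fst Y)"
    by (auto intro!: lin linearI)
  have nu: "bounded_lipschitz K (\<lambda>Y. cross (fst Y) (snd Y))"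
    by (rule bounded_lipschitz_bilinear[OF 1(1,2) bounded_bilinear_cross])
  \<comment> \<open>The inner product with \<open>(0, 1)\<close> extracts the third coordinate, so
    the bilinear rule applies once more.\<close>
  have nub: "bounded_lipschitz K (\<lambda>Y. snd (cross (fst Y) (snd Y)))"
    using bounded_lipschitz_bilinear[OF bounded_lipschitz_const[of K "(0::complex, 1::real)"] nu bounded_bilinear_inner]
    by (simp add: inner_prod_def)
  have inv: "bounded_lipschitz K (\<lambda>Y. inverse (snd (fst Y)))"
    using \<beta> by (rule bounded_lipschitz_inverse[OF 1(3)])
  have \<kappa>: "bounded_lipschitz K (\<lambda>Y. h + \<mu> * (snd (cross (fst Y) (snd Y)) * inverse (snd (fst Y))))"
    by (intro bounded_lipschitz_add bounded_lipschitz_const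
        bounded_lipschitz_bilinear[OF _ _ bounded_bilinear_mult] nub inv)
  have "bounded_lipschitz K (curve_field h \<mu>)"
    using bounded_lipschitz_Pair[OF 1(2) bounded_lipschitz_add[OF 1(4)
      bounded_lipschitz_bilinear[OF \<kappa> nu bounded_bilinear_scaleR]]]
    by (simp add: curve_field_def divide_inverse case_prod_unfold mult.assoc)
  then show ?thesis by (auto simp: bounded_lipschitz_def)
qed

section \<open>Mean curvature of rotational hypersurfaces\<close>

text \<open>A great circle in the sphere factor, combined with a line in the interval, realizes any
  tangent vector as a velocity within the domain. Such curves are what makes derivatives within the
  domain unique on tangent vectors.\<close>

lemma param_tangent_curve:
  fixes q u :: "real \<times> (real ^ 'm::finite)"
  assumes q: "q \<in> param_domain I" and I: "open I" and u: "u \<in> param_tangent q"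
  shows "\<exists>c S. open S \<and> (0::real) \<in> S \<and> c ` S \<subseteq> param_domain I \<and> c 0 = q \<and> (c has_vector_derivative u) (at 0)"
proof -
  obtain t x where q_eq: "q = (t, x)" by (rule prod.exhaust)
  obtain \<tau> y where u_eq: "u = (\<tau>, y)" by (rule prod.exhaust)
  have x: "norm x = 1" and t: "t \<in> I" using q unfolding q_eq param_domain_def by simp_all
  have xy: "x \<bullet> y = 0" using u unfolding q_eq u_eq param_tangent_def by simp
  \<comment> \<open>If \<open>y = 0\<close>, then \<open>sgn y = 0\<close> and \<open>c\<close>
    stays at \<open>x\<close> in the sphere factor; otherwise \<open>x\<close> and
    \<open>sgn y\<close> are orthonormal.\<close>
  define c where "c \<epsilon> = (t + \<epsilon> * \<tau>, cos (\<epsilon> * norm y) *\<^sub>R x + sin (\<epsilon> * norm y) *\<^sub>R sgn y)" for \<epsilon>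
  define S where "S = {\<epsilon>. t + \<epsilon> * \<tau> \<in> I}"
  have "continuous_on UNIV (\<lambda>\<epsilon>. t + \<epsilon> * \<tau>)" by (intro continuous_intros)
  from open_vimage[OF I this] have S: "open S" unfolding S_def vimage_def .
  have S0: "0 \<in> S" using t by (simp add: S_def)
  have y: "norm y *\<^sub>R sgn y = y" unfolding sgn_div_norm by (cases "y = 0") simp_all
  have dc: "(c has_vector_derivative u) (at 0)"
  proof -
    have lin: "((\<lambda>\<epsilon>. t + \<epsilon> * \<tau>) has_vector_derivative \<tau>) (at 0)"
      unfolding has_real_derivative_iff_has_vector_derivative[symmetric]
      by (rule derivative_eq_intros refl | simp)+
    have co: "((\<lambda>\<epsilon>. cos (\<epsilon> * norm y)) has_real_derivative 0) (at 0)"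
      by (rule derivative_eq_intros refl | simp)+
    have si: "((\<lambda>\<epsilon>. sin (\<epsilon> * norm y)) has_real_derivative norm y) (at 0)"
      by (rule derivative_eq_intros refl | simp)+
    from has_vector_derivative_Pair[OF lin has_vector_derivative_add[OF
        has_vector_derivative_scaleR[OF co has_vector_derivative_const[of x]]
        has_vector_derivative_scaleR[OF si has_vector_derivative_const[of "sgn y"]]]]
    show ?thesis unfolding c_def u_eq using y by simp
  qed
  have unit: "norm (cos a *\<^sub>R x + sin a *\<^sub>R sgn y) = 1" if "y \<noteq> 0" for a
  proof -
    have 1: "x \<bullet> x = 1" "sgn y \<bullet> sgn y = 1" "x \<bullet> sgn y = 0"
      using x xy that by (simp_all add: dot_square_norm norm_sgn) (simp add: sgn_div_norm)
    have "(cos a *\<^sub>R x + sin a *\<^sub>R sgn y) \<bullet> (cos a *\<^sub>R x + sin a *\<^sub>R sgn y) = (cos a)\<^sup>2 + (sin a)\<^sup>2"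
      unfolding inner_add_left inner_add_right inner_scaleR_left inner_scaleR_right inner_commute[of "sgn y" x] 1
      by (simp add: power2_eq_square)
    then show ?thesis by (simp add: norm_eq_sqrt_inner)
  qed
  have "c \<epsilon> \<in> param_domain I" if "\<epsilon> \<in> S" for \<epsilon>
  proof (cases "y = 0")
    case True
    then show ?thesis using that x unfolding c_def S_def param_domain_def by simp
  next
    case False
    then show ?thesis using that unit[OF False] unfolding c_def S_def param_domain_def by simp
  qed
  then have cS: "c ` S \<subseteq> param_domain I" by (rule image_subsetI)
  have c0: "c 0 = q" unfolding c_def q_eq by simp
  show ?thesis using S S0 cS c0 dc by (intro exI[of _ c] exI[of _ S] conjI)
qed

text \<open>The domain is a hypersurface, so a derivative within it is arbitrary in the normal
  direction. On a tangent vector, composing with a curve inside the domain reduces uniqueness to one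
  real variable.\<close>

lemma param_derivative_unique:
  fixes f :: "real \<times> (real ^ 'm::finite) \<Rightarrow> 'b::real_normed_vector"
  assumes D1: "(f has_derivative D1) (at q within param_domain I)"
    and D2: "(f has_derivative D2) (at q within param_domain I)"
    and q: "q \<in> param_domain I" and I: "open I" and u: "u \<in> param_tangent q"
  shows "D1 u = D2 u"
proof -
  obtain c S where S: "open S" "(0::real) \<in> S" and cS: "c ` S \<subseteq> param_domain I" and c0: "c 0 = q"
    and dc: "(c has_vector_derivative u) (at 0)"
    using param_tangent_curve[OF q I u] by (elim exE conjE)
  have dc': "(c has_derivative (\<lambda>r. r *\<^sub>R u)) (at 0 within S)"
    using dc unfolding has_vector_derivative_def by (rule has_derivative_at_withinI)
  have D: "((f \<circ> c) has_vector_derivative D u) (at 0)"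
    if D: "(f has_derivative D) (at q within param_domain I)" for D
  proof -
    have "(f has_derivative D) (at (c 0) within c ` S)"
      using D cS unfolding c0 by (rule has_derivative_subset)
    from diff_chain_within[OF dc' this]
    have 1: "((f \<circ> c) has_derivative (D \<circ> (\<lambda>r. r *\<^sub>R u))) (at 0 within S)" .
    have 2: "D \<circ> (\<lambda>r. r *\<^sub>R u) = (\<lambda>r. r *\<^sub>R D u)"
      unfolding o_def using linear_cmul[OF has_derivative_linear[OF D]] by (rule ext)
    show ?thesis
      using 1 unfolding has_vector_derivative_def at_within_open[OF S(2,1)] 2 .
  qed
  show ?thesis by (rule vector_derivative_unique_at[OF D[OF D1] D[OF D2]])
qed

text \<open>The derivative of \<open>rot_hyp\<close> at a point with profile position
  \<open>p\<close>, profile velocity \<open>p'\<close> and sphere point \<open>x\<close>. It serves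
  for the immersion and for its normal alike, because the normal is itself \<open>rot_hyp\<close> of
  a curve.\<close>

definition drot :: "complex \<times> real \<Rightarrow> complex \<times> real \<Rightarrow> (real ^ 'm) \<Rightarrow> real \<times> (real ^ 'm::finite) \<Rightarrow> complex \<times> (real ^ 'm)" where
  "drot p p' x = (\<lambda>u. (fst u *\<^sub>R fst p', (fst u * snd p') *\<^sub>R x + snd p *\<^sub>R snd u))"

lemma rot_hyp_has_derivative:
  fixes x :: "real ^ 'm::finite"
  assumes "(\<gamma> has_vector_derivative \<gamma>') (at t)"
  shows "(rot_hyp \<gamma> has_derivative drot (\<gamma> t) \<gamma>' x) (at (t, x))"
proof -
  have g: "(\<gamma> has_derivative (\<lambda>r. r *\<^sub>R \<gamma>')) (at (fst (t, x)))"
    using assms unfolding has_vector_derivative_def fst_conv .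
  have f: "(fst has_derivative fst) (at (t, x))" "(snd has_derivative snd) (at (t, x))"
    by (rule bounded_linear_imp_has_derivative[OF bounded_linear_fst] bounded_linear_imp_has_derivative[OF bounded_linear_snd])+
  have c: "((\<lambda>q. \<gamma> (fst q)) has_derivative (\<lambda>u. fst u *\<^sub>R \<gamma>')) (at (t, x))"
    by (rule has_derivative_compose[OF f(1) g])
  have "((\<lambda>q. (fst (\<gamma> (fst q)), snd (\<gamma> (fst q)) *\<^sub>R snd q)) has_derivative
      (\<lambda>u. (fst (fst u *\<^sub>R \<gamma>'), snd (\<gamma> (fst (t, x))) *\<^sub>R snd u + snd (fst u *\<^sub>R \<gamma>') *\<^sub>R snd (t, x)))) (at (t, x))"
    by (rule has_derivative_Pair[OF has_derivative_fst[OF c] has_derivative_scaleR[OF has_derivative_snd[OF c] f(2)]])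
  moreover have "(\<lambda>q::real \<times> (real ^ 'm). (fst (\<gamma> (fst q)), snd (\<gamma> (fst q)) *\<^sub>R snd q)) = rot_hyp \<gamma>"
    by (simp add: rot_hyp_def case_prod_unfold)
  moreover have "(\<lambda>u::real \<times> (real ^ 'm). (fst (fst u *\<^sub>R \<gamma>'), snd (\<gamma> (fst (t, x))) *\<^sub>R snd u + snd (fst u *\<^sub>R \<gamma>') *\<^sub>R snd (t, x))) = drot (\<gamma> t) \<gamma>' x"
    unfolding drot_def by (rule ext) (simp only: fst_conv snd_conv fst_scaleR snd_scaleR real_scaleR_def add.commute)
  ultimately show ?thesis by (simp only:)
qed

lemma drot_inner:
  assumes "norm x = 1" "x \<bullet> snd u = 0" "x \<bullet> snd w = 0"
  shows "drot p p' x u \<bullet> drot r r' x w = fst u * fst w * (p' \<bullet> r') + snd p * snd r * (snd u \<bullet> snd w)"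
proof -
  have 1: "x \<bullet> x = 1" using assms(1) by (simp add: dot_square_norm)
  have 2: "snd u \<bullet> x = 0" using assms(2) by (simp add: inner_commute)
  show ?thesis
    unfolding drot_def inner_prod_def fst_conv snd_conv inner_add_left inner_add_right
      inner_scaleR_left inner_scaleR_right 1 2 assms(3)
    by (simp add: algebra_simps)
qed

lemma drot_linear: "linear (drot p p' x)"
  unfolding drot_def
  by (rule linearI) (simp_all add: scaleR_add_left scaleR_add_right distrib_left distrib_right mult_ac)

lemma param_tangent_hyperplane: "param_tangent (t, x) = {u. (0, x) \<bullet> u = 0}"
  by (auto simp: param_tangent_def inner_prod_def)

text \<open>The basis \<open>E\<close> is arbitrary, so nothing is diagonalized. For
  \<open>u\<close> in \<open>E\<close> both forms depend only on \<open>(fst u)^2\<close> and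
  \<open>|snd u|^2\<close>; orthonormality eliminates the latter, and the sum of the former is found
  by expanding the profile direction \<open>(1, 0)\<close> in \<open>E\<close>.\<close>

lemma drot_trace:
  fixes x :: "real ^ 'm::finite"
  assumes x: "norm x = 1" and E: "finite E" "E \<subseteq> param_tangent (t, x)" "span E = param_tangent (t, x)"
    and orth: "\<And>u w. u \<in> E \<Longrightarrow> w \<in> E \<Longrightarrow> drot p p' x u \<bullet> drot p p' x w = (if u = w then 1 else 0)"
    and p: "p' \<noteq> 0" "snd p \<noteq> 0"
  shows "(\<Sum>u\<in>E. - (drot r r' x u \<bullet> drot p p' x u))
    = - (r' \<bullet> p') / (p' \<bullet> p') - (real CARD('m) - 1) * (snd r / snd p)"
proof -
  have tan: "x \<bullet> snd u = 0" if "u \<in> E" for u using E(2) that by (auto simp: param_tangent_def)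
  have coef: "c w = drot p p' x (\<Sum>u\<in>E. c u *\<^sub>R u) \<bullet> drot p p' x w" if "w \<in> E" for c w
  proof -
    have "drot p p' x (\<Sum>u\<in>E. c u *\<^sub>R u) \<bullet> drot p p' x w = (\<Sum>u\<in>E. c u * (drot p p' x u \<bullet> drot p p' x w))"
      by (simp add: linear_sum[OF drot_linear] linear_cmul[OF drot_linear] inner_sum_left)
    also have "\<dots> = (\<Sum>u\<in>E. if u = w then c u else 0)"
      by (rule sum.cong) (use orth that in auto)
    also have "\<dots> = c w" using E(1) that by simp
    finally show ?thesis ..
  qed
  have ind: "independent E"
  proof (rule independent_if_scalars_zero[OF E(1)])
    fix c w assume "(\<Sum>u\<in>E. c u *\<^sub>R u) = 0" "w \<in> E"
    with coef[of w c] show "c w = 0" by (simp add: linear_0[OF drot_linear])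
  qed
  have "card E = dim (param_tangent (t, x))"
    using dim_span_eq_card_independent[OF ind] E(3) by simp
  also have "\<dots> = CARD('m)"
    unfolding param_tangent_hyperplane using x by (subst dim_hyperplane) (auto simp: zero_prod_def)
  finally have card: "card E = CARD('m)" .
  have "(1, 0) \<in> span E" unfolding E(3) by (simp add: param_tangent_def)
  then obtain c where c: "(1, 0) = (\<Sum>u\<in>E. c u *\<^sub>R u)"
    unfolding span_finite[OF E(1)] by auto
  define V A \<rho> where "V = p' \<bullet> p'" and "A = r' \<bullet> p'" and "\<rho> = snd r / snd p"
  have V: "V \<noteq> 0" using p by (simp add: V_def)
  have cu: "c u = fst u * V" if "u \<in> E" for u
  proof -
    have "c u = drot p p' x (1, 0) \<bullet> drot p p' x u" using coef[OF that, of c] unfolding c .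
    also have "\<dots> = fst u * V" using tan[OF that] by (subst drot_inner[OF x]) (simp_all add: V_def)
    finally show ?thesis .
  qed
  have "1 = (\<Sum>u\<in>E. c u * fst u)" using arg_cong[OF c, of fst] by (simp add: fst_sum)
  also have "\<dots> = V * (\<Sum>u\<in>E. (fst u)\<^sup>2)"
    unfolding sum_distrib_left by (rule sum.cong) (auto simp: cu power2_eq_square)
  finally have S: "(\<Sum>u\<in>E. (fst u)\<^sup>2) = 1 / V" using V by (simp add: field_simps)
  \<comment> \<open>\<open>\<rho>\<close> is the common factor of the rotational directions; the
    profile direction deviates from it by \<open>A - \<rho> V\<close>.\<close>
  have "- (drot r r' x u \<bullet> drot p p' x u) = - \<rho> - (A - \<rho> * V) * (fst u)\<^sup>2" if u: "u \<in> E" for u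
  proof -
    define y where "y = snd u \<bullet> snd u"
    have 1: "fst u * fst u * V + snd p * snd p * y = 1"
      using orth[OF u u] drot_inner[OF x tan[OF u] tan[OF u], of p p' p p'] unfolding V_def y_def by simp
    have 2: "drot r r' x u \<bullet> drot p p' x u = fst u * fst u * A + snd r * snd p * y"
      unfolding drot_inner[OF x tan[OF u] tan[OF u]] A_def y_def ..
    have "snd r = \<rho> * snd p" using p by (simp add: \<rho>_def)
    then have "snd r * snd p * y = \<rho> * (snd p * snd p * y)" by simp
    also have "\<dots> = \<rho> * (1 - fst u * fst u * V)" using 1 by (metis add_diff_cancel_left')
    finally show ?thesis unfolding 2 by (simp add: power2_eq_square algebra_simps)
  qed
  then have "(\<Sum>u\<in>E. - (drot r r' x u \<bullet> drot p p' x u)) = (\<Sum>u\<in>E. - \<rho> - (A - \<rho> * V) * (fst u)\<^sup>2)"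
    by (rule sum.cong[OF refl])
  also have "\<dots> = - \<rho> * real (card E) - (A - \<rho> * V) * (\<Sum>u\<in>E. (fst u)\<^sup>2)"
    by (simp add: sum_subtractf sum_distrib_left[symmetric] sum_negf)
  also have "\<dots> = - A / V - (real CARD('m) - 1) * \<rho>"
    unfolding S card using V by (simp add: field_simps)
  finally show ?thesis unfolding V_def A_def \<rho>_def .
qed

text \<open>The induced metric is \<open>|p'|^2\<close> times the metric of the line plus
  \<open>(snd p)^2\<close> times that of the sphere, so rescaling the two components of a Euclidean
  orthonormal basis suffices.\<close>

lemma drot_orthonormal_basis:
  fixes x :: "real ^ 'm::finite"
  assumes x: "norm x = 1" and p: "p' \<noteq> 0" "snd p \<noteq> 0"
  shows "\<exists>E. finite E \<and> E \<subseteq> param_tangent (t, x) \<and> span E = param_tangent (t, x) \<and>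
    (\<forall>u\<in>E. \<forall>w\<in>E. drot p p' x u \<bullet> drot p p' x w = (if u = w then 1 else 0))"
proof -
  have "subspace (param_tangent (t, x))" unfolding param_tangent_hyperplane by (rule subspace_hyperplane)
  then obtain B where B: "B \<subseteq> param_tangent (t, x)" "pairwise orthogonal B" "\<And>u. u \<in> B \<Longrightarrow> norm u = 1"
      "independent B" "card B = dim (param_tangent (t, x))" "span B = param_tangent (t, x)"
    by (rule orthonormal_basis_subspace) blast
  define f where "f u = (fst u / norm p', snd u /\<^sub>R snd p)" for u :: "real \<times> (real ^ 'm)"
  have f: "linear f" unfolding f_def
    by (auto intro!: linearI simp: algebra_simps add_divide_distrib)
  have fT: "f u \<in> param_tangent (t, x)" if "u \<in> param_tangent (t, x)" for u
    using that by (auto simp: f_def param_tangent_def)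
  have "f (norm p' * fst u, snd p *\<^sub>R snd u) = u" for u using p by (simp add: f_def)
  moreover have "(norm p' * fst u, snd p *\<^sub>R snd u) \<in> param_tangent (t, x)" if "u \<in> param_tangent (t, x)" for u
    using that by (auto simp: param_tangent_def)
  ultimately have "f ` param_tangent (t, x) = param_tangent (t, x)"
    using fT by (metis (no_types, lifting) image_eqI subsetI image_subsetI subset_antisym)
  then have span: "span (f ` B) = param_tangent (t, x)"
    using linear_span_image[OF f, of B] B(6) by simp
  have inner: "drot p p' x (f u) \<bullet> drot p p' x (f w) = u \<bullet> w"
    if "u \<in> B" "w \<in> B" for u w
  proof -
    have "u \<in> param_tangent (t, x)" "w \<in> param_tangent (t, x)" using that B(1) by auto
    then have "drot p p' x (f u) \<bullet> drot p p' x (f w)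
        = fst (f u) * fst (f w) * (p' \<bullet> p') + snd p * snd p * (snd (f u) \<bullet> snd (f w))"
      by (intro drot_inner x) (simp_all add: f_def param_tangent_def)
    also have "\<dots> = fst u * fst w + snd u \<bullet> snd w"
    proof -
      have "p' \<bullet> p' = norm p' * norm p'" by (simp add: dot_square_norm power2_eq_square)
      moreover have "snd p * snd p * (snd (f u) \<bullet> snd (f w)) = (snd p * inverse (snd p)) * (snd p * inverse (snd p)) * (snd u \<bullet> snd w)"
        unfolding f_def by (simp add: mult_ac)
      ultimately show ?thesis using p unfolding f_def by simp
    qed
    finally show ?thesis by (simp add: inner_prod_def)
  qed
  have orth: "u \<bullet> w = (if u = w then 1 else 0)" if "u \<in> B" "w \<in> B" for u w
    using B(2,3) that by (auto simp: pairwise_def orthogonal_def dot_square_norm)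
  have "finite B" using B(4) by (rule independent_imp_finite)
  moreover have "f ` B \<subseteq> param_tangent (t, x)" using fT B(1) by auto
  moreover have "\<forall>u\<in>f ` B. \<forall>w\<in>f ` B. drot p p' x u \<bullet> drot p p' x w = (if u = w then 1 else 0)"
  proof (intro ballI)
    fix u' w' assume "u' \<in> f ` B" "w' \<in> f ` B"
    then obtain u w where uw: "u \<in> B" "w \<in> B" and eq: "u' = f u" "w' = f w" by (elim imageE)
    have "f u = f w \<longleftrightarrow> u = w"
      using inner[OF uw] inner[OF uw(1,1)] orth[OF uw] orth[OF uw(1,1)] by (auto split: if_splits)
    then show "drot p p' x u' \<bullet> drot p p' x w' = (if u' = w' then 1 else 0)"
      using inner[OF uw] orth[OF uw] unfolding eq by simp
  qed
  ultimately show ?thesis using span by (intro exI[of _ "f ` B"]) auto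
qed

text \<open>\<open>has_mean_curvature\<close> only asserts that some derivatives and some basis
  produce \<open>H\<close>. Uniqueness on tangent vectors and \<open>drot_trace\<close> show that
  every choice produces the same number; conversely one orthonormal basis has to exist.\<close>

lemma has_mean_curvature_rot_hyp_iff:
  fixes x :: "real ^ 'm::finite"
  assumes I: "open I" "t \<in> I" and x: "norm x = 1"
    and \<gamma>: "(\<gamma> has_vector_derivative \<gamma>') (at t)" "\<gamma>' \<noteq> 0" "snd (\<gamma> t) \<noteq> 0"
    and \<nu>: "(\<nu> has_vector_derivative \<nu>') (at t)"
    and N: "\<And>q. q \<in> param_domain I \<Longrightarrow> N q = rot_hyp \<nu> q"
  shows "has_mean_curvature (param_domain I) param_tangent (rot_hyp \<gamma>) N (t, x) H \<longleftrightarrow>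
    H = - (\<nu>' \<bullet> \<gamma>') / (\<gamma>' \<bullet> \<gamma>') - (real CARD('m) - 1) * (snd (\<nu> t) / snd (\<gamma> t))"
    (is "_ \<longleftrightarrow> H = ?H")
proof -
  have q: "(t, x) \<in> param_domain I" using I x unfolding param_domain_def by simp
  have DG: "(rot_hyp \<gamma> has_derivative drot (\<gamma> t) \<gamma>' x) (at (t, x) within param_domain I)"
    by (rule has_derivative_at_withinI[OF rot_hyp_has_derivative[OF \<gamma>(1)]])
  have DN: "(N has_derivative drot (\<nu> t) \<nu>' x) (at (t, x) within param_domain I)"
    using q N has_derivative_at_withinI[OF rot_hyp_has_derivative[OF \<nu>]] by (rule has_derivative_transform)
  show ?thesis
  proof
    assume "has_mean_curvature (param_domain I) param_tangent (rot_hyp \<gamma>) N (t, x) H"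
    then obtain DG' DN' E where *: "(rot_hyp \<gamma> has_derivative DG') (at (t, x) within param_domain I)"
      "(N has_derivative DN') (at (t, x) within param_domain I)" "finite E"
      "E \<subseteq> param_tangent (t, x)" "span E = param_tangent (t, x)"
      "\<forall>u\<in>E. \<forall>v\<in>E. DG' u \<bullet> DG' v = (if u = v then 1 else 0)"
      "H = (\<Sum>u\<in>E. second_fundamental_form DG' DN' u u)"
      unfolding has_mean_curvature_def by (elim exE conjE)
    have eq: "DG' u = drot (\<gamma> t) \<gamma>' x u" "DN' u = drot (\<nu> t) \<nu>' x u" if "u \<in> E" for u
    proof -
      have u: "u \<in> param_tangent (t, x)" using that *(4) by blast
      show "DG' u = drot (\<gamma> t) \<gamma>' x u" by (rule param_derivative_unique[OF *(1) DG q I(1) u])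
      show "DN' u = drot (\<nu> t) \<nu>' x u" by (rule param_derivative_unique[OF *(2) DN q I(1) u])
    qed
    have orth: "drot (\<gamma> t) \<gamma>' x u \<bullet> drot (\<gamma> t) \<gamma>' x w = (if u = w then 1 else 0)"
      if "u \<in> E" "w \<in> E" for u w
      using bspec[OF bspec[OF *(6) that(1)] that(2)] unfolding eq(1)[OF that(1)] eq(1)[OF that(2)] .
    have "(\<Sum>u\<in>E. second_fundamental_form DG' DN' u u) = (\<Sum>u\<in>E. - (drot (\<nu> t) \<nu>' x u \<bullet> drot (\<gamma> t) \<gamma>' x u))"
      by (rule sum.cong[OF refl]) (simp only: second_fundamental_form_def eq)
    also have "\<dots> = ?H"
      by (rule drot_trace[OF x *(3-5) orth \<gamma>(2,3)])
    finally have "(\<Sum>u\<in>E. second_fundamental_form DG' DN' u u) = ?H" .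
    with *(7) show "H = ?H" by (rule trans)
  next
    assume H: "H = ?H"
    obtain E where E: "finite E" "E \<subseteq> param_tangent (t, x)" "span E = param_tangent (t, x)"
      "\<forall>u\<in>E. \<forall>w\<in>E. drot (\<gamma> t) \<gamma>' x u \<bullet> drot (\<gamma> t) \<gamma>' x w = (if u = w then 1 else 0)"
      using drot_orthonormal_basis[OF x \<gamma>(2,3), of t] by (elim exE conjE)
    have "(\<Sum>u\<in>E. - (drot (\<nu> t) \<nu>' x u \<bullet> drot (\<gamma> t) \<gamma>' x u)) = ?H"
      by (rule drot_trace[OF x E(1-3) bspec[OF bspec[OF E(4)]] \<gamma>(2,3)])
    then show "has_mean_curvature (param_domain I) param_tangent (rot_hyp \<gamma>) N (t, x) H"
      unfolding has_mean_curvature_def second_fundamental_form_def H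
      by (intro exI[of _ "drot (\<gamma> t) \<gamma>' x"] exI[of _ "drot (\<nu> t) \<nu>' x"] exI[of _ E] conjI DG DN E) (rule sym)
  qed
qed

section \<open>Equivalence of the mean curvature equation with the Frenet system\<close>

lemma frenet_normal_derivative:
  assumes p: "(p has_vector_derivative v *\<^sub>R q t) (at t)" and q: "(q has_vector_derivative q') (at t)"
  shows "((\<lambda>t. cross (p t) (q t)) has_vector_derivative cross (p t) q') (at t)"
  using has_vector_derivative_cross[OF p q] by (simp add: cross_scaleR_left)

lemma has_vector_derivative_inner_zero:
  assumes p: "\<And>t. (p has_vector_derivative p' t) (at t)" and q: "\<And>t. (q has_vector_derivative q' t) (at t)"
    and const: "\<And>t. p t \<bullet> q t = c"
  shows "p t \<bullet> q' t + p' t \<bullet> q t = 0"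
proof -
  have "((\<lambda>t. p t \<bullet> q t) has_vector_derivative (p t \<bullet> q' t + p' t \<bullet> q t)) (at t)"
    by (rule bounded_bilinear.has_vector_derivative[OF bounded_bilinear_inner p q])
  moreover have "((\<lambda>t. p t \<bullet> q t) has_vector_derivative 0) (at t)"
    by (simp only: const has_vector_derivative_const)
  ultimately show ?thesis by (rule vector_derivative_unique_at)
qed

lemma rot_hyp_apply: "rot_hyp \<gamma> (t, x) = (fst (\<gamma> t), snd (\<gamma> t) *\<^sub>R x)"
  by (simp add: rot_hyp_def)

text \<open>Orthogonality to the sphere directions makes the second component of the normal a
  multiple of \<open>x\<close>. What remains is a unit vector of three-space orthogonal to
  \<open>\<gamma> t\<close> and \<open>q\<close>, which leaves only a sign.\<close>

lemma unit_normal_field_decomposition: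
  fixes N :: "real \<times> (real ^ 'm::finite) \<Rightarrow> complex \<times> (real ^ 'm)"
  assumes N: "norm (N (t, x)) = 1" "N (t, x) \<bullet> rot_hyp \<gamma> (t, x) = 0"
      "(rot_hyp \<gamma> has_derivative DG) (at (t, x) within param_domain UNIV)"
      "\<And>u. u \<in> param_tangent (t, x) \<Longrightarrow> N (t, x) \<bullet> DG u = 0"
    and x: "norm x = 1"
    and \<gamma>: "(\<gamma> has_vector_derivative v *\<^sub>R q) (at t)" "v \<noteq> 0"
    and fr: "\<gamma> t \<bullet> \<gamma> t = 1" "q \<bullet> q = 1" "\<gamma> t \<bullet> q = 0" and b: "snd (\<gamma> t) \<noteq> 0"
  shows "\<exists>e\<in>{1,-1}. N (t, x) = e *\<^sub>R (fst (cross (\<gamma> t) q), snd (cross (\<gamma> t) q) *\<^sub>R x)"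
proof -
  have qd: "(t, x) \<in> param_domain UNIV" using x unfolding param_domain_def by simp
  have DG: "DG u = drot (\<gamma> t) (v *\<^sub>R q) x u" if "u \<in> param_tangent (t, x)" for u
    using N(3) has_derivative_at_withinI[OF rot_hyp_has_derivative[OF \<gamma>(1)]] qd open_UNIV that
    by (rule param_derivative_unique)
  obtain \<alpha> \<beta> where N_eq: "N (t, x) = (\<alpha>, \<beta>)" by (rule prod.exhaust)
  define n where "n = cross (\<gamma> t) q"
  define b0 where "b0 = x \<bullet> \<beta>"
  have xx: "x \<bullet> x = 1" using x by (simp add: dot_square_norm)
  \<comment> \<open>\<open>y\<close> is the part of \<open>\<beta>\<close> tangent to the sphere
    factor. Testing the normal against \<open>(0, y)\<close> shows that it vanishes, because the
    height is nonzero.\<close>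
  define y where "y = \<beta> - b0 *\<^sub>R x"
  have xy: "x \<bullet> y = 0" unfolding y_def b0_def by (simp add: inner_diff_right xx)
  then have "(0, y) \<in> param_tangent (t, x)" by (simp add: param_tangent_def)
  from N(4)[OF this] have "snd (\<gamma> t) * (\<beta> \<bullet> y) = 0"
    unfolding DG[OF \<open>(0, y) \<in> param_tangent (t, x)\<close>] N_eq by (simp add: drot_def inner_prod_def)
  then have "y \<bullet> y = 0" using b xy unfolding y_def by (simp add: inner_diff_left inner_diff_right inner_commute)
  then have "y = 0" by simp
  then have \<beta>: "\<beta> = b0 *\<^sub>R x" by (simp add: y_def)
  have 1: "(\<alpha>, b0) \<bullet> \<gamma> t = 0"
    using N(2) unfolding N_eq rot_hyp_apply \<beta> by (simp add: inner_prod_def xx mult_ac)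
  have t1: "(1, 0) \<in> param_tangent (t, x)" by (simp add: param_tangent_def)
  have 2: "(\<alpha>, b0) \<bullet> q = 0"
  proof -
    have "v * ((\<alpha>, b0) \<bullet> q) = 0"
      using N(4)[OF t1] unfolding DG[OF t1] N_eq \<beta>
      by (simp add: drot_def inner_prod_def xx algebra_simps)
    then show ?thesis using \<gamma>(2) by simp
  qed
  define e where "e = (\<alpha>, b0) \<bullet> n"
  have ab: "(\<alpha>, b0) = e *\<^sub>R n"
    using orthonormal_frame_expansion[OF fr, of "(\<alpha>, b0)"] unfolding 1 2 e_def n_def by simp
  have nn: "n \<bullet> n = 1" unfolding n_def cross_inner_cross fr by simp
  have "(norm (N (t, x)))\<^sup>2 = (\<alpha>, b0) \<bullet> (\<alpha>, b0)"
    unfolding N_eq \<beta> power2_norm_eq_inner by (simp add: inner_prod_def xx)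
  also have "\<dots> = e\<^sup>2" unfolding ab by (simp add: nn power2_eq_square)
  finally have "e\<^sup>2 = 1" using N(1) by simp
  then have "e \<in> {1,-1}" by (auto simp: power2_eq_1_iff)
  moreover have "N (t, x) = e *\<^sub>R (fst n, snd n *\<^sub>R x)"
    using arg_cong[OF ab, of fst] arg_cong[OF ab, of snd] unfolding N_eq \<beta> by simp
  ultimately show ?thesis unfolding n_def by blast
qed

text \<open>The sign of \<open>v\<close> absorbs the choice of the unit normal: with \<open>T = \<gamma>'/v\<close> the given normal is \<open>-\<gamma> \<times> T\<close>.\<close>

theorem k_curve_imp_frenet:
  fixes \<gamma> :: "real \<Rightarrow> complex \<times> real"
  assumes kc: "k_curve TYPE('m::finite) k UNIV \<gamma>" and m: "CARD('m) \<ge> 2"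
  shows "\<exists>v v' T. (\<forall>t. (v has_real_derivative v' t) (at t)) \<and> continuous_on UNIV v' \<and>
    (\<forall>t. v t \<noteq> 0) \<and> (\<forall>t. (\<gamma> has_vector_derivative v t *\<^sub>R T t) (at t)) \<and>
    (\<forall>t. \<gamma> t \<bullet> \<gamma> t = 1 \<and> T t \<bullet> T t = 1 \<and> \<gamma> t \<bullet> T t = 0 \<and> snd (\<gamma> t) > 0) \<and>
    (\<forall>t. ((\<lambda>t. (\<gamma> t, T t)) has_vector_derivative v t *\<^sub>R curve_field (- k) (real CARD('m) - 1) (\<gamma> t, T t)) (at t))"
proof -
  let ?\<mu> = "real CARD('m) - 1"
  obtain D N where D: "\<And>t. (\<gamma> has_vector_derivative D t) (at t)" "\<And>t. D t \<noteq> 0" "D C1_differentiable_on UNIV"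
    and sph: "\<And>t. \<gamma> t \<in> sphere 0 1" and b: "\<And>t. snd (\<gamma> t) > 0"
    and N: "unit_normal_field (param_domain UNIV) param_tangent (rot_hyp \<gamma>) (N :: real \<times> (real ^ 'm) \<Rightarrow> complex \<times> (real ^ 'm))"
    and H: "\<And>q. q \<in> param_domain UNIV \<Longrightarrow> has_mean_curvature (param_domain UNIV) param_tangent (rot_hyp \<gamma>) N q k"
    using kc unfolding k_curve_def regular_C2_curve_def by blast
  obtain D' where D': "\<And>t. (D has_vector_derivative D' t) (at t)" "continuous_on UNIV D'"
    using D(3) unfolding C1_differentiable_on_def by blast
  have \<gamma>1: "\<gamma> t \<bullet> \<gamma> t = 1" for t using sph[of t] by (simp add: dot_square_norm)
  define r where "r t = norm (D t)" for t
  have r: "r t > 0" for t using D(2) by (simp add: r_def)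
  define r' where "r' t = (D t \<bullet> D' t) / r t" for t
  have contD: "continuous_on UNIV D"
    using D'(1) by (rule continuous_on_if_derivative)
  have dr: "(r has_real_derivative r' t) (at t)" for t
  proof -
    have "((\<lambda>t. D t \<bullet> D t) has_vector_derivative D t \<bullet> D' t + D' t \<bullet> D t) (at t)"
      by (rule bounded_bilinear.has_vector_derivative[OF bounded_bilinear_inner D'(1) D'(1)])
    then have 1: "((\<lambda>t. D t \<bullet> D t) has_real_derivative 2 * (D t \<bullet> D' t)) (at t)"
      by (simp add: has_real_derivative_iff_has_vector_derivative inner_commute)
    have "D t \<bullet> D t > 0" using D(2)[of t] by simp
    from DERIV_chain2[OF DERIV_real_sqrt[OF this] 1] show ?thesis
      unfolding r_def[abs_def] r'_def norm_eq_sqrt_inner by (simp add: field_simps)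
  qed
  have contr: "continuous_on UNIV r" "continuous_on UNIV r'"
    unfolding r'_def r_def[abs_def] using D(2) by (auto intro!: continuous_intros contD D'(2))
  define T0 where "T0 t = inverse (r t) *\<^sub>R D t" for t
  define T0' where "T0' t = inverse (r t) *\<^sub>R D' t + (- (inverse (r t) * r' t * inverse (r t))) *\<^sub>R D t" for t
  have dT0: "(T0 has_vector_derivative T0' t) (at t)" for t
    unfolding T0_def[abs_def] T0'_def
    by (rule has_vector_derivative_scaleR[OF DERIV_inverse'[OF dr] D'(1)]) (use r[of t] in simp)
  have DT0: "D t = r t *\<^sub>R T0 t" for t using r[of t] by (simp add: T0_def)
  have T01: "T0 t \<bullet> T0 t = 1" for t using r[of t] D(2)[of t]
    by (simp add: T0_def r_def dot_square_norm power2_eq_square)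
  have "\<gamma> t \<bullet> D t = 0" for t
    using has_vector_derivative_inner_zero[OF D(1) D(1) \<gamma>1, of t] by (simp add: inner_commute)
  then have \<gamma>T0: "\<gamma> t \<bullet> T0 t = 0" for t by (simp add: T0_def)
  define n0 where "n0 t = cross (\<gamma> t) (T0 t)" for t
  have dn0: "(n0 has_vector_derivative cross (\<gamma> t) (T0' t)) (at t)" for t
    unfolding n0_def[abs_def] by (rule frenet_normal_derivative[OF D(1)[unfolded DT0] dT0])
  have n01: "n0 t \<bullet> n0 t = 1" for t by (simp add: n0_def cross_inner_cross \<gamma>1 T01 \<gamma>T0)
  have decomp: "\<exists>e\<in>{1,-1}. N (t, x) = e *\<^sub>R (fst (n0 t), snd (n0 t) *\<^sub>R x)" if x: "norm x = 1" for t x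
  proof -
    have q: "(t, x) \<in> param_domain UNIV" using x unfolding param_domain_def by simp
    obtain DG where *: "norm (N (t, x)) = 1" "N (t, x) \<bullet> rot_hyp \<gamma> (t, x) = 0"
      "(rot_hyp \<gamma> has_derivative DG) (at (t, x) within param_domain UNIV)"
      "\<forall>u\<in>param_tangent (t, x). N (t, x) \<bullet> DG u = 0"
      using bspec[OF conjunct2[OF N[unfolded unit_normal_field_def]] q] by (elim exE conjE)
    show ?thesis unfolding n0_def
      by (rule unit_normal_field_decomposition[where N = N and \<gamma> = \<gamma> and q = "T0 t" and v = "r t" and t = t and x = x,
            OF *(1-3) bspec[OF *(4)] x])
        (use r[of t] b[of t] D(1)[of t] in \<open>simp_all add: DT0 \<gamma>1 T01 \<gamma>T0\<close>)
  qed
  \<comment> \<open>\<open>E\<close> is the sign of \<open>N\<close> relative to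
    \<open>rot_hyp n0\<close>. It is continuous with values in \<open>{1, -1}\<close>, and the
    domain is connected since the sphere factor has positive dimension; so the sign is one constant
    \<open>e\<close>.\<close>
  define E where "E q = N q \<bullet> rot_hyp n0 q" for q
  have EN: "N q = E q *\<^sub>R rot_hyp n0 q \<and> (E q = 1 \<or> E q = -1)" if q: "q \<in> param_domain UNIV" for q
  proof -
    obtain t x where tx: "q = (t, x)" by (rule prod.exhaust)
    have x: "norm x = 1" using q unfolding tx param_domain_def by simp
    then have xx: "x \<bullet> x = 1" by (simp add: dot_square_norm)
    obtain e where e: "e \<in> {1,-1}" "N q = e *\<^sub>R rot_hyp n0 q"
      using decomp[OF x] unfolding tx rot_hyp_apply by blast
    have "rot_hyp n0 q \<bullet> rot_hyp n0 q = 1"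
      using n01[of t] unfolding tx rot_hyp_apply by (simp add: inner_prod_def xx)
    then have "E q = e" unfolding E_def e(2) by simp
    then show ?thesis using e by auto
  qed
  have conn: "connected (param_domain UNIV :: (real \<times> (real ^ 'm)) set)"
    unfolding param_domain_def
    by (intro connected_Times connected_UNIV connected_sphere) (use m in simp)
  have contE: "continuous_on (param_domain UNIV) E"
  proof -
    have "continuous_on UNIV n0"
      using dn0 by (rule continuous_on_if_derivative)
    then have "continuous_on (param_domain UNIV :: (real \<times> (real ^ 'm)) set) (\<lambda>q. n0 (fst q))"
      by (rule continuous_on_compose2) (auto intro!: continuous_intros)
    then have "continuous_on (param_domain UNIV :: (real \<times> (real ^ 'm)) set) (rot_hyp n0)"
      unfolding rot_hyp_def case_prod_unfold by (intro continuous_intros)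
    then show ?thesis unfolding E_def
      using conjunct1[OF N[unfolded unit_normal_field_def]] by (intro continuous_intros)
  qed
  have ne: "param_domain UNIV \<noteq> ({} :: (real \<times> (real ^ 'm)) set)"
    unfolding param_domain_def by simp
  have "E constant_on param_domain UNIV"
  proof (rule continuous_finite_range_constant[OF conn contE])
    have "E ` param_domain UNIV \<subseteq> {1,-1}" using EN by blast
    then show "finite (E ` param_domain UNIV)" by (rule finite_subset) simp
  qed
  then obtain e where e: "\<And>q. q \<in> param_domain UNIV \<Longrightarrow> E q = e" unfolding constant_on_def by blast
  obtain q0 :: "real \<times> (real ^ 'm)" where "q0 \<in> param_domain UNIV" using ne by blast
  with EN e have e1: "e = 1 \<or> e = -1" by metis
  \<comment> \<open>Multiplying the tangent by \<open>- e\<close> turns \<open>n0\<close> into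
    \<open>- e n0\<close>, whence \<open>N = e n0\<close> becomes \<open>- n\<close>. The same
    factor in \<open>v\<close> keeps \<open>D = v T\<close>.\<close>
  define T where "T t = (- e) *\<^sub>R T0 t" for t
  define T' where "T' t = (- e) *\<^sub>R T0' t" for t
  define v where "v t = - e * r t" for t
  define n where "n t = cross (\<gamma> t) (T t)" for t
  have ee: "e * e = 1" using e1 by auto
  have dT: "(T has_vector_derivative T' t) (at t)" for t
    unfolding T_def[abs_def] T'_def
    by (rule bounded_linear.has_vector_derivative[OF bounded_linear_scaleR_right dT0])
  have DvT: "D t = v t *\<^sub>R T t" for t by (simp add: DT0 v_def T_def ee mult.assoc mult.left_commute[of _ e])
  have vnz: "v t \<noteq> 0" for t using e1 r[of t] by (auto simp: v_def)
  have TT: "T t \<bullet> T t = 1" and \<gamma>T: "\<gamma> t \<bullet> T t = 0" for t using ee by (simp_all add: T_def T01 \<gamma>T0)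
  have nn0: "n t = (- e) *\<^sub>R n0 t" for t by (simp add: n_def n0_def T_def cross_scaleR_right cross_minus_right)
  have dn: "(n has_vector_derivative cross (\<gamma> t) (T' t)) (at t)" for t
    unfolding n_def[abs_def] by (rule frenet_normal_derivative[OF D(1)[unfolded DvT] dT])
  have Nn: "N q = rot_hyp (\<lambda>t. - n t) q" if q: "q \<in> param_domain UNIV" for q
  proof -
    have "N q = e *\<^sub>R rot_hyp n0 q" using EN[OF q] e[OF q] by simp
    then show ?thesis by (cases q) (simp add: rot_hyp_apply nn0)
  qed
  obtain x0 :: "real ^ 'm" where x0: "norm x0 = 1" using vector_choose_size[of 1] by auto
  define \<kappa> where "\<kappa> t = - k + ?\<mu> * snd (n t) / snd (\<gamma> t)" for t
  have \<kappa>: "cross (\<gamma> t) (T' t) \<bullet> T t = - v t * \<kappa> t" for t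
  proof -
    have q: "(t, x0) \<in> param_domain UNIV" using x0 unfolding param_domain_def by simp
    have dmn: "((\<lambda>t. - n t) has_vector_derivative - cross (\<gamma> t) (T' t)) (at t)"
      using dn by (rule has_vector_derivative_minus)
    have "k = - (- cross (\<gamma> t) (T' t) \<bullet> D t) / (D t \<bullet> D t) - ?\<mu> * (snd (- n t) / snd (\<gamma> t))"
      using H[OF q] b[of t]
      by (subst (asm) has_mean_curvature_rot_hyp_iff[OF open_UNIV UNIV_I x0 D(1,2) _ dmn Nn]) simp_all
    then have "k = (cross (\<gamma> t) (T' t) \<bullet> T t) / v t + ?\<mu> * (snd (n t) / snd (\<gamma> t))"
      unfolding DvT using vnz[of t] by (simp add: TT)
    then have "(cross (\<gamma> t) (T' t) \<bullet> T t) / v t = - \<kappa> t" unfolding \<kappa>_def by simp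
    then show ?thesis using vnz[of t] by (simp add: field_simps)
  qed
  \<comment> \<open>The three frame coordinates of \<open>T'\<close> come from differentiating the
    constant products \<open>T \<bullet> T\<close>, \<open>\<gamma> \<bullet> T\<close> and
    \<open>n \<bullet> T\<close>; only the last one involves the mean curvature.\<close>
  have T': "T' t = v t *\<^sub>R (- \<gamma> t + \<kappa> t *\<^sub>R n t)" for t
  proof -
    have 1: "T' t \<bullet> T t = 0"
      using has_vector_derivative_inner_zero[OF dT dT TT, of t] by (simp add: inner_commute)
    have 2: "T' t \<bullet> \<gamma> t = - v t"
      using has_vector_derivative_inner_zero[OF D(1) dT \<gamma>T, of t] unfolding DvT by (simp add: TT inner_commute)
    have "n t \<bullet> T t = 0" for t by (simp add: n_def)
    from has_vector_derivative_inner_zero[OF dn dT this, of t]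
    have 3: "T' t \<bullet> n t = v t * \<kappa> t" using \<kappa>[of t] by (simp add: inner_commute)
    show ?thesis
      using orthonormal_frame_expansion[OF \<gamma>1 TT \<gamma>T, of "T' t" t] unfolding n_def[symmetric] 1 2 3
      by (simp add: algebra_simps)
  qed
  have Y: "((\<lambda>t. (\<gamma> t, T t)) has_vector_derivative v t *\<^sub>R curve_field (- k) ?\<mu> (\<gamma> t, T t)) (at t)" for t
  proof -
    have "v t *\<^sub>R curve_field (- k) ?\<mu> (\<gamma> t, T t) = (D t, T' t)"
      unfolding curve_field_def DvT T' \<kappa>_def n_def by simp
    then show ?thesis using has_vector_derivative_Pair[OF D(1) dT, of t] by simp
  qed
  have dv: "(v has_real_derivative - e * r' t) (at t)" for t
    unfolding v_def[abs_def] by (rule DERIV_cmult[OF dr])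
  have "continuous_on UNIV (\<lambda>t. - e * r' t)" by (intro continuous_intros contr)
  then show ?thesis
    using dv vnz D(1)[unfolded DvT] \<gamma>1 TT \<gamma>T b Y
    by (intro exI[of _ v] exI[of _ "\<lambda>t. - e * r' t"] exI[of _ T] conjI allI)
qed

text \<open>Converse at unit speed, with the normal \<open>- n\<close>. Frenet's equations give
  \<open>n' = - \<kappa> q\<close>, so the profile direction contributes \<open>- \<kappa>\<close>
  and the rotational ones \<open>\<mu>\<close> times \<open>snd n / snd p\<close>; the sum is
  \<open>- h\<close>.\<close>

theorem frenet_imp_k_curve:
  assumes Y: "\<And>t. ((\<lambda>t. (p t, q t)) has_vector_derivative curve_field h (real CARD('m) - 1) (p t, q t)) (at t)"
    and fr: "\<And>t. p t \<bullet> p t = 1" "\<And>t. q t \<bullet> q t = 1" "\<And>t. p t \<bullet> q t = 0" "\<And>t. snd (p t) > 0"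
  shows "k_curve TYPE('m::finite) (- h) UNIV p"
proof -
  let ?\<mu> = "real CARD('m) - 1"
  define n where "n t = cross (p t) (q t)" for t
  define \<kappa> where "\<kappa> t = h + ?\<mu> * snd (n t) / snd (p t)" for t
  have "curve_field h ?\<mu> (p t, q t) = (q t, - p t + \<kappa> t *\<^sub>R n t)" for t
    by (simp add: curve_field_def \<kappa>_def n_def)
  note Y' = Y[unfolded this]
  have dp: "(p has_vector_derivative q t) (at t)" for t
    using bounded_linear.has_vector_derivative[OF bounded_linear_fst Y'[of t]] by simp
  have dq: "(q has_vector_derivative - p t + \<kappa> t *\<^sub>R n t) (at t)" for t
    using bounded_linear.has_vector_derivative[OF bounded_linear_snd Y'[of t]] by simp
  have n1: "n t \<bullet> n t = 1" for t by (simp add: n_def cross_inner_cross fr)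
  have dn: "(n has_vector_derivative - (\<kappa> t *\<^sub>R q t)) (at t)" for t
  proof -
    have "(p has_vector_derivative 1 *\<^sub>R q t) (at t)" using dp by simp
    from frenet_normal_derivative[OF this dq[of t]]
    have "(n has_vector_derivative cross (p t) (- p t + \<kappa> t *\<^sub>R n t)) (at t)" unfolding n_def[abs_def] .
    moreover have "cross (p t) (- p t + \<kappa> t *\<^sub>R n t) = - (\<kappa> t *\<^sub>R q t)"
      by (simp only: cross_add_right cross_minus_right cross_scaleR_right n_def cross_cross_right fr) simp
    ultimately show ?thesis by simp
  qed
  have cont: "continuous_on UNIV p" "continuous_on UNIV q" "continuous_on UNIV n"
    using dp dq dn has_vector_derivative_continuous by (blast intro: continuous_at_imp_continuous_on)+
  have cont\<kappa>: "continuous_on UNIV \<kappa>"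
    unfolding \<kappa>_def using fr(4) by (intro continuous_intros cont) (simp add: less_imp_neq[symmetric])
  have reg: "regular_C2_curve UNIV p"
    unfolding regular_C2_curve_def C1_differentiable_on_def
  proof (intro exI conjI ballI)
    show "(p has_vector_derivative q t) (at t)" for t by (rule dp)
    show "q t \<noteq> 0" for t using fr(2)[of t] by auto
    show "(q has_vector_derivative - p t + \<kappa> t *\<^sub>R n t) (at t)" for t by (rule dq)
    show "continuous_on UNIV (\<lambda>t. - p t + \<kappa> t *\<^sub>R n t)" by (intro continuous_intros cont cont\<kappa>)
  qed
  define N :: "real \<times> (real ^ 'm) \<Rightarrow> complex \<times> (real ^ 'm)" where "N = rot_hyp (\<lambda>t. - n t)"
  have dmn: "((\<lambda>t. - n t) has_vector_derivative \<kappa> t *\<^sub>R q t) (at t)" for t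
    using has_vector_derivative_minus[OF dn[of t]] by simp
  have H: "has_mean_curvature (param_domain UNIV) param_tangent (rot_hyp p) N z (- h)"
    if z: "z \<in> param_domain UNIV" for z
  proof -
    obtain t x where tx: "z = (t, x)" by (rule prod.exhaust)
    have x: "norm x = 1" using z unfolding tx param_domain_def by simp
    have q0: "q t \<noteq> 0" using fr(2)[of t] by auto
    have b0: "snd (p t) \<noteq> 0" using fr(4)[of t] by simp
    have "- h = - (\<kappa> t *\<^sub>R q t \<bullet> q t) / (q t \<bullet> q t) - ?\<mu> * (snd (- n t) / snd (p t))"
      by (simp add: fr \<kappa>_def)
    then show ?thesis unfolding tx
      by (subst has_mean_curvature_rot_hyp_iff[OF open_UNIV UNIV_I x dp q0 b0 dmn]) (simp_all add: N_def)
  qed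
  have "unit_normal_field (param_domain UNIV) param_tangent (rot_hyp p) N"
    unfolding unit_normal_field_def
  proof (intro conjI ballI)
    have "continuous_on (param_domain UNIV :: (real \<times> (real ^ 'm)) set) (\<lambda>z. n (fst z))"
      by (rule continuous_on_compose2[OF cont(3)]) (auto intro!: continuous_intros)
    then show "continuous_on (param_domain UNIV) N"
      unfolding N_def rot_hyp_def case_prod_unfold by (intro continuous_intros)
    fix z :: "real \<times> (real ^ 'm)" assume z: "z \<in> param_domain UNIV"
    obtain t x where tx: "z = (t, x)" by (rule prod.exhaust)
    have x: "norm x = 1" using z unfolding tx param_domain_def by simp
    then have xx: "x \<bullet> x = 1" by (simp add: dot_square_norm)
    have "N z \<bullet> N z = n t \<bullet> n t" unfolding N_def tx rot_hyp_apply by (simp add: inner_prod_def xx)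
    then show "norm (N z) = 1" unfolding n1 by (simp add: norm_eq_sqrt_inner)
    have "N z \<bullet> rot_hyp p z = - (n t \<bullet> p t)" unfolding N_def tx rot_hyp_apply by (simp add: inner_prod_def xx)
    then show "N z \<bullet> rot_hyp p z = 0" by (simp add: n_def)
    have "N z \<bullet> drot (p t) (q t) x u = 0" if u: "u \<in> param_tangent z" for u
    proof -
      have "x \<bullet> snd u = 0" using u unfolding tx param_tangent_def by simp
      then have "N z \<bullet> drot (p t) (q t) x u = - fst u * (n t \<bullet> q t)"
        unfolding N_def tx rot_hyp_apply drot_def
        by (simp add: inner_prod_def inner_add_right xx algebra_simps)
      then show ?thesis by (simp add: n_def)
    qed
    then show "\<exists>DG. (rot_hyp p has_derivative DG) (at z within param_domain UNIV) \<and> (\<forall>u\<in>param_tangent z. N z \<bullet> DG u = 0)"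
      using has_derivative_at_withinI[OF rot_hyp_has_derivative[OF dp]] unfolding tx
      by (intro exI[of _ "drot (p t) (q t) x"] conjI ballI)
  qed
  with H have ex: "\<exists>N :: real \<times> (real ^ 'm) \<Rightarrow> complex \<times> (real ^ 'm).
      unit_normal_field (param_domain UNIV) param_tangent (rot_hyp p) N \<and>
      (\<forall>z\<in>param_domain UNIV. has_mean_curvature (param_domain UNIV) param_tangent (rot_hyp p) N z (- h))"
    by blast
  have "norm (p t) = 1" for t using fr(1)[of t] by (simp add: norm_eq_sqrt_inner)
  then show ?thesis unfolding k_curve_def using reg fr(4) ex by simp
qed

section \<open>The conserved flux and global solutions\<close>

lemma curve_field_components:
  assumes "(Y has_vector_derivative curve_field h \<mu> (Y t)) (at t within I)"
  shows "((\<lambda>t. fst (Y t)) has_vector_derivative snd (Y t)) (at t within I)"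
    and "((\<lambda>t. snd (Y t)) has_vector_derivative - fst (Y t) +
      (h + \<mu> * snd (cross (fst (Y t)) (snd (Y t))) / snd (fst (Y t))) *\<^sub>R cross (fst (Y t)) (snd (Y t))) (at t within I)"
  using bounded_linear.has_vector_derivative[OF bounded_linear_fst assms]
    bounded_linear.has_vector_derivative[OF bounded_linear_snd assms]
  by (simp_all add: curve_field_def case_prod_unfold)

definition orthonormal_pair :: "(complex \<times> real) \<times> (complex \<times> real) \<Rightarrow> bool" where
  "orthonormal_pair Y \<longleftrightarrow> fst Y \<bullet> fst Y = 1 \<and> snd Y \<bullet> snd Y = 1 \<and> fst Y \<bullet> snd Y = 0"

text \<open>The curvature term is orthogonal to both vectors and drops out, leaving the closed
  linear system \<open>A' = 2 B\<close>, \<open>B' = D - A\<close>, \<open>D' = - 2 B\<close>. Its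
  first integrals \<open>A + D\<close> and \<open>(A - D)^2 + 4 B^2\<close> determine all three
  products.\<close>

lemma orthonormal_pair_preserved:
  assumes I: "convex I" "t0 \<in> I" "t \<in> I" and init: "orthonormal_pair (Y t0)"
    and Y: "\<And>t. t \<in> I \<Longrightarrow> (Y has_vector_derivative curve_field h \<mu> (Y t)) (at t)"
  shows "orthonormal_pair (Y t)"
proof -
  define A B D where "A t = fst (Y t) \<bullet> fst (Y t)" and "B t = fst (Y t) \<bullet> snd (Y t)"
    and "D t = snd (Y t) \<bullet> snd (Y t)" for t
  have dA: "(A has_real_derivative 2 * B t) (at t within I)"
    and dB: "(B has_real_derivative D t - A t) (at t within I)"
    and dD: "(D has_real_derivative - 2 * B t) (at t within I)" if "t \<in> I" for t
  proof -
    note d = curve_field_components[OF has_vector_derivative_at_within[OF Y[OF that]], of I]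
    note i = bounded_bilinear.has_vector_derivative[OF bounded_bilinear_inner]
    show "(A has_real_derivative 2 * B t) (at t within I)"
      using i[OF d(1) d(1)] unfolding has_real_derivative_iff_has_vector_derivative A_def[abs_def] B_def
      by (simp add: inner_commute)
    show "(B has_real_derivative D t - A t) (at t within I)"
      using i[OF d(1) d(2)] unfolding has_real_derivative_iff_has_vector_derivative A_def B_def[abs_def] D_def
      by (simp add: inner_add_right inner_diff_right)
    show "(D has_real_derivative - 2 * B t) (at t within I)"
      using i[OF d(2) d(2)] unfolding has_real_derivative_iff_has_vector_derivative B_def D_def[abs_def]
      by (simp add: inner_add_right inner_add_left inner_diff_right inner_diff_left inner_commute)
  qed
  have "\<exists>c. \<forall>t\<in>I. A t + D t = c"
    by (rule has_field_derivative_zero_constant[OF I(1)])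
      (auto intro!: derivative_eq_intros dA dD)
  moreover have "\<exists>c. \<forall>t\<in>I. (A t - D t)\<^sup>2 + 4 * (B t)\<^sup>2 = c"
    by (rule has_field_derivative_zero_constant[OF I(1)])
      (rule derivative_eq_intros dA dB dD refl | assumption | simp add: algebra_simps)+
  moreover have "A t0 = 1" "D t0 = 1" "B t0 = 0" using init by (simp_all add: orthonormal_pair_def A_def B_def D_def)
  ultimately have 1: "A t + D t = 2" and 2: "(A t - D t)\<^sup>2 + 4 * (B t)\<^sup>2 = 0"
    using I(2,3) by force+
  from 2 have "(A t - D t)\<^sup>2 = 0" "(B t)\<^sup>2 = 0"
    using zero_le_power2[of "A t - D t"] zero_le_power2[of "B t"] by linarith+
  with 1 show ?thesis by (simp add: orthonormal_pair_def A_def B_def D_def)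
qed

locale delaunay_field =
  fixes h :: real and \<mu> :: nat
  assumes h_pos: "h > 0" and mu_pos: "\<mu> \<ge> 1"
begin

text \<open>With \<open>\<mu> = n - 2\<close> this is the transition value
  \<open>h / (n - 1)\<close>.\<close>

definition a where "a = h / (real \<mu> + 1)"

lemma a_pos: "a > 0" using h_pos by (simp add: a_def)

definition flux :: "(complex \<times> real) \<times> (complex \<times> real) \<Rightarrow> real" where
  "flux Y = snd (fst Y) ^ \<mu> * snd (cross (fst Y) (snd Y)) + a * snd (fst Y) ^ Suc \<mu>"

text \<open>Along a solution \<open>b' = c\<close> and \<open>\<nu>\<^sub>b' = - \<kappa> c\<close>,
  so the derivative is \<open>c\<close> times \<open>\<mu> b^(\<mu>-1) \<nu>\<^sub>b - b^\<mu>
  \<kappa> + h b^\<mu>\<close>, which vanishes by the choice of \<open>\<kappa>\<close>.\<close>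

lemma flux_preserved:
  assumes I: "convex I" "t0 \<in> I" "t \<in> I" and orth: "\<And>t. t \<in> I \<Longrightarrow> orthonormal_pair (Y t)"
    and pos: "\<And>t. t \<in> I \<Longrightarrow> snd (fst (Y t)) > 0"
    and Y: "\<And>t. t \<in> I \<Longrightarrow> (Y has_vector_derivative curve_field h (real \<mu>) (Y t)) (at t)"
  shows "flux (Y t) = flux (Y t0)"
proof -
  have "\<exists>c. \<forall>t\<in>I. flux (Y t) = c"
  proof (rule has_field_derivative_zero_constant[OF I(1)])
    fix t assume t: "t \<in> I"
    define b n c \<kappa> where "b = snd (fst (Y t))" and "n = cross (fst (Y t)) (snd (Y t))"
      and "c = snd (snd (Y t))" and "\<kappa> = h + real \<mu> * snd n / b"
    have b: "b > 0" using pos[OF t] by (simp add: b_def)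
    note d = curve_field_components[OF has_vector_derivative_at_within[OF Y[OF t]], of I]
    have db: "((\<lambda>t. snd (fst (Y t))) has_real_derivative c) (at t within I)"
      using bounded_linear.has_vector_derivative[OF bounded_linear_snd d(1)]
      by (simp add: has_real_derivative_iff_has_vector_derivative c_def)
    have "((\<lambda>t. cross (fst (Y t)) (snd (Y t))) has_vector_derivative
        cross (fst (Y t)) (- fst (Y t) + \<kappa> *\<^sub>R n) + cross (snd (Y t)) (snd (Y t))) (at t within I)"
      unfolding n_def \<kappa>_def b_def by (rule has_vector_derivative_cross[OF d])
    moreover have "cross (fst (Y t)) (- fst (Y t) + \<kappa> *\<^sub>R n) + cross (snd (Y t)) (snd (Y t)) = - \<kappa> *\<^sub>R snd (Y t)"
      using orth[OF t] unfolding orthonormal_pair_def n_def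
      by (simp only: cross_add_right cross_minus_right cross_scaleR_right cross_cross_right cross_self) simp
    ultimately have "((\<lambda>t. cross (fst (Y t)) (snd (Y t))) has_vector_derivative - \<kappa> *\<^sub>R snd (Y t)) (at t within I)"
      by simp
    from bounded_linear.has_vector_derivative[OF bounded_linear_snd this]
    have dn: "((\<lambda>t. snd (cross (fst (Y t)) (snd (Y t)))) has_real_derivative - \<kappa> * c) (at t within I)"
      by (simp add: has_real_derivative_iff_has_vector_derivative c_def)
    have a1: "a * (real \<mu> + 1) = h" by (simp add: a_def add_pos_pos)
    have bp: "b ^ \<mu> = b * b ^ (\<mu> - 1)" using mu_pos by (simp add: power_eq_if)
    have "((\<lambda>t. flux (Y t)) has_real_derivative
        real \<mu> * b ^ (\<mu> - 1) * c * snd n - b ^ \<mu> * (\<kappa> * c) + a * (real \<mu> + 1) * b ^ \<mu> * c) (at t within I)"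
      unfolding flux_def
      by (rule derivative_eq_intros db dn refl | simp add: b_def n_def algebra_simps del: power_Suc)+
    moreover have "real \<mu> * b ^ (\<mu> - 1) * c * snd n - b ^ \<mu> * (\<kappa> * c) + a * (real \<mu> + 1) * b ^ \<mu> * c = 0"
      unfolding a1 \<kappa>_def bp using b by (simp add: field_simps)
    ultimately show "((\<lambda>t. flux (Y t)) has_real_derivative 0) (at t within I)" by simp
  qed
  then show ?thesis using I(2,3) by force
qed

text \<open>To be read as a lower bound for the height, at least \<open>flux Y / (1 + a)\<close>.
  The coordinates of the frame are at most 1, and \<open>\<mu> \<ge> 1\<close> makes the powers of
  the height at most the height itself.\<close>

lemma flux_lower_bound:
  assumes "orthonormal_pair Y" "snd (fst Y) > 0"
  shows "flux Y \<le> snd (fst Y) * (1 + a)"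
proof -
  define b n where "b = snd (fst Y)" and "n = snd (cross (fst Y) (snd Y))"
  have fr: "b\<^sup>2 + (snd (snd Y))\<^sup>2 + n\<^sup>2 = 1"
    using orthonormal_frame_third_coordinate[of "fst Y" "snd Y"] assms(1)
    by (simp add: orthonormal_pair_def b_def n_def)
  have b: "0 < b" using assms(2) by (simp add: b_def)
  have n1: "n \<le> 1"
    using fr zero_le_power2[of b] zero_le_power2[of "snd (snd Y)"]
    by (intro power2_le_imp_le[of n 1]; simp; linarith)
  have b1: "b \<le> 1"
    using fr zero_le_power2[of n] zero_le_power2[of "snd (snd Y)"]
    by (intro power2_le_imp_le[of b 1]; simp; linarith)
  have p: "b ^ \<mu> \<le> b" "b ^ Suc \<mu> \<le> b"
    using power_decreasing[of 1 \<mu> b] power_decreasing[of 1 "Suc \<mu>" b] mu_pos b b1 by auto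
  have "flux Y = b ^ \<mu> * n + a * b ^ Suc \<mu>" by (simp add: flux_def b_def n_def)
  also have "\<dots> \<le> b ^ \<mu> * 1 + a * b ^ Suc \<mu>" using n1 b a_pos by (intro add_mono mult_left_mono) auto
  also have "\<dots> \<le> b + a * b" using p a_pos by (intro add_mono mult_left_mono) auto
  finally show ?thesis by (simp add: b_def algebra_simps)
qed

definition trajectory :: "(real \<Rightarrow> complex \<times> real) \<Rightarrow> (real \<Rightarrow> complex \<times> real) \<Rightarrow> bool" where
  "trajectory p q \<longleftrightarrow> (\<forall>t. ((\<lambda>t. (p t, q t)) has_vector_derivative curve_field h (real \<mu>) (p t, q t)) (at t)) \<and>
     (\<forall>t. orthonormal_pair (p t, q t) \<and> snd (p t) > 0)"

end

text \<open>A continuation argument. At the first parameter \<open>m\<close> at which the curve is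
  outside \<open>U\<close>, all earlier points lie in \<open>U\<close>, so closedness puts the whole
  stretch up to \<open>m\<close> into \<open>K\<close>; then \<open>step\<close> puts the point at
  \<open>m\<close> back into \<open>U\<close>.\<close>

lemma stays_inside:
  fixes Y :: "real \<Rightarrow> 'a::topological_space"
  assumes cont: "continuous_on UNIV Y" and K: "closed K" and U: "open U" "U \<subseteq> K" and init: "Y 0 \<in> K"
    and step: "\<And>t. (\<And>s. s \<in> closed_segment 0 t \<Longrightarrow> Y s \<in> K) \<Longrightarrow> Y t \<in> U"
  shows "Y t \<in> U"
proof (rule ccontr)
  assume t: "Y t \<notin> U"
  \<comment> \<open>Scaling time to \<open>{0..1}\<close> treats positive and negative
    \<open>t\<close> alike.\<close>
  define Z where "Z u = Y (u * t)" for u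
  have contZ: "continuous_on UNIV Z"
    unfolding Z_def by (intro continuous_on_compose2[OF cont] continuous_intros) auto
  define B where "B = {u\<in>{0..1}. Z u \<notin> U}"
  have "B = {0..1} \<inter> Z -` (- U)" by (auto simp: B_def)
  moreover have "closed (Z -` (- U))" using closed_vimage[OF _ contZ] U by auto
  ultimately have "compact B" by (simp add: compact_Int_closed)
  moreover have "B \<noteq> {}" using t by (auto simp: B_def Z_def intro!: exI[of _ 1])
  ultimately obtain m where m: "m \<in> B" "\<And>u. u \<in> B \<Longrightarrow> m \<le> u"
    using compact_attains_inf[of B] by auto
  have Y0: "Y 0 \<in> U" using step[of 0] init by simp
  then have m0: "0 < m" using m(1) by (cases "m = 0") (auto simp: B_def Z_def)
  have "Z u \<in> K" if "u \<in> {0<..<m}" for u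
    using m(2)[of u] that m(1) U(2) by (auto simp: B_def)
  then have "{0<..<m} \<subseteq> Z -` K" by auto
  moreover have "closed (Z -` K)" using closed_vimage[OF K contZ] .
  ultimately have "{0..m} \<subseteq> Z -` K"
    using closure_minimal[of "{0<..<m}" "Z -` K"] m0 by simp
  then have "Y s \<in> K" if s: "s \<in> closed_segment 0 (m * t)" for s
  proof -
    obtain u where u: "0 \<le> u" "u \<le> 1" "s = u * (m * t)"
      using s by (auto simp: in_segment)
    have "u * m \<in> {0..m}" using u m0 by (simp add: mult_left_le_one_le)
    with \<open>{0..m} \<subseteq> Z -` K\<close> have "Z (u * m) \<in> K" by blast
    then show ?thesis by (simp add: Z_def u(3) mult.assoc)
  qed
  from step[OF this] m(1) show False by (simp add: B_def Z_def)
qed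

context delaunay_field begin

text \<open>The field is Lipschitz only away from \<open>b = 0\<close>. It is composed with the nearest-point projection
  onto a compact convex set, which the solution cannot leave because its flux bounds \<open>b\<close> from below.\<close>

theorem trajectory_exists:
  assumes orth: "orthonormal_pair (p0, q0)" and b0: "snd p0 > 0" and flux: "flux (p0, q0) > 0"
  shows "\<exists>p q. trajectory p q \<and> p 0 = p0 \<and> q 0 = q0"
proof -
  \<comment> \<open>Half of the bound from \<open>flux_lower_bound\<close>, so that frames with the
    given flux stay strictly above \<open>\<beta>\<close>.\<close>
  define \<beta> where "\<beta> = flux (p0, q0) / (2 * (1 + a))"
  have \<beta>: "\<beta> > 0" using flux a_pos by (simp add: \<beta>_def)
  \<comment> \<open>Radius 2 leaves room around unit vectors, so that frames lie in the open set
    \<open>U\<close> and not on the boundary of \<open>K\<close>.\<close>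
  define K where "K = (cball 0 2 \<times> cball 0 2) \<inter> {Y :: (complex \<times> real) \<times> (complex \<times> real). ((0, 1), 0) \<bullet> Y \<ge> \<beta>}"
  define U where "U = (ball 0 2 \<times> ball 0 2) \<inter> {Y :: (complex \<times> real) \<times> (complex \<times> real). ((0, 1), 0) \<bullet> Y > \<beta>}"
  have half: "((0, 1), 0) \<bullet> Y = snd (fst Y)" for Y :: "(complex \<times> real) \<times> (complex \<times> real)"
    by (simp add: inner_prod_def)
  have K: "closed K" "convex K" "bounded K" unfolding K_def
    by (auto intro!: closed_Int closed_Times closed_halfspace_ge convex_Int convex_Times convex_halfspace_ge
        bounded_Int bounded_Times)
  have U: "open U" "U \<subseteq> K" unfolding U_def K_def
    by (auto intro!: open_Int open_Times open_halfspace_gt)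
  have orthU: "Y \<in> U" if Y: "orthonormal_pair Y" "snd (fst Y) > \<beta>" for Y
  proof -
    have "norm (fst Y) = 1" "norm (snd Y) = 1"
      using Y(1) by (auto simp: orthonormal_pair_def norm_eq_sqrt_inner)
    moreover have "fst Y \<in> ball 0 2" "snd Y \<in> ball 0 2" using calculation by simp_all
    ultimately show ?thesis unfolding U_def using Y(2) by (simp add: half mem_Times_iff)
  qed
  have above: "snd (fst Y) > \<beta>" if "orthonormal_pair Y" "snd (fst Y) > 0" "flux Y = flux (p0, q0)" for Y
  proof -
    have "2 * \<beta> * (1 + a) = flux (p0, q0)" using a_pos by (simp add: \<beta>_def field_simps)
    also have "\<dots> \<le> snd (fst Y) * (1 + a)" using flux_lower_bound[OF that(1,2)] that(3) by simp
    finally have "2 * \<beta> \<le> snd (fst Y)" using a_pos by simp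
    then show ?thesis using \<beta> by simp
  qed
  have init: "(p0, q0) \<in> K" using orthU[OF orth] above[OF orth] b0 U by auto
  then have Kne: "K \<noteq> {}" by auto
  obtain L where L: "L-lipschitz_on K (curve_field h (real \<mu>))"
    using curve_field_lipschitz[OF K(3) \<beta>] by (auto simp: K_def half)
  have "1-lipschitz_on UNIV (closest_point K)"
    using closest_point_lipschitz[OF K(2,1) Kne] by (intro lipschitz_onI) auto
  then have lip: "(L * 1)-lipschitz_on UNIV (\<lambda>Y. curve_field h (real \<mu>) (closest_point K Y))"
    by (rule lipschitz_on_compose2)
      (rule lipschitz_on_subset[OF L], use closest_point_in_set[OF K(1) Kne] in auto)
  then obtain Y where Y0: "Y 0 = (p0, q0)"
    and dY: "\<And>t. (Y has_vector_derivative curve_field h (real \<mu>) (closest_point K (Y t))) (at t)"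
    using lipschitz_ode_solution_exists[OF lip] by blast
  have contY: "continuous_on UNIV Y"
    using dY by (rule continuous_on_if_derivative)
  \<comment> \<open>While the solution is in \<open>K\<close> the projection does nothing. Both
    conservation laws then hold up to time \<open>t\<close>, and they return the solution to
    \<open>U\<close>.\<close>
  have seg: "orthonormal_pair (Y t) \<and> flux (Y t) = flux (p0, q0) \<and> Y t \<in> U"
    if inK: "\<And>s. s \<in> closed_segment 0 t \<Longrightarrow> Y s \<in> K" for t
  proof -
    have d: "(Y has_vector_derivative curve_field h (real \<mu>) (Y s)) (at s)" if "s \<in> closed_segment 0 t" for s
      using dY[of s] closest_point_self[OF inK[OF that]] by simp
    have o: "orthonormal_pair (Y s)" if "s \<in> closed_segment 0 t" for s
      by (rule orthonormal_pair_preserved[OF convex_closed_segment ends_in_segment(1) that _ d])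
        (use Y0 orth in auto)
    have b: "snd (fst (Y s)) > 0" if "s \<in> closed_segment 0 t" for s
      using inK[OF that] \<beta> by (auto simp: K_def half)
    have f: "flux (Y t) = flux (p0, q0)"
      using flux_preserved[OF convex_closed_segment ends_in_segment(1,2) o b d] Y0 by simp
    show ?thesis using o b f above orthU ends_in_segment(2) by blast
  qed
  have inU: "Y t \<in> U" for t
    by (rule stays_inside[OF contY K(1) U]) (use init Y0 seg in auto)
  have "trajectory (\<lambda>t. fst (Y t)) (\<lambda>t. snd (Y t))"
    unfolding trajectory_def
  proof (intro conjI allI)
    fix t
    have inK: "Y s \<in> K" for s using inU U by auto
    show "((\<lambda>t. (fst (Y t), snd (Y t))) has_vector_derivative curve_field h (real \<mu>) (fst (Y t), snd (Y t))) (at t)"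
      using dY[of t] closest_point_self[OF inK] by simp
    show "orthonormal_pair (fst (Y t), snd (Y t))" using seg[OF inK] by simp
    show "snd (fst (Y t)) > 0" using inU[of t] \<beta> by (auto simp: U_def half)
  qed
  then show ?thesis using Y0 by (intro exI[of _ "\<lambda>t. fst (Y t)"] exI[of _ "\<lambda>t. snd (Y t)"]) simp
qed

end

section \<open>The admissible interval\<close>

context delaunay_field begin

abbreviation L :: "real \<Rightarrow> real" where "L \<equiv> L_fun (\<mu> + 2)"
abbreviation R :: "real \<Rightarrow> real \<Rightarrow> real" where "R s C \<equiv> R_fun (\<mu> + 2) s C (- h)"
abbreviation J :: "real \<Rightarrow> real set" where "J C \<equiv> J_set (\<mu> + 2) C (- h)"
abbreviation piece :: "real \<Rightarrow> (real \<Rightarrow> complex \<times> real) \<Rightarrow> real set \<Rightarrow> bool" where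
  "piece C \<equiv> local_piece (\<mu> + 2) (- h) C"
abbreviation field :: "(complex \<times> real) \<times> (complex \<times> real) \<Rightarrow> (complex \<times> real) \<times> (complex \<times> real)" where
  "field \<equiv> curve_field h (real \<mu>)"

text \<open>Since \<open>R s C = C - a sin^(\<mu>+1) s\<close>, the condition \<open>|R| < L\<close>
  splits into \<open>C < U s\<close> and \<open>W s < C\<close>, where \<open>U\<close> and
  \<open>W\<close> are independent of \<open>C\<close>.\<close>

definition U :: "real \<Rightarrow> real" where "U s = a * sin s ^ Suc \<mu> + cos s * sin s ^ \<mu>"
definition W :: "real \<Rightarrow> real" where "W s = a * sin s ^ Suc \<mu> - cos s * sin s ^ \<mu>"
text \<open>Up to the factor \<open>sin s ^ (\<mu> - 1)\<close>, \<open>PU\<close> and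
  \<open>PW\<close> are the derivatives of \<open>U\<close> and \<open>W\<close>.\<close>

definition PU :: "real \<Rightarrow> real" where "PU s = \<mu> * (cos s)\<^sup>2 - (sin s)\<^sup>2 + h * sin s * cos s"
definition PW :: "real \<Rightarrow> real" where "PW s = (sin s)\<^sup>2 - \<mu> * (cos s)\<^sup>2 + h * sin s * cos s"
text \<open>\<open>xU\<close> and \<open>-xW\<close> are the roots of \<open>x\<^sup>2 - h x - \<mu>\<close>, whose values at \<open>x = tan s\<close> and
  \<open>x = - tan s\<close> are \<open>- PU s / cos\<^sup>2 s\<close> and \<open>PW s / cos\<^sup>2 s\<close>.\<close>

definition xU :: real where "xU = (sqrt (h\<^sup>2 + 4 * \<mu>) + h) / 2"
definition xW :: real where "xW = (sqrt (h\<^sup>2 + 4 * \<mu>) - h) / 2"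
definition sU :: real where "sU = arctan xU"
definition sW :: real where "sW = arctan xW"

lemma a_mult: "a * (real \<mu> + 1) = h"
  by (simp add: a_def add_pos_pos)

lemma L_fun_eq: "L s = cos s * sin s ^ \<mu>"
  by (simp add: L_fun_def)

lemma R_fun_eq: "R s C = C - a * sin s ^ Suc \<mu>"
  by (simp add: R_fun_def a_def del: power_Suc)

lemma mem_J_set_iff: "s \<in> J C \<longleftrightarrow> 0 < s \<and> s < pi / 2 \<and> C < U s \<and> W s < C"
  unfolding J_set_def L_fun_eq R_fun_eq by (auto simp: U_def W_def simp del: power_Suc)

lemma xU_xW: "xU > 0" "xW > 0" "xU - xW = h" "xU * xW = \<mu>"
proof -
  have "sqrt (h\<^sup>2 + 4 * \<mu>) > sqrt (h\<^sup>2)" using mu_pos by (intro real_sqrt_less_mono) simp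
  then have "sqrt (h\<^sup>2 + 4 * \<mu>) > h" using h_pos by simp
  then show "xU > 0" "xW > 0" using h_pos by (simp_all add: xU_def xW_def)
  show "xU - xW = h" by (simp add: xU_def xW_def field_simps)
  have "(sqrt (h\<^sup>2 + 4 * \<mu>))\<^sup>2 = h\<^sup>2 + 4 * \<mu>" by simp
  then show "xU * xW = \<mu>" unfolding xU_def xW_def by (simp add: field_simps power2_eq_square)
qed

lemma sU_sW: "0 < sU" "sU < pi / 2" "0 < sW" "sW < pi / 2"
  using xU_xW arctan_bounded by (auto simp: sU_def sW_def)

lemma PU_factor: "cos s \<noteq> 0 \<Longrightarrow> PU s = (cos s)\<^sup>2 * (xU - tan s) * (tan s + xW)"
  and PW_factor: "cos s \<noteq> 0 \<Longrightarrow> PW s = (cos s)\<^sup>2 * (tan s - xW) * (tan s + xU)"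
proof -
  assume c: "cos s \<noteq> 0"
  then have s: "sin s = tan s * cos s" by (simp add: tan_def)
  have "PU s = (cos s)\<^sup>2 * (xU * xW - (tan s)\<^sup>2 + (xU - xW) * tan s)"
    unfolding PU_def xU_xW s by (simp add: power2_eq_square algebra_simps)
  then show "PU s = (cos s)\<^sup>2 * (xU - tan s) * (tan s + xW)"
    by (simp add: power2_eq_square algebra_simps)
  have "PW s = (cos s)\<^sup>2 * ((tan s)\<^sup>2 - xU * xW + (xU - xW) * tan s)"
    unfolding PW_def xU_xW s by (simp add: power2_eq_square algebra_simps)
  then show "PW s = (cos s)\<^sup>2 * (tan s - xW) * (tan s + xU)"
    by (simp add: power2_eq_square algebra_simps)
qed

lemma tan_less_iff: "0 < s \<Longrightarrow> s < pi / 2 \<Longrightarrow> tan s < x \<longleftrightarrow> s < arctan x"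
  using arctan_tan[of s] arctan_less_iff[of "tan s" x] by simp

lemma less_tan_iff: "0 < s \<Longrightarrow> s < pi / 2 \<Longrightarrow> x < tan s \<longleftrightarrow> arctan x < s"
  using arctan_tan[of s] arctan_less_iff[of x "tan s"] by simp

lemma PU_pos: "0 < s \<Longrightarrow> s < sU \<Longrightarrow> PU s > 0"
  using tan_less_iff[of s xU] sU_sW xU_xW cos_gt_zero[of s] tan_gt_zero[of s]
  by (simp add: PU_factor sU_def[symmetric] zero_less_mult_iff)

lemma PU_neg: "sU < s \<Longrightarrow> s \<le> pi / 2 \<Longrightarrow> PU s < 0"
proof (cases "s = pi / 2")
  case True
  show ?thesis unfolding True PU_def by simp
next
  case False
  assume s: "sU < s" "s \<le> pi / 2"
  with False have "0 < s" "s < pi / 2" using sU_sW by auto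
  with less_tan_iff[of s xU] s xU_xW cos_gt_zero[of s] show ?thesis
    by (simp add: PU_factor sU_def[symmetric] mult_less_0_iff)
qed

lemma PW_neg: "0 < s \<Longrightarrow> s < sW \<Longrightarrow> PW s < 0"
  using tan_less_iff[of s xW] sU_sW xU_xW cos_gt_zero[of s] tan_gt_zero[of s]
  by (simp add: PW_factor sW_def[symmetric] mult_less_0_iff)

lemma PW_pos: "sW < s \<Longrightarrow> s \<le> pi / 2 \<Longrightarrow> PW s > 0"
proof (cases "s = pi / 2")
  case True
  show ?thesis unfolding True PW_def by simp
next
  case False
  assume s: "sW < s" "s \<le> pi / 2"
  with False have "0 < s" "s < pi / 2" using sU_sW by auto
  with less_tan_iff[of s xW] s xU_xW cos_gt_zero[of s] show ?thesis
    by (simp add: PW_factor sW_def[symmetric] zero_less_mult_iff)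
qed

section \<open>Monotonicity of \<open>U\<close> and \<open>W\<close> and the critical
  parameter\<close>

lemma U_deriv: "(U has_real_derivative sin s ^ (\<mu> - 1) * PU s) (at s)"
  and W_deriv: "(W has_real_derivative sin s ^ (\<mu> - 1) * PW s) (at s)"
proof -
  have p: "sin s ^ \<mu> = sin s * sin s ^ (\<mu> - 1)" using mu_pos by (simp add: power_eq_if)
  have "(U has_real_derivative (a * (real \<mu> + 1)) * sin s ^ \<mu> * cos s
      + (cos s * (real \<mu> * sin s ^ (\<mu> - 1) * cos s) - sin s * sin s ^ \<mu>)) (at s)"
    unfolding U_def
    by (rule derivative_eq_intros refl | simp add: algebra_simps del: power_Suc)+
  then show "(U has_real_derivative sin s ^ (\<mu> - 1) * PU s) (at s)"
    unfolding a_mult p PU_def by (simp add: power2_eq_square algebra_simps)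
  have "(W has_real_derivative (a * (real \<mu> + 1)) * sin s ^ \<mu> * cos s
      - (cos s * (real \<mu> * sin s ^ (\<mu> - 1) * cos s) - sin s * sin s ^ \<mu>)) (at s)"
    unfolding W_def
    by (rule derivative_eq_intros refl | simp add: algebra_simps del: power_Suc)+
  then show "(W has_real_derivative sin s ^ (\<mu> - 1) * PW s) (at s)"
    unfolding a_mult p PW_def by (simp add: power2_eq_square algebra_simps)
qed

lemma continuous_U: "continuous_on A U" and continuous_W: "continuous_on A W"
  unfolding U_def W_def by (intro continuous_intros)+

lemma sin_pos_quadrant: "0 < s \<Longrightarrow> s \<le> pi / 2 \<Longrightarrow> sin s > 0"
  by (rule sin_gt_zero) (use pi_half_less_two pi_gt_zero in linarith)+

lemma U_increasing: "0 \<le> s \<Longrightarrow> s < t \<Longrightarrow> t \<le> sU \<Longrightarrow> U s < U t"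
proof (rule DERIV_pos_imp_increasing_open[where f = U])
  fix x assume *: "0 \<le> s" "t \<le> sU" "s < x" "x < t"
  have "sin x > 0" using * sU_sW by (intro sin_pos_quadrant) auto
  then show "\<exists>y. (U has_real_derivative y) (at x) \<and> 0 < y"
    using PU_pos[of x] * \<open>sin x > 0\<close> by (intro exI[of _ "sin x ^ (\<mu> - 1) * PU x"] conjI U_deriv) auto
qed (auto intro: continuous_U)

lemma U_decreasing: "sU \<le> s \<Longrightarrow> s < t \<Longrightarrow> t \<le> pi / 2 \<Longrightarrow> U t < U s"
proof (rule DERIV_neg_imp_decreasing_open[where f = U])
  fix x assume *: "sU \<le> s" "t \<le> pi / 2" "s < x" "x < t"
  have "sin x > 0" using * sU_sW by (intro sin_pos_quadrant) auto
  then show "\<exists>y. (U has_real_derivative y) (at x) \<and> y < 0"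
    using PU_neg[of x] * \<open>sin x > 0\<close>
    by (intro exI[of _ "sin x ^ (\<mu> - 1) * PU x"] conjI U_deriv) (auto simp: mult_less_0_iff)
qed (auto intro: continuous_U)

lemma W_decreasing: "0 \<le> s \<Longrightarrow> s < t \<Longrightarrow> t \<le> sW \<Longrightarrow> W t < W s"
proof (rule DERIV_neg_imp_decreasing_open[where f = W])
  fix x assume *: "0 \<le> s" "t \<le> sW" "s < x" "x < t"
  have "sin x > 0" using * sU_sW by (intro sin_pos_quadrant) auto
  then show "\<exists>y. (W has_real_derivative y) (at x) \<and> y < 0"
    using PW_neg[of x] * \<open>sin x > 0\<close>
    by (intro exI[of _ "sin x ^ (\<mu> - 1) * PW x"] conjI W_deriv) (auto simp: mult_less_0_iff)
qed (auto intro: continuous_W)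

lemma W_increasing: "sW \<le> s \<Longrightarrow> s < t \<Longrightarrow> t \<le> pi / 2 \<Longrightarrow> W s < W t"
proof (rule DERIV_pos_imp_increasing_open[where f = W])
  fix x assume *: "sW \<le> s" "t \<le> pi / 2" "s < x" "x < t"
  have "sin x > 0" using * sU_sW by (intro sin_pos_quadrant) auto
  then show "\<exists>y. (W has_real_derivative y) (at x) \<and> 0 < y"
    using PW_pos[of x] * \<open>sin x > 0\<close> by (intro exI[of _ "sin x ^ (\<mu> - 1) * PW x"] conjI W_deriv) auto
qed (auto intro: continuous_W)

lemma UW_endpoints: "U 0 = 0" "W 0 = 0" "U (pi / 2) = a" "W (pi / 2) = a"
  using mu_pos by (simp_all add: U_def W_def)

lemma W_le: "sW \<le> s \<Longrightarrow> s \<le> pi / 2 \<Longrightarrow> W s \<le> a"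
proof (cases "s = pi / 2")
  case True
  then show ?thesis unfolding True UW_endpoints by simp
next
  case False
  assume "sW \<le> s" "s \<le> pi / 2"
  with False W_increasing[of s "pi / 2"] show ?thesis unfolding UW_endpoints by simp
qed

lemma U_ge: "sU \<le> s \<Longrightarrow> s \<le> pi / 2 \<Longrightarrow> a \<le> U s"
proof (cases "s = pi / 2")
  case True
  then show ?thesis unfolding True UW_endpoints by simp
next
  case False
  assume "sU \<le> s" "s \<le> pi / 2"
  with False U_decreasing[of s "pi / 2"] show ?thesis unfolding UW_endpoints by simp
qed

text \<open>Multiplied by \<open>tan s\<close>, the defining equation becomes
  \<open>(xU - tan s) (tan s + xW) = 0\<close>. So \<open>s_crit\<close> is the point where
  \<open>U\<close> stops increasing and starts decreasing, and \<open>C_crit\<close> is the maximum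
  of \<open>U\<close>.\<close>

lemma s_crit_eq: "s_crit (\<mu> + 2) (- h) = sU"
  unfolding s_crit_def
proof (rule the_equality)
  have "cot sU = 1 / xU" by (simp add: cot_altdef sU_def tan_arctan inverse_eq_divide)
  moreover have "real \<mu> * (1 / xU) = xW"
    using xU_xW(1) by (simp add: divide_eq_eq mult.commute xU_xW(4))
  ultimately have "- tan sU + real \<mu> * cot sU = - h"
    using xU_xW(3) by (simp add: sU_def tan_arctan)
  then show "sU \<in> {0<..<pi / 2} \<and> - tan sU + (real (\<mu> + 2) - 2) * cot sU = - h" using sU_sW by simp
next
  fix s assume s: "s \<in> {0<..<pi / 2} \<and> - tan s + (real (\<mu> + 2) - 2) * cot s = - h"
  then have t: "tan s > 0" by (auto intro: tan_gt_zero)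
  have "- tan s + \<mu> * (1 / tan s) = - h" using s by (simp add: cot_altdef inverse_eq_divide)
  then have "- tan s * tan s + \<mu> = - h * tan s" using t by (simp add: field_simps)
  then have 1: "\<mu> - tan s * tan s + h * tan s = 0" by simp
  have "(xU - tan s) * (tan s + xW) = xU * xW - tan s * tan s + (xU - xW) * tan s"
    by (simp add: algebra_simps)
  also have "\<dots> = 0" unfolding xU_xW(3,4) by (rule 1)
  finally have "tan s = xU" using t xU_xW(2) by simp
  then show "s = sU" unfolding sU_def using s arctan_tan[of s] by auto
qed

lemma C_crit_eq: "C_crit (\<mu> + 2) (- h) = U sU"
  unfolding C_crit_def s_crit_eq L_fun_eq by (simp add: U_def a_def del: power_Suc)

lemma a_less_C_crit: "a < U sU"
  using U_decreasing[of sU "pi / 2"] sU_sW UW_endpoints by simp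

text \<open>The value of \<open>\<nu>\<^sub>b\<close> that flux \<open>C\<close> forces at height
  \<open>b\<close>. Inserted into the field it gives the vertical acceleration \<open>accel\<close>
  as a function of the height alone.\<close>

definition slope :: "real \<Rightarrow> real \<Rightarrow> real" where
  "slope C b = (C - a * b ^ Suc \<mu>) / b ^ \<mu>"

definition accel :: "real \<Rightarrow> real \<Rightarrow> real" where
  "accel C b = - b + (h + \<mu> * slope C b / b) * slope C b"

text \<open>At a zero of \<open>U - C\<close> or \<open>W - C\<close> one has
  \<open>\<nu>\<^sub>b = cos s\<close> or \<open>\<nu>\<^sub>b = - cos s\<close>. The acceleration
  at a turning point thus has the sign of \<open>PU\<close> or \<open>- PW\<close>, which rules out
  equilibria there.\<close>

lemma accel_U: "0 < s \<Longrightarrow> s \<le> pi / 2 \<Longrightarrow> U s = C \<Longrightarrow> accel C (sin s) = PU s / sin s"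
  and accel_W: "0 < s \<Longrightarrow> s \<le> pi / 2 \<Longrightarrow> W s = C \<Longrightarrow> accel C (sin s) = - PW s / sin s"
proof -
  assume s: "0 < s" "s \<le> pi / 2"
  have pos: "sin s > 0" using sin_pos_quadrant[OF s] .
  { assume "U s = C"
    then have "slope C (sin s) = cos s" using pos by (auto simp: slope_def U_def simp del: power_Suc)
    then show "accel C (sin s) = PU s / sin s"
      using pos by (simp add: accel_def PU_def field_simps power2_eq_square) }
  { assume "W s = C"
    then have "slope C (sin s) = - cos s" using pos by (auto simp: slope_def W_def simp del: power_Suc)
    then show "accel C (sin s) = - PW s / sin s"
      using pos by (simp add: accel_def PW_def field_simps power2_eq_square) }
qed

lemma W_less_U: "0 < s \<Longrightarrow> s < pi / 2 \<Longrightarrow> W s < U s"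
  using sin_pos_quadrant[of s] cos_gt_zero[of s] by (simp add: U_def W_def)

text \<open>The upper end of the admissible interval is a zero of \<open>U - C\<close> for unduloids, of \<open>W - C\<close> for
  nodoids; the two cases merge at the pole for \<open>C = a\<close>.\<close>

theorem admissible_interval:
  assumes C: "0 < C" "C < U sU"
  shows "\<exists>s\<^sub>0 s\<^sub>1. 0 < s\<^sub>0 \<and> s\<^sub>0 < s\<^sub>1 \<and> s\<^sub>1 \<le> pi / 2 \<and> s\<^sub>0 < sU \<and> (s\<^sub>1 = pi / 2 \<longleftrightarrow> C = a) \<and> U s\<^sub>0 = C \<and>
     (\<forall>s. 0 < s \<longrightarrow> s < pi / 2 \<longrightarrow> (C < U s \<and> W s < C \<longleftrightarrow> s\<^sub>0 < s \<and> s < s\<^sub>1)) \<and>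
     (\<forall>s. 0 < s \<longrightarrow> s \<le> pi / 2 \<longrightarrow> C \<le> U s \<longrightarrow> W s \<le> C \<longrightarrow> s\<^sub>0 \<le> s \<and> s \<le> s\<^sub>1) \<and>
     accel C (sin s\<^sub>0) > 0 \<and> accel C (sin s\<^sub>1) < 0"
proof -
  obtain s0 where s0: "0 \<le> s0" "s0 \<le> sU" "U s0 = C"
    using IVT'[of U 0 C sU] C sU_sW UW_endpoints continuous_U by auto
  have s0': "0 < s0" "s0 < sU"
    using s0 C UW_endpoints by (auto simp: le_less)
  have U0: "C < U s \<longleftrightarrow> s0 < s" if "0 < s" "s \<le> sU" for s
    using U_increasing[of s s0] U_increasing[of s0 s] that s0 s0' by (cases s s0 rule: linorder_cases) auto
  have acc0: "accel C (sin s0) > 0"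
    using accel_U[of s0 C] PU_pos[of s0] sin_pos_quadrant[of s0] s0 s0' sU_sW by simp
  have W_small: "W s < C" if "0 < s" "s \<le> sW" for s
    using W_decreasing[of 0 s] that C UW_endpoints by simp
  have le_U: "s0 \<le> s" if "0 < s" "C \<le> U s" for s
    using U_increasing[of s s0] that s0 s0' by (cases "s < s0") auto
  consider "C > a" | "C = a" | "C < a" by linarith
  then show ?thesis
  proof cases
    \<comment> \<open>\<open>W\<close> never reaches \<open>C\<close>: it is negative up to
      \<open>sW\<close> and at most \<open>a\<close> afterwards. Both ends are therefore zeros of
      \<open>U - C\<close>, one on each branch of \<open>U\<close>.\<close>
    case 1
    obtain s1 where s1: "sU \<le> s1" "s1 \<le> pi / 2" "U s1 = C"
      using IVT2'[of U "pi/2" C sU] 1 C sU_sW UW_endpoints continuous_U by auto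
    have "s1 \<noteq> pi / 2" 
    proof
      assume eq: "s1 = pi / 2"
      show False using s1(3) 1 UW_endpoints(3) unfolding eq by simp
    qed
    then have s1': "sU < s1" "s1 < pi / 2" using s1 C by (auto simp: le_less)
    have U1: "C < U s \<longleftrightarrow> s < s1" if "sU \<le> s" "s \<le> pi / 2" for s
      using U_decreasing[of s s1] U_decreasing[of s1 s] that s1 s1' by (cases s s1 rule: linorder_cases) auto
    have W1: "W s < C" if "0 < s" "s \<le> pi / 2" for s
      using W_small[of s] W_le[of s] that 1 by (cases "s \<le> sW") auto
    have "accel C (sin s1) < 0"
      using accel_U[of s1 C] PU_neg[of s1] sin_pos_quadrant[of s1] s1 s1' sU_sW by (simp add: divide_less_0_iff)
    moreover have "C < U s \<and> W s < C \<longleftrightarrow> s0 < s \<and> s < s1" if "0 < s" "s < pi / 2" for s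
      using U0[of s] U1[of s] W1[of s] that s0' s1' by (cases "s \<le> sU") auto
    moreover have "s \<le> s1" if "0 < s" "s \<le> pi / 2" "C \<le> U s" for s
      using U_decreasing[of s1 s] that s1 s1' by (cases "s1 < s") auto
    ultimately show ?thesis using s0 s0' s1 s1' acc0 le_U 1
      by (intro exI[of _ s0] exI[of _ s1]) auto
  next
    \<comment> \<open>\<open>U\<close> tends to \<open>a\<close> from above and \<open>W\<close>
      from below as \<open>s\<close> tends to \<open>pi / 2\<close>, so neither condition fails
      before \<open>pi / 2\<close>.\<close>
    case 2
    have U1: "C < U s" if "sU \<le> s" "s < pi / 2" for s
      using U_decreasing[of s "pi / 2"] that 2 UW_endpoints by simp
    have W1: "W s < C" if "0 < s" "s < pi / 2" for s
      using W_small[of s] W_increasing[of s "pi / 2"] that 2 UW_endpoints by (cases "s \<le> sW") auto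
    have "accel C (sin (pi / 2)) < 0"
      using accel_U[of "pi / 2" C] PU_neg[of "pi / 2"] sU_sW UW_endpoints 2 by simp
    moreover have "C < U s \<and> W s < C \<longleftrightarrow> s0 < s \<and> s < pi / 2" if "0 < s" "s < pi / 2" for s
      using U0[of s] U1[of s] W1[of s] that s0' by (cases "s \<le> sU") auto
    ultimately show ?thesis using s0 s0' acc0 le_U 2 sU_sW
      by (intro exI[of _ s0] exI[of _ "pi / 2"]) auto
  next
    \<comment> \<open>\<open>U\<close> stays at least \<open>a > C\<close> beyond \<open>sU\<close>,
      so only the increasing branch of \<open>W\<close> can close the interval.\<close>
    case 3
    have "W sW < C" using W_small sU_sW by simp
    then obtain s1 where s1: "sW \<le> s1" "s1 \<le> pi / 2" "W s1 = C"
      using IVT'[of W sW C "pi / 2"] 3 C sU_sW UW_endpoints continuous_W by auto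
    have "s1 \<noteq> pi / 2" 
    proof
      assume eq: "s1 = pi / 2"
      show False using s1(3) 3 UW_endpoints(4) unfolding eq by simp
    qed
    then have s1': "sW < s1" "s1 < pi / 2" using s1 \<open>W sW < C\<close> by (auto simp: le_less)
    have W1: "W s < C \<longleftrightarrow> s < s1" if "0 < s" "s \<le> pi / 2" for s
      using W_small[of s] W_increasing[of s s1] W_increasing[of s1 s] that s1 s1'
      by (cases "s \<le> sW"; cases s s1 rule: linorder_cases) auto
    have U1: "C < U s" if "sU \<le> s" "s \<le> pi / 2" for s
      using U_ge[OF that] 3 by simp
    have "s0 < s1" using W1[of s0] W_less_U[of s0] s0 s0' sU_sW by simp
    moreover have "accel C (sin s1) < 0"
      using accel_W[of s1 C] PW_pos[of s1] sin_pos_quadrant[of s1] s1 s1' sU_sW by simp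
    moreover have "C < U s \<and> W s < C \<longleftrightarrow> s0 < s \<and> s < s1" if "0 < s" "s < pi / 2" for s
      using U0[of s] U1[of s] W1[of s] that s0' s1' by (cases "s \<le> sU") auto
    moreover have "s \<le> s1" if "0 < s" "s \<le> pi / 2" "W s \<le> C" for s
      using W_increasing[of s1 s] that s1 s1' by (cases "s1 < s") auto
    ultimately show ?thesis using s0 s0' s1 s1' acc0 le_U 3
      by (intro exI[of _ s0] exI[of _ s1]) auto
  qed
qed

end

section \<open>Oscillation and symmetry\<close>

text \<open>If \<open>c\<close> stayed positive, \<open>b\<close> would increase forever. Below any
  level under \<open>b1\<close> the energy bounds the speed from below, so the level is passed in
  finite time; close to \<open>b1\<close> the acceleration is bounded above by a negative number and
  uses up the speed. Hence \<open>b1\<close> is reached and not merely approached.\<close>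

lemma reaches_turning_point:
  fixes b c :: "real \<Rightarrow> real"
  assumes db: "\<And>t. (b has_real_derivative c t) (at t)"
    and dc: "\<And>t. (c has_real_derivative acc (b t)) (at t)"
    and range: "\<And>t. b t \<in> {b0..b1}"
    and acc: "continuous_on {b0..b1} acc" "acc b0 > 0" "acc b1 < 0"
    and energy: "\<And>t. (c t)\<^sup>2 = P (b t)" "continuous_on {b0..b1} P"
      "\<And>x. x \<in> {b0..b1} \<Longrightarrow> P x = 0 \<Longrightarrow> x = b0 \<or> x = b1"
    and init: "b 0 = b0" "c 0 = 0"
  shows "\<exists>T>0. b T = b1 \<and> c T = 0 \<and> (\<forall>t\<in>{0<..<T}. c t > 0)"
proof -
  have contb: "continuous_on A b" and contc: "continuous_on A c" for A
    using db dc by (meson DERIV_isCont continuous_at_imp_continuous_on)+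
  obtain d where d: "d > 0" "\<And>t. 0 < t \<Longrightarrow> t < d \<Longrightarrow> c t > 0"
    using DERIV_pos_inc_right[OF dc[of 0]] init acc by auto
  have mono: "b s < b t" if "0 \<le> s" "s < t" "\<And>x. s < x \<Longrightarrow> x < t \<Longrightarrow> c x > 0" for s t
    by (rule DERIV_pos_imp_increasing_open[OF that(2)]) (use that db contb in blast)+
  have "\<exists>t>0. c t \<le> 0"
  proof (rule ccontr)
    assume "\<not> (\<exists>t>0. c t \<le> 0)"
    then have cpos: "c t > 0" if "t > 0" for t using that by force
    have bmono: "b s \<le> b t" if "0 \<le> s" "s \<le> t" for s t
      using mono[of s t] cpos that by (cases "s = t") auto
    have b0b1: "b0 < b1" using mono[of 0 1] cpos init range[of 1] by auto
    have "\<forall>\<^sub>F x in at b1 within {b0..b1}. acc x < acc b1 / 2"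
      using acc(1,3) b0b1 by (intro order_tendstoD(2)) (auto simp: continuous_on_def)
    then obtain \<eta> where \<eta>: "\<eta> > 0" "\<And>x. x \<in> {b0..b1} \<Longrightarrow> x \<noteq> b1 \<Longrightarrow> dist x b1 < \<eta> \<Longrightarrow> acc x < acc b1 / 2"
      unfolding eventually_at by auto
    have near: "acc x \<le> acc b1 / 2" if "x \<in> {b0..b1}" "x > b1 - \<eta>" for x
      using \<eta>(2)[of x] that acc(3) by (cases "x = b1") (auto simp: dist_real_def)
    have b_d: "b0 < b 1" using mono[of 0 1] cpos init by auto
    have "\<exists>t1\<ge>1. b t1 > b1 - \<eta>"
    proof (rule ccontr)
      assume "\<not> (\<exists>t1\<ge>1. b t1 > b1 - \<eta>)"
      then have le: "b t \<le> b1 - \<eta>" if "t \<ge> 1" for t using that by force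
      have sub: "{b 1..b1 - \<eta>} \<subseteq> {b0..b1}" using b_d \<eta>(1) by auto
      have ne: "{b 1..b1 - \<eta>} \<noteq> {}" using le[of 1] by simp
      obtain x where x: "x \<in> {b 1..b1 - \<eta>}" "\<And>y. y \<in> {b 1..b1 - \<eta>} \<Longrightarrow> P x \<le> P y"
        using continuous_attains_inf[OF compact_Icc ne continuous_on_subset[OF energy(2) sub]] by blast
      have inr: "b t \<in> {b 1..b1 - \<eta>}" if "t \<ge> 1" for t using le[OF that] bmono[of 1 t] that by simp
      have Pnz: "P y \<noteq> 0" if "b 1 \<le> y" "y \<le> b1 - \<eta>" for y
        using energy(3)[of y] that b_d \<eta>(1) by (auto simp: less_imp_le)
      have x': "b 1 \<le> x" "x \<le> b1 - \<eta>" using x(1) by simp_all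
      \<comment> \<open>\<open>P\<close> is a square at \<open>b 1\<close> and has no zero on this
        stretch, so the intermediate value theorem forbids a nonpositive minimum.\<close>
      have Px: "P x > 0"
      proof (rule ccontr)
        assume "\<not> P x > 0"
        have "continuous_on {b 1..x} P"
          using x' b_d \<eta>(1) by (intro continuous_on_subset[OF energy(2)]) auto
        then have "\<exists>y. b 1 \<le> y \<and> y \<le> x \<and> P y = 0"
          using \<open>\<not> P x > 0\<close> x' energy(1)[of 1, symmetric] by (intro IVT2') auto
        then show False using Pnz x' by force
      qed
      have cge: "sqrt (P x) \<le> c t" if "t \<ge> 1" for t
      proof -
        have "sqrt (P x) \<le> sqrt ((c t)\<^sup>2)" using x(2)[OF inr[OF that]] energy(1)[of t] by simp
        then show ?thesis using cpos[of t] that by simp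
      qed
      \<comment> \<open>Long enough to travel more than the full width \<open>b1 - b0\<close> at the
        minimal speed \<open>sqrt (P x)\<close>.\<close>
      define t where "t = 2 + (b1 - b0) / sqrt (P x)"
      have t: "t > 1" using b0b1 Px by (simp add: t_def add_pos_nonneg)
      obtain \<xi> where \<xi>: "1 < \<xi>" "\<xi> < t" "b t - b 1 = (t - 1) * c \<xi>"
        using MVT2[OF t, of b c] db by blast
      have "(t - 1) * sqrt (P x) \<le> b t - b 1"
        unfolding \<xi>(3) using cge[of \<xi>] \<xi> t by (intro mult_left_mono) auto
      moreover have "(t - 1) * sqrt (P x) = sqrt (P x) + (b1 - b0)" using Px by (simp add: t_def field_simps)
      ultimately show False using range[of t] range[of 1] Px real_sqrt_gt_zero[OF Px] by auto
    qed
    then obtain t1 where t1: "t1 \<ge> 1" "b t1 > b1 - \<eta>" by blast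
    \<comment> \<open>One unit more than the time in which the acceleration
      \<open>acc b1 / 2\<close> uses up the velocity \<open>c t1\<close>.\<close>
    define t where "t = t1 + 1 + c t1 / (- (acc b1 / 2))"
    have t: "t > t1" using cpos[of t1] t1 acc(3) by (simp add: t_def add_pos_nonneg)
    obtain \<xi> where \<xi>: "t1 < \<xi>" "\<xi> < t" "c t - c t1 = (t - t1) * acc (b \<xi>)"
      using MVT2[OF t, of c "\<lambda>x. acc (b x)"] dc by blast
    have "acc (b \<xi>) \<le> acc b1 / 2" using near[OF range] bmono[of t1 \<xi>] t1 \<xi> by auto
    then have "c t - c t1 \<le> (t - t1) * (acc b1 / 2)" unfolding \<xi>(3) using t by (intro mult_left_mono) auto
    also have "\<dots> = acc b1 / 2 - c t1" using acc(3) by (simp add: t_def field_simps)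
    finally show False using cpos[of t] t t1 acc(3) by simp
  qed
  then obtain t1 where t1: "t1 > 0" "c t1 \<le> 0" by blast
  \<comment> \<open>Starting at \<open>d / 2\<close> excludes the zero of \<open>c\<close> at time
    0, so the minimum of \<open>A\<close> is the next one.\<close>
  define A where "A = {t \<in> {d/2..t1}. c t \<le> 0}"
  have "t1 \<ge> d" using d(2)[of t1] t1 by force
  have "A = {d/2..t1} \<inter> c -` {..0}" by (auto simp: A_def)
  moreover have "closed (c -` {..0})" by (intro closed_vimage closed_atMost contc)
  ultimately have "compact A" by (simp add: compact_Int_closed)
  moreover have "t1 \<in> A" using t1 \<open>t1 \<ge> d\<close> d(1) by (simp add: A_def)
  ultimately obtain T where T: "T \<in> A" "\<And>t. t \<in> A \<Longrightarrow> T \<le> t"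
    using compact_attains_inf[of A] by blast
  have T_gt: "T > d / 2" using T(1) d(2)[of "d/2"] d(1) by (cases "T = d/2") (auto simp: A_def)
  have pos: "c t > 0" if "0 < t" "t < T" for t
    using d(2)[of t] T(2)[of t] T(1) that d(1) by (cases "t < d") (force simp: A_def)+
  have "c T = 0"
  proof (rule ccontr)
    assume "c T \<noteq> 0"
    then have "c T < 0" using T(1) by (auto simp: A_def)
    then obtain y where "d/2 \<le> y" "y \<le> T" "c y = 0"
      using IVT2'[of c T 0 "d/2"] T_gt pos[of "d/2"] d(1) contc by auto
    then show False using T(2)[of y] T(1) \<open>c T \<noteq> 0\<close> by (cases "y = T") (auto simp: A_def)
  qed
  have "b 0 < b T" using mono[of 0 T] pos T_gt d(1) by auto
  then have "b T = b1" using energy(3)[OF range, of T] energy(1)[of T] \<open>c T = 0\<close> init by simp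
  then show ?thesis using \<open>c T = 0\<close> pos T_gt d(1) by (intro exI[of _ T]) auto
qed

section \<open>Equivariance of the field under rotations and reflections\<close>

lemma reflect_linear: "reflect \<theta> (x + y) = reflect \<theta> x + reflect \<theta> y" "reflect \<theta> (r *\<^sub>R x) = r *\<^sub>R reflect \<theta> x"
    "reflect \<theta> (x - y) = reflect \<theta> x - reflect \<theta> y"
    "reflect \<theta> (- x) = - reflect \<theta> x" "snd (reflect \<theta> x) = snd x"
  by (simp_all add: reflect_def distrib_left right_diff_distrib)

lemma rotate_linear: "rotate_curve \<theta> (x + y) = rotate_curve \<theta> x + rotate_curve \<theta> y"
    "rotate_curve \<theta> (r *\<^sub>R x) = r *\<^sub>R rotate_curve \<theta> x"
    "rotate_curve \<theta> (x - y) = rotate_curve \<theta> x - rotate_curve \<theta> y"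
    "rotate_curve \<theta> (- x) = - rotate_curve \<theta> x" "snd (rotate_curve \<theta> x) = snd x"
  by (simp_all add: rotate_curve_def distrib_left right_diff_distrib)

lemma cis_cnj_cis: "cnj (cis \<theta>) * cis \<theta> = 1" "cis \<theta> * cnj (cis \<theta>) = 1"
  by (simp_all add: cis_cnj cis_mult)

lemma rotate_cross: "cross (rotate_curve \<theta> p) (rotate_curve \<theta> q) = rotate_curve \<theta> (cross p q)"
proof -
  have "cnj (cis \<theta> * fst p) * (cis \<theta> * fst q) = (cnj (cis \<theta>) * cis \<theta>) * (cnj (fst p) * fst q)"
    by (simp add: mult_ac)
  also have "\<dots> = cnj (fst p) * fst q" unfolding cis_cnj_cis by simp
  finally have *: "cnj (cis \<theta> * fst p) * (cis \<theta> * fst q) = cnj (fst p) * fst q" .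
  have "\<i> * (of_real (snd p) * (cis \<theta> * fst q) - of_real (snd q) * (cis \<theta> * fst p))
      = cis \<theta> * (\<i> * (of_real (snd p) * fst q - of_real (snd q) * fst p))"
    by (simp only: right_diff_distrib mult_ac)
  then show ?thesis unfolding cross_def rotate_curve_def fst_conv snd_conv * by simp
qed

text \<open>A reflection reverses the sign of the vector product; negating the velocity, as time
  reversal does, compensates. This is why reflection combined with time reversal preserves the
  equation with the same \<open>h\<close>.\<close>

lemma reflect_cross: "cross (reflect \<theta> p) (- reflect \<theta> q) = reflect \<theta> (cross p q)"
proof -
  let ?u = "cis (2 * \<theta>)"
  have "cnj (?u * cnj (fst p)) * (- (?u * cnj (fst q))) = (cnj ?u * ?u) * - (fst p * cnj (fst q))"
    by (simp add: mult_ac)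
  also have "\<dots> = - (fst p * cnj (fst q))" unfolding cis_cnj_cis by simp
  finally have *: "cnj (?u * cnj (fst p)) * (- (?u * cnj (fst q))) = - (fst p * cnj (fst q))" .
  have Im: "Im (- (fst p * cnj (fst q))) = Im (cnj (fst p) * fst q)" by (simp add: algebra_simps)
  have r: "- reflect \<theta> q = (- (?u * cnj (fst q)), - snd q)" by (simp add: reflect_def)
  have i: "cnj (\<i> * (of_real (snd p) * fst q - of_real (snd q) * fst p))
      = - \<i> * (of_real (snd p) * cnj (fst q) - of_real (snd q) * cnj (fst p))"
    by simp
  have "\<i> * (of_real (snd p) * (- (?u * cnj (fst q))) - of_real (- snd q) * (?u * cnj (fst p)))
      = ?u * (- \<i> * (of_real (snd p) * cnj (fst q) - of_real (snd q) * cnj (fst p)))"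
    by (simp only: right_diff_distrib mult_ac mult_minus_left mult_minus_right of_real_minus)
  then show ?thesis
    unfolding r unfolding cross_def reflect_def fst_conv snd_conv * Im i by simp
qed

lemma bounded_linear_reflect: "bounded_linear (reflect \<theta>)"
  by (simp add: linear_conv_bounded_linear[symmetric] linearI reflect_linear)

lemma bounded_linear_rotate: "bounded_linear (rotate_curve \<theta>)"
  by (simp add: linear_conv_bounded_linear[symmetric] linearI rotate_linear)

lemma curve_field_rotate:
  "curve_field h \<mu> (rotate_curve \<theta> p, rotate_curve \<theta> q) =
    map_prod (rotate_curve \<theta>) (rotate_curve \<theta>) (curve_field h \<mu> (p, q))"
  by (simp add: curve_field_def rotate_cross rotate_linear)

lemma curve_field_reflect:
  "curve_field h \<mu> (reflect \<theta> p, - reflect \<theta> q) =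
    map_prod (\<lambda>x. - reflect \<theta> x) (reflect \<theta>) (curve_field h \<mu> (p, q))"
  by (simp add: curve_field_def reflect_cross reflect_linear)

lemma curve_field_lipschitz_compact:
  assumes "compact X" "X \<subseteq> {Y. snd (fst Y) > 0}"
  shows "\<exists>L. L-lipschitz_on X (curve_field h \<mu>)"
proof (cases "X = {}")
  case False
  have "continuous_on X (\<lambda>Y. snd (fst Y))" by (intro continuous_intros)
  from continuous_attains_inf[OF assms(1) False this]
  obtain Y0 where "Y0 \<in> X" "\<forall>Y\<in>X. snd (fst Y0) \<le> snd (fst Y)" by blast
  with assms show ?thesis
    by (intro curve_field_lipschitz[of X "snd (fst Y0)"] compact_imp_bounded) auto
qed (auto intro!: exI[of _ 0])

lemma curve_field_unique:
  assumes "\<And>t. (Y1 has_vector_derivative v t *\<^sub>R curve_field h \<mu> (Y1 t)) (at t)"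
    and "\<And>t. (Y2 has_vector_derivative v t *\<^sub>R curve_field h \<mu> (Y2 t)) (at t)"
    and "continuous_on UNIV v" "Y1 t0 = Y2 t0" "\<And>t. snd (fst (Y1 t)) > 0" "\<And>t. snd (fst (Y2 t)) > 0"
  shows "Y1 = Y2"
  by (rule time_changed_ode_unique[OF assms(1-4) curve_field_lipschitz_compact]) (use assms(5,6) in auto)

context delaunay_field begin

section \<open>Symmetry and height of trajectories\<close>

lemma trajectory_deriv:
  assumes "trajectory p q"
  shows "((\<lambda>t. (p t, q t)) has_vector_derivative field (p t, q t)) (at t)"
    "orthonormal_pair (p t, q t)" "snd (p t) > 0"
    "(p has_vector_derivative q t) (at t)"
proof -
  show *: "((\<lambda>t. (p t, q t)) has_vector_derivative field (p t, q t)) (at t)"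
    and "orthonormal_pair (p t, q t)" "snd (p t) > 0"
    using assms unfolding trajectory_def by auto
  show "(p has_vector_derivative q t) (at t)"
    using bounded_linear.has_vector_derivative[OF bounded_linear_fst *] by (simp add: curve_field_def)
qed

text \<open>The reflection is chosen to reverse the horizontal velocity \<open>w\<close> at \<open>t\<^sub>0\<close>, not to fix the phase of the
  position, so that it also makes sense at the pole.\<close>

lemma trajectory_reflection:
  assumes tr: "trajectory p q" and c0: "snd (q t0) = 0"
  shows "\<exists>\<theta>. \<forall>t. p t = reflect \<theta> (p (2 * t0 - t)) \<and> q t = - reflect \<theta> (q (2 * t0 - t))"
proof -
  define z w where "z = fst (p t0)" and "w = fst (q t0)"
  have on: "orthonormal_pair (p t0, q t0)" using tr by (rule trajectory_deriv)
  have "w \<bullet> w = 1" "z \<bullet> w = 0"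
    using on c0 by (simp_all add: orthonormal_pair_def inner_prod_def w_def z_def)
  then have w: "cmod w = 1" and zw: "Re (cnj z * w) = 0"
    by (simp add: norm_eq_sqrt_inner, simp add: inner_complex_def)
  have ww: "w * cnj w = 1" using complex_norm_square[of w] w by simp
  have "cmod (- (w * w)) = 1" using w by (simp add: norm_mult)
  \<comment> \<open>The reflection \<open>z \<mapsto> cis (2 * \<theta>) * cnj z\<close> is to send
    the unit vector \<open>w\<close> to \<open>- w\<close>, which forces
    \<open>cis (2 * \<theta>) = - w^2\<close>. It then fixes \<open>z\<close>, because
    \<open>z\<close> is orthogonal to \<open>w\<close>.\<close>
  define \<theta> where "\<theta> = Arg (- (w * w)) / 2"
  have \<theta>: "cis (2 * \<theta>) = - (w * w)"
    using rcis_cmod_Arg[of "- (w * w)"] \<open>cmod (- (w * w)) = 1\<close> by (simp add: rcis_def \<theta>_def)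
  have "cnj (cnj z * w) = - (cnj z * w)" using zw by (intro complex_eqI) simp_all
  then have zw': "z * cnj w = - (cnj z * w)" unfolding complex_cnj_mult complex_cnj_cnj .
  have "z = z * (w * cnj w)" unfolding ww by simp
  also have "\<dots> = w * (z * cnj w)" by (rule mult.left_commute)
  also have "\<dots> = - (w * w) * cnj z" unfolding zw' by (simp only: mult_minus_left mult_minus_right mult_ac)
  finally have z: "cis (2 * \<theta>) * cnj z = z" unfolding \<theta> by (rule sym)
  have "cis (2 * \<theta>) * cnj w = - (w * (w * cnj w))" unfolding \<theta> by (simp only: mult_minus_left mult.assoc)
  then have w': "cis (2 * \<theta>) * cnj w = - w" unfolding ww by simp
  define Y2 where "Y2 t = (reflect \<theta> (p (2 * t0 - t)), - reflect \<theta> (q (2 * t0 - t)))" for t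
  have "(\<lambda>t. (p t, q t)) = Y2"
  proof (rule curve_field_unique[where v = "\<lambda>_. 1" and h = h and \<mu> = \<mu> and ?t0.0 = t0])
    show "((\<lambda>t. (p t, q t)) has_vector_derivative 1 *\<^sub>R field (p t, q t)) (at t)" for t
      using trajectory_deriv(1)[OF tr] by simp
    have "bounded_linear (\<lambda>Y. (reflect \<theta> (fst Y), - reflect \<theta> (snd Y)))"
      by (intro bounded_linear_Pair bounded_linear_minus bounded_linear_compose[OF bounded_linear_reflect]
          bounded_linear_fst bounded_linear_snd)
    note bl = bounded_linear.has_vector_derivative[OF this]
    show "(Y2 has_vector_derivative 1 *\<^sub>R field (Y2 t)) (at t)" for t
    proof -
      have "((\<lambda>t. (p (2 * t0 + -1 * t), q (2 * t0 + -1 * t))) has_vector_derivative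
          -1 *\<^sub>R field (p (2 * t0 + -1 * t), q (2 * t0 + -1 * t))) (at t)"
        by (rule has_vector_derivative_affine[where y = "\<lambda>t. (p t, q t)"]) (rule trajectory_deriv(1)[OF tr])
      note * = bl[OF this]
      obtain x1 x2 where X: "field (p (2 * t0 + -1 * t), q (2 * t0 + -1 * t)) = (x1, x2)"
        by (rule prod.exhaust)
      have "field (Y2 t) = (- reflect \<theta> x1, reflect \<theta> x2)"
        using X unfolding Y2_def curve_field_reflect by simp
      moreover have "Y2 = (\<lambda>t. (reflect \<theta> (p (2 * t0 + -1 * t)), - reflect \<theta> (q (2 * t0 + -1 * t))))"
        unfolding Y2_def by simp
      ultimately show ?thesis using * unfolding X by (simp add: reflect_linear)
    qed
    show "(p t0, q t0) = Y2 t0"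
      using z w' c0 by (simp add: Y2_def reflect_def z_def w_def prod_eq_iff)
  qed (use trajectory_deriv(3)[OF tr] in \<open>auto simp: Y2_def reflect_linear\<close>)
  from fun_cong[OF this] show ?thesis
    unfolding Y2_def prod.inject by (intro exI[of _ \<theta>] allI)
qed

text \<open>Conservation of flux expresses \<open>\<nu>\<^sub>b\<close> through \<open>b\<close>.
  That closes both the second-order equation for the height and its energy identity, leaving a
  motion in one dimension.\<close>

lemma trajectory_height:
  assumes tr: "trajectory p q" and C: "C = flux (p 0, q 0)"
  shows "flux (p t, q t) = C" "snd (cross (p t) (q t)) = slope C (snd (p t))"
    "((\<lambda>t. snd (p t)) has_real_derivative snd (q t)) (at t)"
    "((\<lambda>t. snd (q t)) has_real_derivative accel C (snd (p t))) (at t)"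
    "(snd (p t))\<^sup>2 + (snd (q t))\<^sup>2 + (slope C (snd (p t)))\<^sup>2 = 1"
proof -
  note d = trajectory_deriv[OF tr]
  have f: "flux (p t, q t) = C" for t
    unfolding C by (rule flux_preserved[of UNIV 0 t "\<lambda>t. (p t, q t)"]) (use d in auto)
  then show "flux (p t, q t) = C" .
  show sl: "snd (cross (p t) (q t)) = slope C (snd (p t))" for t
    using f[of t] d(3)[of t] by (simp add: flux_def slope_def field_simps del: power_Suc)
  show "((\<lambda>t. snd (p t)) has_real_derivative snd (q t)) (at t)"
    using bounded_linear.has_vector_derivative[OF bounded_linear_snd d(4)[of t]]
    by (simp add: has_real_derivative_iff_has_vector_derivative)
  show "((\<lambda>t. snd (q t)) has_real_derivative accel C (snd (p t))) (at t)"
    using bounded_linear.has_vector_derivative[OF bounded_linear_snd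
        bounded_linear.has_vector_derivative[OF bounded_linear_snd d(1)[of t]]]
    by (simp add: has_real_derivative_iff_has_vector_derivative curve_field_def accel_def sl)
  show "(snd (p t))\<^sup>2 + (snd (q t))\<^sup>2 + (slope C (snd (p t)))\<^sup>2 = 1"
    using orthonormal_frame_third_coordinate[of "p t" "q t"] d(2)[of t] by (simp add: orthonormal_pair_def sl)
qed

text \<open>With \<open>b = sin s\<close> the energy identity reads
  \<open>slope^2 + b'^2 = cos^2 s\<close>, so \<open>|slope| \<le> cos s\<close>, strictly where the
  height moves. Multiplied by \<open>sin^\<mu> s\<close> this is \<open>|R| \<le> L\<close>.\<close>

lemma trajectory_admissible:
  assumes tr: "trajectory p q" and C: "C = flux (p 0, q 0)"
  defines "s \<equiv> \<lambda>t. arcsin (snd (p t))"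
  shows "0 < s t" "s t \<le> pi / 2" "sin (s t) = snd (p t)" "C \<le> U (s t)" "W (s t) \<le> C"
    "snd (q t) \<noteq> 0 \<Longrightarrow> s t < pi / 2 \<and> C < U (s t) \<and> W (s t) < C"
proof -
  define b where "b = snd (p t)"
  have b: "b > 0" using trajectory_deriv(3)[OF tr] by (simp add: b_def)
  have e: "b\<^sup>2 + (snd (q t))\<^sup>2 + (slope C b)\<^sup>2 = 1" using trajectory_height(5)[OF tr C] by (simp add: b_def)
  have "b\<^sup>2 \<le> 1\<^sup>2" using e zero_le_power2[of "slope C b"] zero_le_power2[of "snd (q t)"]
    unfolding power_one by linarith
  then have b1: "b \<le> 1" by (rule power2_le_imp_le) simp
  have sb: "s t = arcsin b" by (simp add: s_def b_def)
  have sin: "sin (s t) = b" unfolding sb using b b1 by (intro sin_arcsin) auto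
  have lo: "0 < s t" unfolding sb using arcsin_less_arcsin[of 0 b] b b1 by simp
  have up: "s t \<le> pi / 2" unfolding sb using arcsin_ubound[of b] b b1 by simp
  show "0 < s t" "s t \<le> pi / 2" by (rule lo up)+
  show "sin (s t) = snd (p t)" using sin unfolding b_def .
  have cs: "cos (s t) \<ge> 0" using lo up by (intro cos_ge_zero) auto
  have c2: "(slope C b)\<^sup>2 + (snd (q t))\<^sup>2 = (cos (s t))\<^sup>2"
    using e sin_cos_squared_add[of "s t"] unfolding sin by linarith
  define B Z g x where "B = b ^ \<mu>" and "Z = a * b ^ Suc \<mu>" and "g = slope C b" and "x = cos (s t)"
  have B: "B > 0" using b by (simp add: B_def)
  have "B * g = C - Z"
    unfolding B_def g_def Z_def slope_def times_divide_eq_right using b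
    by (intro nonzero_mult_div_cancel_left) simp
  then have C_eq: "C = B * g + Z" by simp
  have UW: "U (s t) = Z + x * B" "W (s t) = Z - x * B"
    unfolding U_def W_def sin Z_def x_def B_def by (rule refl)+
  have gx: "g\<^sup>2 + (snd (q t))\<^sup>2 = x\<^sup>2" and x: "0 \<le> x" using c2 cs by (simp_all add: g_def x_def)
  have "\<bar>g\<bar>\<^sup>2 \<le> x\<^sup>2" unfolding power2_abs gx[symmetric] by simp
  then have "\<bar>g\<bar> \<le> x" using x by (rule power2_le_imp_le)
  then have "B * g \<le> B * x" "B * (- x) \<le> B * g"
    using B by (intro mult_left_mono; simp)+
  then show "C \<le> U (s t)" "W (s t) \<le> C" unfolding UW C_eq by (simp_all add: mult.commute)
  assume c: "snd (q t) \<noteq> 0"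
  have "\<bar>g\<bar>\<^sup>2 < x\<^sup>2" unfolding power2_abs gx[symmetric] using c by simp
  then have ab: "\<bar>g\<bar> < x" using x by (rule power2_less_imp_less)
  have "s t \<noteq> pi / 2"
  proof
    assume "s t = pi / 2"
    then have "x = 0" unfolding x_def by (simp only: cos_pi_half)
    with ab show False by simp
  qed
  then have "s t < pi / 2" using up by (rule le_neq_trans[rotated])
  moreover have "B * g < B * x" "B * (- x) < B * g"
    using B ab by (intro mult_strict_left_mono; simp)+
  ultimately show "s t < pi / 2 \<and> C < U (s t) \<and> W (s t) < C"
    unfolding UW C_eq by (simp add: mult.commute)
qed

lemma trajectory_complete:
  assumes tr: "trajectory p q" and m: "\<mu> + 1 = CARD('m::finite)"
  shows "complete_k_curve TYPE('m) (- h) p"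
proof -
  note d = trajectory_deriv[OF tr]
  have mu: "real CARD('m) - 1 = real \<mu>" using m by linarith
  have n: "norm (vector_derivative p (at t)) = 1" for t
    using d(2)[of t] vector_derivative_at[OF d(4)[of t]] by (simp add: orthonormal_pair_def norm_eq_sqrt_inner)
  have "k_curve TYPE('m) (- h) UNIV p"
  proof (rule frenet_imp_k_curve[where q = q])
    show "((\<lambda>t. (p t, q t)) has_vector_derivative curve_field h (real CARD('m) - 1) (p t, q t)) (at t)" for t
      unfolding mu by (rule d(1))
  qed (use d(2,3) in \<open>auto simp: orthonormal_pair_def\<close>)
  moreover have "filterlim (\<lambda>r. integral {0..r} (\<lambda>t. norm (vector_derivative p (at t)))) at_top at_top"
    unfolding n by (rule filterlim_at_top_mono[OF filterlim_ident]) (auto simp: eventually_at_top_linorder intro!: exI[of _ 0])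
  moreover have "filterlim (\<lambda>r. integral {- r..0} (\<lambda>t. norm (vector_derivative p (at t)))) at_top at_top"
    unfolding n by (rule filterlim_at_top_mono[OF filterlim_ident]) (auto simp: eventually_at_top_linorder intro!: exI[of _ 0])
  ultimately show ?thesis by (simp add: complete_k_curve_def)
qed

end

section \<open>Local pieces\<close>

lemma regular_C2_real_iff:
  "regular_C2_curve I (\<phi> :: real \<Rightarrow> real) \<longleftrightarrow>
    (\<exists>D D'. (\<forall>t\<in>I. (\<phi> has_real_derivative D t) (at t) \<and> D t \<noteq> 0 \<and> (D has_real_derivative D' t) (at t)) \<and> continuous_on I D')"
  unfolding regular_C2_curve_def C1_differentiable_on_def has_real_derivative_iff_has_vector_derivative by blast

lemma reparametrization_compose:
  assumes \<phi>: "reparametrization K J \<phi>" and \<psi>: "reparametrization K' K \<psi>"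
  shows "reparametrization K' J (\<phi> \<circ> \<psi>)"
proof -
  obtain D D' where D: "\<And>t. t \<in> K \<Longrightarrow> (\<phi> has_real_derivative D t) (at t)" "\<And>t. t \<in> K \<Longrightarrow> D t \<noteq> 0"
      "\<And>t. t \<in> K \<Longrightarrow> (D has_real_derivative D' t) (at t)" "continuous_on K D'"
    using \<phi> unfolding reparametrization_def regular_C2_real_iff by blast
  obtain E E' where E: "\<And>t. t \<in> K' \<Longrightarrow> (\<psi> has_real_derivative E t) (at t)" "\<And>t. t \<in> K' \<Longrightarrow> E t \<noteq> 0"
      "\<And>t. t \<in> K' \<Longrightarrow> (E has_real_derivative E' t) (at t)" "continuous_on K' E'"
    using \<psi> unfolding reparametrization_def regular_C2_real_iff by blast
  have maps: "\<psi> t \<in> K" if "t \<in> K'" for t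
    using \<psi> that unfolding reparametrization_def bij_betw_def by blast
  have cont: "continuous_on K' \<psi>" "continuous_on K' E" "continuous_on K D"
    using E D by (meson DERIV_isCont continuous_at_imp_continuous_on)+
  have sub: "\<psi> ` K' \<subseteq> K" using maps by blast
  have "regular_C2_curve K' (\<phi> \<circ> \<psi>)"
    unfolding regular_C2_real_iff
  proof (intro exI conjI ballI)
    fix t assume t: "t \<in> K'"
    show "((\<phi> \<circ> \<psi>) has_real_derivative D (\<psi> t) * E t) (at t)"
      using DERIV_chain[OF D(1)[OF maps[OF t]] E(1)[OF t]] .
    show "D (\<psi> t) * E t \<noteq> 0" using D(2) E(2) maps t by simp
    have "((\<lambda>t. D (\<psi> t)) has_real_derivative D' (\<psi> t) * E t) (at t)"
      using DERIV_chain2[OF D(3)[OF maps[OF t]] E(1)[OF t]] .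
    from DERIV_mult'[OF this E(3)[OF t]]
    show "((\<lambda>t. D (\<psi> t) * E t) has_real_derivative D (\<psi> t) * E' t + D' (\<psi> t) * E t * E t) (at t)" .
  next
    show "continuous_on K' (\<lambda>t. D (\<psi> t) * E' t + D' (\<psi> t) * E t * E t)"
      by (intro continuous_intros cont E continuous_on_compose2[OF cont(3) cont(1) sub]
          continuous_on_compose2[OF D(4) cont(1) sub])
  qed
  moreover have "bij_betw (\<phi> \<circ> \<psi>) K' J"
    using \<phi> \<psi> unfolding reparametrization_def by (blast intro: bij_betw_trans)
  ultimately show ?thesis by (simp add: reparametrization_def)
qed

lemma reparametrization_affine_reflection: "reparametrization {2 * m - y<..<2 * m - x} {x<..<y} (\<lambda>t. 2 * m - t)"
proof -
  have "bij_betw (\<lambda>t. 2 * m - t) {2 * m - y<..<2 * m - x} {x<..<y}"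
    by (rule bij_betw_byWitness[where f' = "\<lambda>t. 2 * m - t"]) auto
  moreover have "regular_C2_curve {2 * m - y<..<2 * m - x} (\<lambda>t. 2 * m - t)"
    unfolding regular_C2_real_iff
    by (intro exI[of _ "\<lambda>_. -1"] exI[of _ "\<lambda>_. 0"]) (auto intro!: derivative_eq_intros)
  ultimately show ?thesis by (simp add: reparametrization_def)
qed

lemma local_piece_compose:
  assumes "local_piece n k C \<gamma> K" "reparametrization K' K \<psi>" "\<And>t. t \<in> K' \<Longrightarrow> \<gamma>' t = \<gamma> (\<psi> t)"
  shows "local_piece n k C \<gamma>' K'"
proof -
  obtain \<gamma>0 \<phi> where *: "local_k_curve n k C \<gamma>0" "reparametrization K (J_set n C k) \<phi>" "\<forall>t\<in>K. \<gamma> t = \<gamma>0 (\<phi> t)"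
    using assms(1) unfolding local_piece_def by blast
  have "\<psi> t \<in> K" if "t \<in> K'" for t
    using assms(2) that unfolding reparametrization_def bij_betw_def by blast
  then have "\<forall>t\<in>K'. \<gamma>' t = \<gamma>0 ((\<phi> \<circ> \<psi>) t)" using *(3) assms(3) by simp
  then show ?thesis unfolding local_piece_def
    using *(1) reparametrization_compose[OF *(2) assms(2)] by blast
qed

lemma local_piece_rotate:
  assumes "local_piece n k C \<gamma> K"
  shows "local_piece n k C (\<lambda>t. rotate_curve \<alpha> (\<gamma> t)) K"
proof -
  obtain \<gamma>0 \<phi> where *: "local_k_curve n k C \<gamma>0" "reparametrization K (J_set n C k) \<phi>" "\<forall>t\<in>K. \<gamma> t = \<gamma>0 (\<phi> t)"
    using assms unfolding local_piece_def by blast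
  obtain s1 where s1: "\<And>s. s \<in> J_set n C k \<Longrightarrow> (s1 has_real_derivative
           R_fun n s C k / (cos s * sqrt ((L_fun n s)\<^sup>2 - (R_fun n s C k)\<^sup>2))) (at s)"
        "\<And>s. s \<in> J_set n C k \<Longrightarrow> \<gamma>0 s = (of_real (cos s) * cis (s1 s), sin s)"
    using *(1) unfolding local_k_curve_def by blast
  have "local_k_curve n k C (\<lambda>s. rotate_curve \<alpha> (\<gamma>0 s))"
    unfolding local_k_curve_def
  proof (intro exI ballI conjI)
    fix s assume s: "s \<in> J_set n C k"
    show "((\<lambda>s. s1 s + \<alpha>) has_real_derivative
           R_fun n s C k / (cos s * sqrt ((L_fun n s)\<^sup>2 - (R_fun n s C k)\<^sup>2))) (at s)"
      using DERIV_add[OF s1(1)[OF s] DERIV_const[of \<alpha>]] by simp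
    show "rotate_curve \<alpha> (\<gamma>0 s) = (of_real (cos s) * cis (s1 s + \<alpha>), sin s)"
      using s1(2)[OF s] by (simp add: rotate_curve_def cis_mult[symmetric] mult_ac)
  qed
  then show ?thesis unfolding local_piece_def
    using *(2,3) by (intro exI[of _ "\<lambda>s. rotate_curve \<alpha> (\<gamma>0 s)"] exI[of _ \<phi>]) simp
qed

lemma rotate_reflect: "reflect 0 (rotate_curve \<alpha> p) = rotate_curve (- \<alpha>) (reflect 0 p)"
  by (simp add: reflect_def rotate_curve_def cis_cnj)

lemma reflect_reflect:
  "reflect 0 (reflect \<theta> p) = rotate_curve (- 2 * \<theta>) p" "reflect \<theta> p = rotate_curve (2 * \<theta>) (reflect 0 p)"
  by (simp_all add: reflect_def rotate_curve_def cis_cnj)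

context delaunay_field begin

lemma phase_exists:
  assumes J: "J C = {s0<..<s1}" and ne: "s0 < s1"
  shows "\<exists>\<phi>. \<forall>s\<in>J C. (\<phi> has_real_derivative R s C /
    (cos s * sqrt ((L s)\<^sup>2 - (R s C)\<^sup>2))) (at s)"
proof -
  let ?f = "\<lambda>s. R s C / (cos s * sqrt ((L s)\<^sup>2 - (R s C)\<^sup>2))"
  have "isCont ?f s" if "s0 < s" "s < s1" for s
  proof -
    have s: "s \<in> J C" using that J by simp
    then have "cos s > 0" and "\<bar>R s C\<bar> < L s"
      by (auto simp: J_set_def intro!: cos_gt_zero)
    then have "(R s C)\<^sup>2 < (L s)\<^sup>2"
      by (metis abs_ge_zero power2_abs power_strict_mono zero_less_numeral)
    then have nz: "cos s * sqrt ((L s)\<^sup>2 - (R s C)\<^sup>2) \<noteq> 0"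
      using \<open>cos s > 0\<close> by simp
    show ?thesis
      using nz unfolding R_fun_def L_fun_def by (intro continuous_intros) simp_all
  qed
  then obtain F where "\<And>s. s0 < s \<Longrightarrow> s < s1 \<Longrightarrow> (F has_vector_derivative ?f s) (at s)"
    using einterval_antiderivative[of "ereal s0" "ereal s1" ?f] ne by auto
  then show ?thesis unfolding J has_real_derivative_iff_has_vector_derivative
    by (intro exI[of _ F] ballI) simp
qed

text \<open>On a rising stretch \<open>s = arcsin b\<close> is a valid parameter. To avoid choosing
  a branch of the phase of \<open>z\<close>, the quotient \<open>E\<close> of \<open>z\<close> by
  \<open>cos s * cis (\<sigma> s)\<close> is shown to have derivative 0. Its constant value has
  modulus 1 and is absorbed as the additive constant \<open>\<alpha>\<close> of the phase.\<close>

lemma trajectory_local_piece: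
  assumes tr: "trajectory p q" and C: "C = flux (p 0, q 0)"
    and J: "J C = {s0<..<s1}" "0 \<le> s0" "s0 < s1" "s1 \<le> pi / 2"
    and t: "t0 < t1" "snd (p t0) = sin s0" "snd (p t1) = sin s1"
    and pos: "\<And>t. t \<in> {t0<..<t1} \<Longrightarrow> snd (q t) > 0"
  shows "piece C p {t0<..<t1}"
proof -
  define K where "K = {t0<..<t1}"
  define b c where "b t = snd (p t)" and "c t = snd (q t)" for t
  define \<phi> where "\<phi> t = arcsin (b t)" for t
  note ht = trajectory_height[OF tr C]
  note ad = trajectory_admissible[OF tr C]
  have db: "(b has_real_derivative c t) (at t)" for t using ht(3) by (simp add: b_def[abs_def] c_def)
  have dc: "(c has_real_derivative accel C (b t)) (at t)" for t using ht(4) by (simp add: b_def c_def[abs_def])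
  have b0: "b t > 0" for t using trajectory_deriv(3)[OF tr] by (simp add: b_def)
  have sin\<phi>: "sin (\<phi> t) = b t" for t using ad(3) by (simp add: \<phi>_def b_def)
  have \<phi>J: "\<phi> t \<in> J C" if "t \<in> K" for t
    using ad(1,6)[of t] pos[of t] that unfolding mem_J_set_iff \<phi>_def b_def K_def by auto
  have quad: "0 < \<phi> t" "\<phi> t < pi / 2" "cos (\<phi> t) > 0" "b t < 1" if "t \<in> K" for t
  proof -
    show q: "0 < \<phi> t" "\<phi> t < pi / 2" using \<phi>J[OF that] unfolding mem_J_set_iff by auto
    then show c: "cos (\<phi> t) > 0" by (intro cos_gt_zero) auto
    have "(b t)\<^sup>2 = 1 - (cos (\<phi> t))\<^sup>2" unfolding sin\<phi>[symmetric] by (simp add: sin_squared_eq)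
    then have "(b t)\<^sup>2 < 1\<^sup>2" using c by simp
    then show "b t < 1" by (rule power2_less_imp_less) simp
  qed
  have cos\<phi>: "sqrt (1 - (b t)\<^sup>2) = cos (\<phi> t)" if "t \<in> K" for t
    using quad[OF that] unfolding sin\<phi>[symmetric] cos_squared_eq[symmetric] by simp
  have d\<phi>: "(\<phi> has_real_derivative c t / cos (\<phi> t)) (at t)" if "t \<in> K" for t
  proof -
    have "- 1 < b t" "b t < 1" using b0[of t] quad(4)[OF that] by simp_all
    from DERIV_chain2[OF DERIV_arcsin[OF this] db]
    have "((\<lambda>t. arcsin (b t)) has_real_derivative inverse (sqrt (1 - (b t)\<^sup>2)) * c t) (at t)" .
    then show ?thesis unfolding cos\<phi>[OF that] \<phi>_def[abs_def] by (simp add: divide_inverse mult.commute)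
  qed
  have mono: "\<phi> x < \<phi> y" if "x \<in> K" "y \<in> K" "x < y" for x y
  proof (rule DERIV_pos_imp_increasing[OF that(3)])
    fix t assume "x \<le> t" "t \<le> y"
    with that(1,2) have t: "t \<in> K" by (simp add: K_def)
    have "0 < c t" using pos[of t] t by (simp add: K_def c_def)
    with d\<phi>[OF t] quad(3)[OF t] show "\<exists>z. (\<phi> has_real_derivative z) (at t) \<and> 0 < z"
      by (intro exI conjI) (assumption, simp)
  qed
  have bij: "bij_betw \<phi> K (J C)"
  proof (rule bij_betw_imageI)
    show "inj_on \<phi> K" using mono by (metis inj_onI less_irrefl linorder_neqE_linordered_idom)
    show "\<phi> ` K = J C"
    proof (intro equalityI subsetI)
      fix s assume "s \<in> J C"
      then have s: "s0 < s" "s < s1" using J by auto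
      have sin_s: "sin s0 < sin s" "sin s < sin s1"
        using s J by (intro sin_monotone_2pi; simp)+
      have "continuous_on {t0..t1} b" using db by (rule DERIV_continuous_on[OF has_field_derivative_at_within])
      then obtain x where x: "t0 \<le> x" "x \<le> t1" "b x = sin s"
        using IVT'[of b t0 "sin s" t1] t sin_s by (auto simp: b_def)
      then have "x \<in> K" using t sin_s by (auto simp: K_def b_def le_less)
      moreover have "\<phi> x = s" unfolding \<phi>_def x(3) using s J by (intro arcsin_sin) auto
      ultimately show "s \<in> \<phi> ` K" by blast
    qed (use \<phi>J in auto)
  qed
  have contK: "continuous_on K c" "continuous_on K b" "continuous_on K \<phi>"
    using db dc d\<phi> by (meson DERIV_isCont continuous_at_imp_continuous_on)+
  have reg: "regular_C2_curve K \<phi>"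
    unfolding regular_C2_real_iff
  proof (intro exI conjI ballI)
    fix t assume t: "t \<in> K"
    show "(\<phi> has_real_derivative c t / cos (\<phi> t)) (at t)" by (rule d\<phi>[OF t])
    show "c t / cos (\<phi> t) \<noteq> 0" using pos[of t] quad(3)[OF t] t by (simp add: c_def K_def)
    show "((\<lambda>t. c t / cos (\<phi> t)) has_real_derivative
        (accel C (b t) * cos (\<phi> t) - c t * (- sin (\<phi> t) * (c t / cos (\<phi> t)))) / (cos (\<phi> t) * cos (\<phi> t))) (at t)"
      by (rule DERIV_divide[OF dc DERIV_chain2[OF DERIV_cos d\<phi>[OF t]]]) (use quad(3)[OF t] in simp)
  next
    have nz: "\<forall>t\<in>K. cos (\<phi> t) \<noteq> 0" "\<forall>t\<in>K. b t \<noteq> 0" "\<forall>t\<in>K. cos (\<phi> t) * cos (\<phi> t) \<noteq> 0" "\<forall>t\<in>K. b t ^ \<mu> \<noteq> 0"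
      using quad(3) b0 by (force simp: less_imp_neq[symmetric])+
    show "continuous_on K (\<lambda>t. (accel C (b t) * cos (\<phi> t) - c t * (- sin (\<phi> t) * (c t / cos (\<phi> t)))) / (cos (\<phi> t) * cos (\<phi> t)))"
      unfolding accel_def slope_def by (intro continuous_intros contK nz)
  qed
  have rep: "reparametrization K (J C) \<phi>" using bij reg by (simp add: reparametrization_def)
  obtain \<sigma> where \<sigma>: "\<And>s. s \<in> J C \<Longrightarrow> (\<sigma> has_real_derivative R s C /
    (cos s * sqrt ((L s)\<^sup>2 - (R s C)\<^sup>2))) (at s)"
    using phase_exists[OF J(1,3)] by blast
  define E where "E t = fst (p t) * cis (- \<sigma> (\<phi> t)) * of_real (inverse (cos (\<phi> t)))" for t
  have dE: "(E has_vector_derivative 0) (at t)" if tK: "t \<in> K" for t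
  proof -
    define g where "g = slope C (b t)"
    define x where "x = cos (\<phi> t)"
    have x: "x > 0" and c: "c t > 0" and bt: "b t > 0" using quad(3)[OF tK] pos[of t] tK b0 by (simp_all add: x_def K_def c_def)
    have x2: "x\<^sup>2 = 1 - (b t)\<^sup>2" unfolding x_def sin\<phi>[symmetric] by (rule cos_squared_eq)
    have cg: "(c t)\<^sup>2 + g\<^sup>2 = x\<^sup>2" using ht(5)[of t] unfolding x2 g_def b_def c_def by linarith
    have R: "R (\<phi> t) C = b t ^ \<mu> * g"
      unfolding R_fun_eq sin\<phi> g_def slope_def using bt by simp
    have L: "L (\<phi> t) = b t ^ \<mu> * x" unfolding L_fun_eq sin\<phi> x_def by (rule mult.commute)
    have "(b t ^ \<mu> * x)\<^sup>2 - (b t ^ \<mu> * g)\<^sup>2 = (b t ^ \<mu> * c t)\<^sup>2"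
      unfolding power_mult_distrib right_diff_distrib[symmetric] cg[symmetric] by simp
    \<comment> \<open>Here \<open>c t > 0\<close> selects the sign of the root, which is why only
      rising stretches are treated directly.\<close>
    then have "sqrt ((L (\<phi> t))\<^sup>2 - (R (\<phi> t) C)\<^sup>2) = b t ^ \<mu> * c t"
      unfolding R L using bt c by simp
    then have "R (\<phi> t) C / (cos (\<phi> t) * sqrt ((L (\<phi> t))\<^sup>2 - (R (\<phi> t) C)\<^sup>2))
        = g / (x * c t)"
      unfolding R x_def using bt by simp
    with \<sigma>[OF \<phi>J[OF tK]] have "(\<sigma> has_real_derivative g / (x * c t)) (at (\<phi> t))" by simp
    from DERIV_chain2[OF this d\<phi>[OF tK]] c x
    have d\<sigma>: "((\<lambda>t. \<sigma> (\<phi> t)) has_real_derivative g / x\<^sup>2) (at t)" by (simp add: x_def power2_eq_square)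
    have "((\<lambda>t. inverse (cos (\<phi> t))) has_real_derivative - (inverse x * (- sin (\<phi> t) * (c t / x)) * inverse x)) (at t)"
      unfolding x_def by (rule DERIV_inverse'[OF DERIV_chain2[OF DERIV_cos d\<phi>[OF tK]]]) (use x x_def in simp)
    then have dinv: "((\<lambda>t. inverse (cos (\<phi> t))) has_real_derivative b t * c t / x ^ 3) (at t)"
      by (simp add: sin\<phi> field_simps power3_eq_cube)
    define z w where "z = fst (p t)" and "w = fst (q t)"
    have dz: "((\<lambda>t. fst (p t)) has_vector_derivative w) (at t)"
      using bounded_linear.has_vector_derivative[OF bounded_linear_fst trajectory_deriv(4)[OF tr]] by (simp add: w_def)
    have dcis: "((\<lambda>t. cis (- \<sigma> (\<phi> t))) has_vector_derivative (- (g / x\<^sup>2)) *\<^sub>R (\<i> * cis (- \<sigma> (\<phi> t)))) (at t)"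
    proof -
      have c1: "(cis has_vector_derivative \<i> * cis y) (at y)" for y
        using has_derivative_cis[OF has_derivative_ident, of y UNIV] by (simp add: has_vector_derivative_def scaleR_conv_of_real mult_ac)
      have "((\<lambda>t. - \<sigma> (\<phi> t)) has_real_derivative - (g / x\<^sup>2)) (at t)" by (rule DERIV_minus[OF d\<sigma>])
      from vector_diff_chain_at[OF this[unfolded has_real_derivative_iff_has_vector_derivative] c1]
      show ?thesis by (simp add: o_def)
    qed
    have dinv': "((\<lambda>t. of_real (inverse (cos (\<phi> t))) :: complex) has_vector_derivative of_real (b t * c t / x ^ 3)) (at t)"
      using bounded_linear.has_vector_derivative[OF bounded_linear_of_real dinv[unfolded has_real_derivative_iff_has_vector_derivative]] .
    define e where "e = cis (- \<sigma> (\<phi> t))"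
    have E': "(E has_vector_derivative z * e * of_real (b t * c t / x ^ 3) +
        (z * ((- (g / x\<^sup>2)) *\<^sub>R (\<i> * e)) + w * e) * of_real (inverse (cos (\<phi> t)))) (at t)"
      unfolding E_def[abs_def] z_def e_def
      by (rule has_vector_derivative_mult[OF has_vector_derivative_mult[OF dz dcis] dinv'])
    have on: "orthonormal_pair (p t, q t)" by (rule trajectory_deriv(2)[OF tr])
    have "z \<bullet> z = x\<^sup>2"
      unfolding x2 using on by (simp add: orthonormal_pair_def inner_prod_def z_def b_def power2_eq_square)
    then have zz: "z * cnj z = of_real (x\<^sup>2)"
      using complex_norm_square[of z] by (simp add: power2_norm_eq_inner)
    \<comment> \<open>The real part comes from orthogonality of position and velocity, the imaginary
      part is the third coordinate of their vector product. Together they recover \<open>w\<close>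
      from \<open>z\<close>.\<close>
    have zw: "cnj z * w = Complex (- (b t * c t)) g"
    proof (rule complex_eqI)
      show "Re (cnj z * w) = Re (Complex (- (b t * c t)) g)"
        using on by (simp add: orthonormal_pair_def inner_prod_def inner_complex_def z_def w_def b_def c_def)
      show "Im (cnj z * w) = Im (Complex (- (b t * c t)) g)"
        using ht(2)[of t] by (simp add: cross_def z_def w_def g_def b_def)
    qed
    have "of_real (x\<^sup>2) * w = z * (cnj z * w)" unfolding zz[symmetric] by (simp only: mult.assoc)
    also have "\<dots> = z * (of_real (- (b t * c t)) + \<i> * of_real g)" unfolding zw Complex_eq by simp
    finally have w: "w = z * (of_real (- (b t * c t)) + \<i> * of_real g) / of_real (x\<^sup>2)"
      using x by (simp add: field_simps)
    have "z * e * of_real (b t * c t / x ^ 3) +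
        (z * ((- (g / x\<^sup>2)) *\<^sub>R (\<i> * e)) + w * e) * of_real (inverse (cos (\<phi> t))) = 0"
      unfolding w x_def[symmetric] using x by (simp add: scaleR_conv_of_real field_simps power2_eq_square power3_eq_cube)
    with E' show ?thesis by simp
  qed
  have "\<exists>e. \<forall>t\<in>K. E t = e"
  proof (rule has_vector_derivative_zero_constant)
    show "convex K" by (simp add: K_def)
    show "(E has_vector_derivative 0) (at t within K)" if "t \<in> K" for t
      by (rule has_vector_derivative_at_within[OF dE[OF that]])
  qed blast
  then obtain e where e: "\<And>t. t \<in> K \<Longrightarrow> E t = e" by blast
  obtain \<alpha> where \<alpha>: "e = cis \<alpha>"
  proof -
    define m where "m = (t0 + t1) / 2"
    have m: "m \<in> K" using t by (simp add: m_def K_def)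
    have "(cmod (fst (p m)))\<^sup>2 = 1 - (b m)\<^sup>2"
      using trajectory_deriv(2)[OF tr, of m]
      by (simp add: orthonormal_pair_def inner_prod_def b_def power2_norm_eq_inner) (simp add: algebra_simps power2_eq_square)
    also have "\<dots> = (cos (\<phi> m))\<^sup>2" unfolding sin\<phi>[symmetric] by (rule cos_squared_eq[symmetric])
    finally have "cmod (fst (p m)) = cos (\<phi> m)" using quad(3)[OF m] by (simp add: power2_eq_iff_nonneg)
    then have "cmod e = 1" unfolding e[OF m, symmetric] E_def using quad(3)[OF m] by (simp add: norm_mult norm_inverse)
    then have "e = cis (Arg e)" using rcis_cmod_Arg[of e] by (simp add: rcis_def)
    then show ?thesis by (rule that)
  qed
  define \<gamma>0 where "\<gamma>0 s = (of_real (cos s) * cis (\<sigma> s + \<alpha>), sin s)" for s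
  have "local_k_curve (\<mu> + 2) (- h) C \<gamma>0"
    unfolding local_k_curve_def \<gamma>0_def
    by (intro exI[of _ "\<lambda>s. \<sigma> s + \<alpha>"] ballI conjI) (auto intro!: DERIV_add[OF \<sigma> DERIV_const, simplified])
  moreover have "p t = \<gamma>0 (\<phi> t)" if tK: "t \<in> K" for t
  proof -
    have "fst (p t) = fst (p t) * (cis (- \<sigma> (\<phi> t)) * cis (\<sigma> (\<phi> t))) * (of_real (inverse (cos (\<phi> t))) * of_real (cos (\<phi> t)))"
      using quad(3)[OF tK] by (simp add: cis_mult)
    also have "\<dots> = E t * (cis (\<sigma> (\<phi> t)) * of_real (cos (\<phi> t)))" unfolding E_def by (simp only: mult_ac)
    also have "\<dots> = of_real (cos (\<phi> t)) * cis (\<sigma> (\<phi> t) + \<alpha>)"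
      unfolding e[OF tK] \<alpha> cis_mult[symmetric] by (simp only: mult_ac)
    finally show ?thesis unfolding \<gamma>0_def sin\<phi> b_def by (simp add: prod_eq_iff)
  qed
  ultimately show ?thesis unfolding local_piece_def K_def[symmetric] using rep by blast
qed

end

section \<open>Continuing one piece to the whole line by reflection\<close>

lemma zeros_at_multiples:
  fixes f :: "real \<Rightarrow> real"
  assumes odd: "\<And>t0 t. f t0 = 0 \<Longrightarrow> f t = - f (2 * t0 - t)" and f: "f 0 = 0" "f T = 0"
  shows "f (of_int j * T) = 0"
proof -
  \<comment> \<open>Reflecting at a zero sends the preceding zero to the following one, so two
    consecutive zeros are carried through the induction.\<close>
  have nat: "f (real n * T) = 0 \<and> f (real (Suc n) * T) = 0" for n
  proof (induction n)
    case (Suc n)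
    have "f (real (Suc (Suc n)) * T) = - f (2 * (real (Suc n) * T) - real (Suc (Suc n)) * T)"
      using Suc by (intro odd) simp
    also have "2 * (real (Suc n) * T) - real (Suc (Suc n)) * T = real n * T" by (simp add: algebra_simps)
    finally show ?case using Suc by simp
  qed (use f in simp)
  show ?thesis
  proof (cases j)
    case (nonneg n)
    then show ?thesis using nat[of n] by simp
  next
    case (neg n)
    have "f (- (real (Suc n) * T)) = - f (2 * 0 - (- (real (Suc n) * T)))" by (rule odd[OF f(1)])
    also have "2 * 0 - (- (real (Suc n) * T)) = real (Suc n) * T" by simp
    finally have "f (- (real (Suc n) * T)) = 0" using nat[of n] by simp
    moreover have "of_int j * T = - (real (Suc n) * T)" unfolding neg by (simp add: algebra_simps)
    ultimately show ?thesis by (simp only:)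
  qed
qed

lemma subdivision_multiples:
  assumes "T > 0"
  shows "subdivision (\<lambda>j. of_int j * T)"
proof -
  have "t \<in> {of_int \<lfloor>t / T\<rfloor> * T..of_int (\<lfloor>t / T\<rfloor> + 1) * T}" for t
  proof -
    have "of_int \<lfloor>t / T\<rfloor> \<le> t / T" "t / T \<le> of_int (\<lfloor>t / T\<rfloor> + 1)"
      using floor_correct[of "t / T"] by (simp_all add: less_imp_le)
    then show ?thesis using assms by (simp only: pos_le_divide_eq pos_divide_le_eq atLeastAtMost_iff)
  qed
  then have "(\<Union>j. {of_int j * T..of_int (j + 1) * T}) = UNIV" by blast
  then show ?thesis using assms unfolding subdivision_def by (auto intro!: strict_monoI)
qed

context delaunay_field begin

text \<open>The start is the lower turning point with velocity \<open>\<i>\<close>, so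
  \<open>flux\<close> is \<open>U s0 = C\<close> there. \<open>T\<close> is the time of the rise to
  the upper turning point, at height \<open>sin s1\<close>; for \<open>C = a\<close> this height is
  1 and the point is the pole, otherwise \<open>s1 < pi / 2\<close> keeps the whole curve away from
  it.\<close>

theorem standard_trajectory:
  assumes C: "0 < C" "C < U sU"
  shows "\<exists>p q T. trajectory p q \<and> T > 0 \<and> piece C p {0<..<T} \<and>
    (\<forall>j::int. snd (q (of_int j * T)) = 0) \<and> (C = a \<longrightarrow> p T = (0, 1)) \<and> (C \<noteq> a \<longrightarrow> (\<forall>t. fst (p t) \<noteq> 0))"
proof -
  obtain s0 s1 where s: "0 < s0" "s0 < s1" "s1 \<le> pi / 2" "s0 < sU" and s1: "s1 = pi / 2 \<longleftrightarrow> C = a" and Us0: "U s0 = C"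
    and adm: "\<And>s. 0 < s \<Longrightarrow> s < pi / 2 \<Longrightarrow> C < U s \<and> W s < C \<longleftrightarrow> s0 < s \<and> s < s1"
    and adm': "\<And>s. 0 < s \<Longrightarrow> s \<le> pi / 2 \<Longrightarrow> C \<le> U s \<Longrightarrow> W s \<le> C \<Longrightarrow> s0 \<le> s \<and> s \<le> s1"
    and acc: "accel C (sin s0) > 0" "accel C (sin s1) < 0"
    using admissible_interval[OF C] by (elim exE conjE) blast
  have J: "J C = {s0<..<s1}"
    using adm s unfolding set_eq_iff mem_J_set_iff greaterThanLessThan_iff by (meson less_le_trans less_trans)
  define p0 q0 :: "complex \<times> real" where "p0 = (of_real (cos s0), sin s0)" and "q0 = (\<i>, 0)"
  have orth: "orthonormal_pair (p0, q0)"
    by (simp add: orthonormal_pair_def p0_def q0_def inner_prod_def inner_complex_def power2_eq_square[symmetric])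
  have sin0: "sin s0 > 0" using s by (intro sin_pos_quadrant) auto
  have fl: "flux (p0, q0) = C"
    unfolding Us0[symmetric] by (simp add: flux_def p0_def q0_def cross_def U_def mult.commute del: power_Suc)
  obtain p q where tr: "trajectory p q" and pq0: "p 0 = p0" "q 0 = q0"
    using trajectory_exists[OF orth] sin0 fl C by (auto simp: p0_def)
  have CF: "C = flux (p 0, q 0)" by (simp add: pq0 fl)
  note ht = trajectory_height[OF tr CF]
  note ad = trajectory_admissible[OF tr CF]
  have sin_mono: "sin x < sin y" if "s0 \<le> x" "x < y" "y \<le> s1" for x y
    using that s by (intro sin_monotone_2pi) auto
  have range: "s0 \<le> arcsin (snd (p t)) \<and> arcsin (snd (p t)) \<le> s1" for t
    using adm'[OF ad(1,2,4,5)] .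
  have range': "snd (p t) \<in> {sin s0..sin s1}" for t
    using sin_mono[of s0 "arcsin (snd (p t))"] sin_mono[of "arcsin (snd (p t))" s1] range[of t] ad(3)[of t]
    by (auto simp: le_less)
  have "\<exists>T>0. snd (p T) = sin s1 \<and> snd (q T) = 0 \<and> (\<forall>t\<in>{0<..<T}. snd (q t) > 0)"
  proof (rule reaches_turning_point[where acc = "accel C" and P = "\<lambda>x. 1 - x\<^sup>2 - (slope C x)\<^sup>2"])
    have nz: "\<forall>x\<in>{sin s0..sin s1}. x \<noteq> 0" "\<forall>x\<in>{sin s0..sin s1}. x ^ \<mu> \<noteq> 0" using sin0 by auto
    show "continuous_on {sin s0..sin s1} (accel C)"
      unfolding accel_def slope_def by (intro continuous_intros nz)
    show "continuous_on {sin s0..sin s1} (\<lambda>x. 1 - x\<^sup>2 - (slope C x)\<^sup>2)"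
      unfolding slope_def by (intro continuous_intros nz)
    show "(snd (q t))\<^sup>2 = 1 - (snd (p t))\<^sup>2 - (slope C (snd (p t)))\<^sup>2" for t using ht(5)[of t] by linarith
    \<comment> \<open>Strictly between the ends, admissibility gives
      \<open>|slope C x| < cos s\<close>, so the energy function is positive there.\<close>
    show "x = sin s0 \<or> x = sin s1" if x: "x \<in> {sin s0..sin s1}" "1 - x\<^sup>2 - (slope C x)\<^sup>2 = 0" for x
    proof (rule ccontr)
      assume "\<not> (x = sin s0 \<or> x = sin s1)"
      then have x': "sin s0 < x" "x < sin s1" using x(1) by auto
      define s where "s = arcsin x"
      have "x < 1" using x' sin_le_one[of s1] by linarith
      then have sx: "sin s = x" using x' sin0 by (simp add: s_def)
      have "arcsin (sin s0) < s" "s < arcsin (sin s1)"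
        unfolding s_def using x' \<open>x < 1\<close> sin0 by (intro arcsin_less_arcsin; simp)+
      moreover have "arcsin (sin s0) = s0" "arcsin (sin s1) = s1"
        using \<open>0 < s0\<close> \<open>s0 < s1\<close> \<open>s1 \<le> pi / 2\<close> by (intro arcsin_sin; simp)+
      ultimately have "s0 < s" "s < s1" by simp_all
      then have UW: "C < U s" "W s < C" and cs: "cos s > 0"
        using adm[of s] \<open>0 < s0\<close> \<open>s1 \<le> pi / 2\<close> by (auto intro!: cos_gt_zero)
      have xm: "x ^ \<mu> > 0" using x' sin0 by simp
      have "slope C x < cos s" "- cos s < slope C x"
        using UW xm by (simp_all add: slope_def U_def W_def sx pos_divide_less_eq pos_less_divide_eq del: power_Suc)
      then have "\<bar>slope C x\<bar> < cos s" by (simp add: abs_less_iff)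
      then have "\<bar>slope C x\<bar>\<^sup>2 < (cos s)\<^sup>2" by (intro power_strict_mono) auto
      then show False using x(2) sin_cos_squared_add[of s] unfolding sx power2_abs by linarith
    qed
  qed (use ht(3,4) range' acc pq0 in \<open>simp_all add: p0_def q0_def\<close>)
  then obtain T where T: "T > 0" "snd (p T) = sin s1" "snd (q T) = 0" "\<And>t. t \<in> {0<..<T} \<Longrightarrow> snd (q t) > 0"
    by blast
  have piece: "piece C p {0<..<T}"
    by (rule trajectory_local_piece[OF tr CF J _ s(2,3) T(1) _ T(2,4)]) (use s pq0 in \<open>simp_all add: p0_def\<close>)
  have "snd (q t) = - snd (q (2 * t0 - t))" if "snd (q t0) = 0" for t0 t
  proof -
    obtain \<theta> where "\<forall>t. p t = reflect \<theta> (p (2 * t0 - t)) \<and> q t = - reflect \<theta> (q (2 * t0 - t))"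
      using trajectory_reflection[OF tr \<open>snd (q t0) = 0\<close>] by blast
    then have "q t = - reflect \<theta> (q (2 * t0 - t))" by blast
    from arg_cong[OF this, of snd] show ?thesis by (simp add: reflect_linear)
  qed
  then have zeros: "snd (q (of_int j * T)) = 0" for j
    by (rule zeros_at_multiples) (use T pq0 in \<open>simp_all add: q0_def\<close>)
  have unit: "(cmod (fst (p t)))\<^sup>2 = 1 - (snd (p t))\<^sup>2" for t
    using trajectory_deriv(2)[OF tr, of t]
    by (simp add: orthonormal_pair_def inner_prod_def power2_norm_eq_inner) (simp add: algebra_simps power2_eq_square)
  have "p T = (0, 1)" if "C = a"
  proof -
    have "s1 = pi / 2" using s1 that by blast
    then have "snd (p T) = 1" using T(2) by (simp only: sin_pi_half)
    then show ?thesis using unit[of T] by (simp add: prod_eq_iff)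
  qed
  moreover have "fst (p t) \<noteq> 0" if "C \<noteq> a" for t
  proof
    assume "fst (p t) = 0"
    then have "(snd (p t))\<^sup>2 = 1" using unit[of t] by simp
    then have "snd (p t) = 1" using trajectory_deriv(3)[OF tr, of t] by (simp add: power2_eq_1_iff)
    then have "pi / 2 \<le> s1" using range[of t] by simp
    then show False using s s1 that by simp
  qed
  ultimately show ?thesis using tr T(1) piece zeros by (intro exI[of _ p] exI[of _ q] exI[of _ T]) blast
qed

text \<open>Reversing time about \<open>m T\<close> carries interval \<open>j'\<close> onto interval
  \<open>j\<close> when \<open>j + j' + 1 = 2 m\<close>. The parities then differ, so exactly one of
  the two pieces is already mirrored by \<open>F\<close>, and the two reflections combine to a
  rotation, which preserves being a piece.\<close>

theorem trajectory_has_local_pieces: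
  assumes tr: "trajectory p q" and T: "T > 0" and piece: "piece C p {0<..<T}"
    and zeros: "\<And>j::int. snd (q (of_int j * T)) = 0"
  shows "has_local_pieces (\<mu> + 2) (- h) C p"
proof -
  define F where "F j = (if even j then p else (\<lambda>t. reflect 0 (p t)))" for j :: int
  have step: "piece C (F j) {of_int j * T<..<of_int (j + 1) * T}"
    if j': "piece C (F j') {of_int j' * T<..<of_int (j' + 1) * T}"
      and jm: "j + j' + 1 = 2 * m" for j j' m :: int
  proof -
    obtain \<theta> where \<theta>: "\<And>t. p t = reflect \<theta> (p (2 * (of_int m * T) - t))"
      using trajectory_reflection[OF tr zeros[of m]] by blast
    have par: "even j \<longleftrightarrow> odd j'"
    proof -
      have "even (j + j' + 1)" unfolding jm by simp
      then show ?thesis by auto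
    qed
    have j'_eq: "j' = 2 * m - j - 1" using jm by simp
    have ends: "2 * (of_int m * T) - of_int (j' + 1) * T = of_int j * T"
      "2 * (of_int m * T) - of_int j' * T = of_int (j + 1) * T"
      unfolding j'_eq by (simp_all add: algebra_simps)
    have rep: "reparametrization {of_int j * T<..<of_int (j + 1) * T} {of_int j' * T<..<of_int (j' + 1) * T}
        (\<lambda>t. 2 * (of_int m * T) - t)"
      using reparametrization_affine_reflection[of "of_int m * T" "of_int (j' + 1) * T" "of_int j' * T"] unfolding ends .
    obtain \<alpha> where "\<And>t. F j t = rotate_curve \<alpha> (F j' (2 * (of_int m * T) - t))"
    proof (cases "even j")
      case True
      have "F j t = rotate_curve (2 * \<theta>) (F j' (2 * (of_int m * T) - t))" for t
      proof -
        have "F j' (2 * (of_int m * T) - t) = reflect 0 (p (2 * (of_int m * T) - t))" using True par by (simp add: F_def)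
        moreover have "F j t = p t" using True by (simp add: F_def)
        ultimately show ?thesis using trans[OF \<theta>[of t] reflect_reflect(2)] by (simp only:)
      qed
      then show ?thesis by (rule that)
    next
      case False
      have "F j t = rotate_curve (- 2 * \<theta>) (F j' (2 * (of_int m * T) - t))" for t
      proof -
        have "F j' (2 * (of_int m * T) - t) = p (2 * (of_int m * T) - t)" using False par by (simp add: F_def)
        moreover have "F j t = reflect 0 (p t)" using False by (simp add: F_def)
        ultimately show ?thesis using trans[OF arg_cong[OF \<theta>[of t], of "reflect 0"] reflect_reflect(1)] by (simp only:)
      qed
      then show ?thesis by (rule that)
    qed
    then show ?thesis by (intro local_piece_compose[OF local_piece_rotate[OF j'] rep])
  qed
  have Q0: "piece C (F 0) {of_int 0 * T<..<of_int (0 + 1) * T}" using piece by (simp add: F_def)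
  \<comment> \<open>Piece 0 reaches every odd \<open>j\<close> through \<open>2 m = j + 1\<close>;
    piece 1 then reaches every even \<open>j\<close> through \<open>2 m = j + 2\<close>.\<close>
  have Qodd: "piece C (F j) {of_int j * T<..<of_int (j + 1) * T}" if "odd j" for j
    using that by (elim oddE) (intro step[OF Q0, of j "_ + 1"], simp)
  have "piece C (F j) {of_int j * T<..<of_int (j + 1) * T}" for j
  proof (cases "even j")
    case True
    then show ?thesis by (elim evenE) (intro step[OF Qodd[of 1], of j "_ + 1"], simp_all)
  qed (rule Qodd)
  then show ?thesis unfolding has_local_pieces_def F_def using subdivision_multiples[OF T] by blast
qed

text \<open>The symmetry supplies some \<open>\<theta>\<close>, while the definition demands the
  phase of the endpoint. The endpoint is fixed by the reflection and has
  \<open>z \<noteq> 0\<close>, so \<open>cis (2 * \<theta>) = cis (2 * Arg z)\<close> and the two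
  reflections coincide.\<close>

theorem trajectory_repeated_reflection:
  assumes tr: "trajectory p q" and T: "T > 0" and piece: "piece C p {0<..<T}"
    and zeros: "\<And>j::int. snd (q (of_int j * T)) = 0" and nz: "\<And>t. fst (p t) \<noteq> 0"
  shows "repeated_reflection (\<mu> + 2) (- h) C p"
  unfolding repeated_reflection_def
proof (intro conjI exI[of _ "\<lambda>j. of_int j * T"] allI)
  show "continuous_on UNIV p"
    using trajectory_deriv(4)[OF tr] has_vector_derivative_continuous by (blast intro: continuous_at_imp_continuous_on)
  show "subdivision (\<lambda>j. of_int j * T)" by (rule subdivision_multiples[OF T])
  show "piece C p {of_int 0 * T<..<of_int 1 * T}" using piece by simp
  fix j :: int
  obtain \<theta> where \<theta>: "\<And>t. p t = reflect \<theta> (p (2 * (of_int j * T) - t))"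
    using trajectory_reflection[OF tr zeros[of j]] by blast
  define z where "z = fst (p (of_int j * T))"
  have "z = fst (reflect \<theta> (p (2 * (of_int j * T) - of_int j * T)))"
    unfolding z_def by (rule arg_cong[OF \<theta>])
  also have "2 * (of_int j * T) - of_int j * T = of_int j * T" by simp
  finally have z: "z = cis (2 * \<theta>) * cnj z" unfolding reflect_def fst_conv z_def[symmetric] .
  have zc: "of_real (cmod z) * cis (Arg z) = z" using rcis_cmod_Arg[of z] by (simp add: rcis_def)
  have nz': "of_real (cmod z) \<noteq> (0::complex)" using nz by (simp add: z_def)
  have zc': "of_real (cmod z) * cis (- Arg z) = cnj z"
    using arg_cong[OF zc, of cnj] by (simp add: cis_cnj)
  have "of_real (cmod z) * cis (Arg z) = of_real (cmod z) * (cis (2 * \<theta>) * cis (- Arg z))"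
    unfolding zc mult.left_commute[of "of_real (cmod z)"] zc' by (rule z)
  then have "cis (Arg z) = cis (2 * \<theta>) * cis (- Arg z)" using nz' by (simp only: mult_cancel_left) simp
  then have "cis (Arg z) * cis (Arg z) = cis (2 * \<theta>) * cis (- Arg z) * cis (Arg z)" by (rule arg_cong)
  then have "cis (2 * Arg z) = cis (2 * \<theta>)" by (simp add: cis_mult)
  then have refl: "reflect (Arg z) = reflect \<theta>" by (simp add: reflect_def fun_eq_iff)
  have ends: "2 * (of_int j * T) - of_int j * T = of_int j * T" "2 * (of_int j * T) - of_int (j - 1) * T = of_int (j + 1) * T"
    by (simp_all add: algebra_simps)
  have "reparametrization {of_int j * T<..<of_int (j + 1) * T} {of_int (j - 1) * T<..<of_int j * T} (\<lambda>t. 2 * (of_int j * T) - t)"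
    using reparametrization_affine_reflection[of "of_int j * T" "of_int j * T" "of_int (j - 1) * T"] unfolding ends .
  moreover have "\<forall>t\<in>{of_int j * T<..<of_int (j + 1) * T}. p t = reflect (Arg (fst (p (of_int j * T)))) (p (2 * (of_int j * T) - t))"
    unfolding z_def[symmetric] refl using \<theta> by blast
  ultimately show "\<exists>\<phi>. reparametrization {of_int j * T<..<of_int (j + 1) * T} {of_int (j - 1) * T<..<of_int j * T} \<phi> \<and>
      (\<forall>t\<in>{of_int j * T<..<of_int (j + 1) * T}. p t = reflect (Arg (fst (p (of_int j * T)))) (p (\<phi> t)))"
    by blast
qed

end

section \<open>Uniqueness through the pole\<close>

lemma nonvanishing_continuous_sign:
  fixes v :: "real \<Rightarrow> real"
  assumes v: "continuous_on UNIV v" "\<And>t. v t \<noteq> 0"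
  shows "(\<forall>t. v t > 0) \<or> (\<forall>t. v t < 0)"
proof (rule ccontr)
  assume "\<not> ?thesis"
  then obtain x y where "v x < 0" "v y > 0" using v(2) by (meson linorder_neqE_linordered_idom)
  moreover have "connected (range v)" using v(1) by (intro connected_continuous_image) auto
  ultimately have "0 \<in> range v"
    using connectedD_interval[of "range v" "v x" "v y" 0] by (simp add: less_imp_le)
  then show False using v(2) by force
qed

text \<open>Positivity of \<open>v\<close> gives injectivity; infinite length forwards and backwards
  makes \<open>\<sigma>\<close> unbounded above and below, which gives surjectivity.\<close>

lemma antiderivative_surj:
  fixes \<sigma> v :: "real \<Rightarrow> real"
  assumes \<sigma>: "\<And>t. (\<sigma> has_real_derivative v t) (at t)" and v: "continuous_on UNIV v" "\<And>t. v t > 0"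
    and inf: "filterlim (\<lambda>r. integral {0..r} v) at_top at_top" "filterlim (\<lambda>r. integral {- r..0} v) at_top at_top"
  shows "bij \<sigma>"
proof -
  have ftc: "integral {x..y} v = \<sigma> y - \<sigma> x" if "x \<le> y" for x y
  proof (rule integral_unique, rule fundamental_theorem_of_calculus[OF that])
    show "(\<sigma> has_vector_derivative v t) (at t within {x..y})" for t
      using \<sigma>[of t] unfolding has_real_derivative_iff_has_vector_derivative
      by (rule has_vector_derivative_at_within)
  qed
  have mono: "\<sigma> x < \<sigma> y" if "x < y" for x y
    by (rule DERIV_pos_imp_increasing[OF that]) (use \<sigma> v(2) in blast)
  have "inj \<sigma>"
  proof (rule injI)
    fix x y assume "\<sigma> x = \<sigma> y"
    then show "x = y" using mono[of x y] mono[of y x] by (cases x y rule: linorder_cases) auto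
  qed
  have large: "\<exists>r\<ge>0. f r > Z" if "filterlim f at_top at_top" for f :: "real \<Rightarrow> real" and Z
    using eventually_conj[OF eventually_ge_at_top[of 0] filterlim_at_top_dense[THEN iffD1, OF that, rule_format, of Z]]
    by (auto dest!: eventually_happens'[OF trivial_limit_at_top_linorder])
  have "y \<in> range \<sigma>" for y
  proof -
    obtain r where r: "integral {0..r} v > y - \<sigma> 0" "r \<ge> 0" using large[OF inf(1)] by blast
    obtain r' where r': "integral {- r'..0} v > \<sigma> 0 - y" "r' \<ge> 0" using large[OF inf(2)] by blast
    have "\<sigma> (- r') \<le> y" "y \<le> \<sigma> r" using r r' by (simp_all add: ftc)
    moreover have "continuous_on {- r'..r} \<sigma>" using \<sigma> by (rule DERIV_continuous_on[OF has_field_derivative_at_within])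
    ultimately show ?thesis using IVT'[of \<sigma> "- r'" y r] r r' by auto
  qed
  with \<open>inj \<sigma>\<close> show ?thesis by (auto simp: bij_def)
qed

text \<open>Parity has to be kept because \<open>has_local_pieces\<close> mirrors exactly the odd
  pieces.\<close>

lemma reparametrization_subdivision:
  assumes \<phi>: "reparametrization UNIV UNIV \<phi>" and \<tau>: "subdivision \<tau>"
  shows "\<exists>\<tau>'. subdivision \<tau>' \<and>
    (\<forall>j. \<exists>i. (even i \<longleftrightarrow> even j) \<and> reparametrization {\<tau>' j<..<\<tau>' (j + 1)} {\<tau> i<..<\<tau> (i + 1)} \<phi>)"
proof -
  obtain D D' where D: "\<And>t. (\<phi> has_real_derivative D t) (at t)" "\<And>t. D t \<noteq> 0"
      "\<And>t. (D has_real_derivative D' t) (at t)"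
    and reg: "regular_C2_curve UNIV \<phi>" and bij: "bij \<phi>"
    using \<phi> unfolding reparametrization_def regular_C2_real_iff by auto
  have contD: "continuous_on UNIV D" using D(3) by (rule DERIV_continuous_on[OF has_field_derivative_at_within])
  have regS: "regular_C2_curve S \<phi>" for S
    using reg unfolding regular_C2_real_iff by (meson UNIV_I continuous_on_subset subset_UNIV)
  have \<phi>inv: "\<phi> (inv \<phi> x) = x" "inv \<phi> (\<phi> x) = x" for x
    using bij by (simp_all add: bij_is_surj surj_f_inv_f bij_is_inj)
  have mono: "strict_mono \<tau>" and cover: "(\<Union>j. {\<tau> j..\<tau> (j + 1)}) = UNIV"
    using \<tau> by (auto simp: subdivision_def)
  show ?thesis
    using nonvanishing_continuous_sign[OF contD D(2)]
  proof
    assume pos: "\<forall>t. D t > 0"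
    have inc: "\<phi> x < \<phi> y \<longleftrightarrow> x < y" for x y
    proof -
      have "\<phi> x < \<phi> y" if "x < y" for x y
        by (rule DERIV_pos_imp_increasing[OF that]) (use D(1) pos in blast)
      from this[of x y] this[of y x] show ?thesis by (cases x y rule: linorder_cases) auto
    qed
    have inv_less: "inv \<phi> x < y \<longleftrightarrow> x < \<phi> y" "y < inv \<phi> x \<longleftrightarrow> \<phi> y < x" for x y
      using inc[of "inv \<phi> x" y] inc[of y "inv \<phi> x"] by (simp_all add: \<phi>inv)
    define \<tau>' where "\<tau>' j = inv \<phi> (\<tau> j)" for j
    have "t \<in> (\<Union>j. {\<tau>' j..\<tau>' (j + 1)})" for t
    proof -
      obtain j where "\<phi> t \<in> {\<tau> j..\<tau> (j + 1)}" using cover by blast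
      then have "t \<in> {\<tau>' j..\<tau>' (j + 1)}" by (simp add: \<tau>'_def inv_less flip: not_less)
      then show ?thesis by blast
    qed
    moreover have "strict_mono \<tau>'" using mono by (auto simp: strict_mono_def \<tau>'_def inv_less \<phi>inv)
    ultimately have "subdivision \<tau>'" by (auto simp: subdivision_def)
    moreover have "reparametrization {\<tau>' j<..<\<tau>' (j + 1)} {\<tau> j<..<\<tau> (j + 1)} \<phi>" for j
    proof -
      have "bij_betw \<phi> {\<tau>' j<..<\<tau>' (j + 1)} {\<tau> j<..<\<tau> (j + 1)}"
        by (rule bij_betw_byWitness[where f' = "inv \<phi>"]) (auto simp: \<tau>'_def inv_less \<phi>inv)
      then show ?thesis using regS by (simp add: reparametrization_def)
    qed
    ultimately show ?thesis by blast
  next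
    assume neg: "\<forall>t. D t < 0"
    have dec: "\<phi> x < \<phi> y \<longleftrightarrow> y < x" for x y
    proof -
      have "\<phi> y < \<phi> x" if "x < y" for x y
        by (rule DERIV_neg_imp_decreasing[OF that]) (use D(1) neg in blast)
      from this[of x y] this[of y x] show ?thesis by (cases x y rule: linorder_cases) auto
    qed
    have inv_less: "inv \<phi> x < y \<longleftrightarrow> \<phi> y < x" "y < inv \<phi> x \<longleftrightarrow> x < \<phi> y" for x y
      using dec[of "inv \<phi> x" y] dec[of y "inv \<phi> x"] by (simp_all add: \<phi>inv)
    \<comment> \<open>The shift by 1 makes piece \<open>j\<close> correspond to piece
      \<open>- j\<close>, which has the same parity; with \<open>- j\<close> in place of
      \<open>1 - j\<close> it would be piece \<open>- j - 1\<close>.\<close>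
    define \<tau>' where "\<tau>' j = inv \<phi> (\<tau> (1 - j))" for j
    have "t \<in> (\<Union>j. {\<tau>' j..\<tau>' (j + 1)})" for t
    proof -
      obtain j where "\<phi> t \<in> {\<tau> j..\<tau> (j + 1)}" using cover by blast
      then have "t \<in> {\<tau>' (- j)..\<tau>' (- j + 1)}" by (simp add: \<tau>'_def inv_less add.commute flip: not_less)
      then show ?thesis by blast
    qed
    moreover have "strict_mono \<tau>'" using mono by (auto simp: strict_mono_def \<tau>'_def inv_less \<phi>inv)
    ultimately have "subdivision \<tau>'" by (auto simp: subdivision_def)
    moreover have "reparametrization {\<tau>' j<..<\<tau>' (j + 1)} {\<tau> (- j)<..<\<tau> (- j + 1)} \<phi>" for j
    proof -
      have "bij_betw \<phi> {\<tau>' j<..<\<tau>' (j + 1)} {\<tau> (- j)<..<\<tau> (- j + 1)}"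
        by (rule bij_betw_byWitness[where f' = "inv \<phi>"]) (auto simp: \<tau>'_def inv_less \<phi>inv)
      then show ?thesis using regS by (simp add: reparametrization_def)
    qed
    moreover have "even (- j) \<longleftrightarrow> even j" for j :: int by simp
    ultimately show ?thesis by blast
  qed
qed

lemma has_local_pieces_equivalent:
  assumes \<gamma>: "has_local_pieces n k C \<gamma>" and \<phi>: "reparametrization UNIV UNIV \<phi>"
    and \<delta>: "\<And>t. \<delta> t = rotate_curve \<alpha> (\<gamma> (\<phi> t))"
  shows "has_local_pieces n k C \<delta>"
proof -
  obtain \<tau> where \<tau>: "subdivision \<tau>"
    "\<And>j. local_piece n k C (if even j then \<gamma> else (\<lambda>t. reflect 0 (\<gamma> t))) {\<tau> j<..<\<tau> (j + 1)}"
    using \<gamma> unfolding has_local_pieces_def by blast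
  obtain \<tau>' where \<tau>': "subdivision \<tau>'"
    "\<And>j. \<exists>i. (even i \<longleftrightarrow> even j) \<and> reparametrization {\<tau>' j<..<\<tau>' (j + 1)} {\<tau> i<..<\<tau> (i + 1)} \<phi>"
    using reparametrization_subdivision[OF \<phi> \<tau>(1)] by blast
  have "local_piece n k C (if even j then \<delta> else (\<lambda>t. reflect 0 (\<delta> t))) {\<tau>' j<..<\<tau>' (j + 1)}" for j
  proof -
    obtain i where i: "even i \<longleftrightarrow> even j" "reparametrization {\<tau>' j<..<\<tau>' (j + 1)} {\<tau> i<..<\<tau> (i + 1)} \<phi>"
      using \<tau>'(2) by blast
    note lp = \<tau>(2)[of i]
    \<comment> \<open>Conjugating a rotation by the mirror inverts it, so mirrored pieces are
      rotated by \<open>- \<alpha>\<close>.\<close>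
    show ?thesis
      by (rule local_piece_compose[OF local_piece_rotate[OF lp, of "if even j then \<alpha> else - \<alpha>"] i(2)])
        (use i(1) \<delta> in \<open>simp add: rotate_reflect\<close>)
  qed
  with \<tau>'(1) show ?thesis unfolding has_local_pieces_def by blast
qed

text \<open>Written in \<open>|z|\<close> and \<open>b\<close>, the weak inequality
  \<open>|R| \<le> L\<close> defines a closed set \<open>S\<close> invariant under reflections. It
  contains the first piece, by induction in both directions every piece, and by closure the whole
  curve. At \<open>(0, 1)\<close> the inequality would say
  \<open>C + k / (n - 1) = 0\<close>.\<close>

lemma reflected_avoids_pole:
  assumes \<gamma>: "repeated_reflection n k C \<gamma>" and n: "n \<ge> 3" and C: "C + k / (real n - 1) \<noteq> 0"
  shows "(0, 1) \<notin> range \<gamma>"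
proof -
  define S where "S = {p :: complex \<times> real. \<bar>C + k / (real n - 1) * snd p ^ (n - 1)\<bar> \<le> cmod (fst p) * snd p ^ (n - 2)}"
  obtain \<tau> where cont: "continuous_on UNIV \<gamma>" and \<tau>: "subdivision \<tau>" and lp: "local_piece n k C \<gamma> {\<tau> 0<..<\<tau> 1}"
    and refl: "\<And>j. \<exists>\<phi>. reparametrization {\<tau> j<..<\<tau> (j + 1)} {\<tau> (j - 1)<..<\<tau> j} \<phi> \<and>
           (\<forall>t\<in>{\<tau> j<..<\<tau> (j + 1)}. \<gamma> t = reflect (Arg (fst (\<gamma> (\<tau> j)))) (\<gamma> (\<phi> t)))"
    using \<gamma> unfolding repeated_reflection_def by blast
  have reflS: "reflect \<theta> p \<in> S \<longleftrightarrow> p \<in> S" for \<theta> p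
    by (simp add: S_def reflect_def norm_mult)
  have base: "\<gamma> t \<in> S" if "t \<in> {\<tau> 0<..<\<tau> 1}" for t
  proof -
    obtain \<gamma>0 \<phi> where *: "local_k_curve n k C \<gamma>0" "reparametrization {\<tau> 0<..<\<tau> 1} (J_set n C k) \<phi>"
        "\<forall>t\<in>{\<tau> 0<..<\<tau> 1}. \<gamma> t = \<gamma>0 (\<phi> t)"
      using lp unfolding local_piece_def by blast
    have s: "\<phi> t \<in> J_set n C k" using *(2) that unfolding reparametrization_def bij_betw_def by blast
    then obtain \<theta> where "\<gamma>0 (\<phi> t) = (of_real (cos (\<phi> t)) * cis \<theta>, sin (\<phi> t))"
      using *(1) unfolding local_k_curve_def by blast
    moreover have "cos (\<phi> t) > 0" using s by (auto simp: J_set_def intro!: cos_gt_zero)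
    ultimately show ?thesis using *(3) that s by (simp add: S_def J_set_def R_fun_def L_fun_def norm_mult)
  qed
  have step: "(\<forall>t\<in>{\<tau> j<..<\<tau> (j + 1)}. \<gamma> t \<in> S) \<longleftrightarrow> (\<forall>t\<in>{\<tau> (j - 1)<..<\<tau> j}. \<gamma> t \<in> S)" for j
  proof -
    obtain \<phi> where \<phi>: "reparametrization {\<tau> j<..<\<tau> (j + 1)} {\<tau> (j - 1)<..<\<tau> j} \<phi>"
      "\<forall>t\<in>{\<tau> j<..<\<tau> (j + 1)}. \<gamma> t = reflect (Arg (fst (\<gamma> (\<tau> j)))) (\<gamma> (\<phi> t))" using refl by blast
    have "\<phi> ` {\<tau> j<..<\<tau> (j + 1)} = {\<tau> (j - 1)<..<\<tau> j}"
      using \<phi>(1) unfolding reparametrization_def bij_betw_def by blast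
    then have "(\<forall>t\<in>{\<tau> (j - 1)<..<\<tau> j}. \<gamma> t \<in> S) \<longleftrightarrow> (\<forall>t\<in>{\<tau> j<..<\<tau> (j + 1)}. \<gamma> (\<phi> t) \<in> S)"
      by (metis (no_types, lifting) image_iff)
    then show ?thesis using \<phi>(2) reflS by simp
  qed
  have all: "\<forall>t\<in>{\<tau> j<..<\<tau> (j + 1)}. \<gamma> t \<in> S" for j
  proof (induction j rule: int_induct[where k = 0])
    case base
    then show ?case using \<open>\<And>t. t \<in> {\<tau> 0<..<\<tau> 1} \<Longrightarrow> \<gamma> t \<in> S\<close> by simp
  next
    case (step1 i)
    then show ?case using step[of "i + 1"] by simp
  next
    case (step2 i)
    then show ?case using step[of i] by simp
  qed
  have "closed S" unfolding S_def by (intro closed_Collect_le continuous_intros)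
  then have cl: "closed (\<gamma> -` S)" using closed_vimage[OF _ cont] by blast
  have "\<gamma> t \<in> S" for t
  proof -
    obtain j where j: "t \<in> {\<tau> j..\<tau> (j + 1)}" using \<tau> unfolding subdivision_def by blast
    have "\<tau> j < \<tau> (j + 1)" using \<tau> by (simp add: subdivision_def strict_mono_def)
    then have "t \<in> closure {\<tau> j<..<\<tau> (j + 1)}" using j by simp
    moreover have "{\<tau> j<..<\<tau> (j + 1)} \<subseteq> \<gamma> -` S" using all by blast
    ultimately have "t \<in> \<gamma> -` S" using closure_minimal[OF _ cl] by blast
    then show ?thesis by simp
  qed
  moreover have "(0, 1) \<notin> S" using C by (simp add: S_def)
  ultimately show ?thesis by (metis rangeE)
qed

text \<open>Passing through the pole is visible in the hypersurface as a set: it contains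
  \<open>(0, x)\<close> for a unit vector \<open>x\<close>, and \<open>x = b y\<close> with
  \<open>y\<close> a unit vector and \<open>b > 0\<close> forces \<open>b = 1\<close>.\<close>

lemma generated_hypersurface_pole:
  assumes "\<And>t. snd (\<delta> t) > 0" and "(0, 1) \<in> range \<gamma>"
    and eq: "(generated_hypersurface UNIV \<gamma> :: (complex \<times> (real ^ 'm::finite)) set) = generated_hypersurface UNIV \<delta>"
  shows "(0, 1) \<in> range \<delta>"
proof -
  obtain x :: "real ^ 'm" where x: "norm x = 1" using vector_choose_size[of 1] by auto
  obtain t where t: "\<gamma> t = (0, 1)" using assms(2) by (metis rangeE)
  have "(t, x) \<in> param_domain UNIV" using x by (simp add: param_domain_def)
  then have "rot_hyp \<gamma> (t, x) \<in> generated_hypersurface UNIV \<gamma>"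
    unfolding generated_hypersurface_def by (rule imageI)
  then have "(0, x) \<in> generated_hypersurface UNIV \<delta>" unfolding eq rot_hyp_apply t by simp
  then obtain z where z: "z \<in> param_domain UNIV" "(0, x) = rot_hyp \<delta> z"
    unfolding generated_hypersurface_def by (rule imageE)
  obtain s y where sy: "z = (s, y)" by (rule prod.exhaust)
  have y: "norm y = 1" using z(1) by (simp add: sy param_domain_def)
  have e: "0 = fst (\<delta> s)" "x = snd (\<delta> s) *\<^sub>R y" using z(2) unfolding sy rot_hyp_apply prod.inject by auto
  have "snd (\<delta> s) = 1" using x y assms(1)[of s] unfolding e(2) by simp
  then have "\<delta> s = (0, 1)" using e(1) by (simp add: prod_eq_iff)
  then show ?thesis by (metis rangeI)
qed

context delaunay_field begin

text \<open>At the pole both tangents are horizontal unit vectors, so some rotation matches them and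
  the initial data agree. The rotated trajectory is then run at the speed of
  \<open>\<delta>\<close>, so that both satisfy the same time-changed equation.\<close>

theorem trajectory_through_pole_unique:
  assumes tr: "trajectory p q" and pole: "p s0 = (0, 1)" and m: "\<mu> + 1 = CARD('m::finite)"
    and \<delta>: "complete_k_curve TYPE('m) (- h) \<delta>" "(0, 1) \<in> range \<delta>"
  shows "\<exists>\<alpha> \<phi>. reparametrization UNIV UNIV \<phi> \<and> (\<forall>t. \<delta> t = rotate_curve \<alpha> (p (\<phi> t)))"
proof -
  have mu: "real CARD('m) - 1 = real \<mu>" using m by linarith
  have kc: "k_curve TYPE('m) (- h) UNIV \<delta>"
    and inf: "filterlim (\<lambda>r. integral {0..r} (\<lambda>t. norm (vector_derivative \<delta> (at t)))) at_top at_top"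
      "filterlim (\<lambda>r. integral {- r..0} (\<lambda>t. norm (vector_derivative \<delta> (at t)))) at_top at_top"
    using \<delta>(1) by (simp_all add: complete_k_curve_def)
  have "CARD('m) \<ge> 2" using m mu_pos by linarith
  from k_curve_imp_frenet[OF kc this] obtain v v' T where
    v: "\<And>t. (v has_real_derivative v' t) (at t)" "continuous_on UNIV v'" "\<And>t. v t \<noteq> 0"
    and d\<delta>: "\<And>t. (\<delta> has_vector_derivative v t *\<^sub>R T t) (at t)"
    and fr: "\<And>t. \<delta> t \<bullet> \<delta> t = 1 \<and> T t \<bullet> T t = 1 \<and> \<delta> t \<bullet> T t = 0 \<and> snd (\<delta> t) > 0"
    and dY: "\<And>t. ((\<lambda>t. (\<delta> t, T t)) has_vector_derivative v t *\<^sub>R field (\<delta> t, T t)) (at t)"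
    unfolding mu minus_minus by blast
  have contv: "continuous_on UNIV v" using v(1) by (rule DERIV_continuous_on[OF has_field_derivative_at_within])
  obtain t0 where t0: "\<delta> t0 = (0, 1)" using \<delta>(2) by (metis rangeE)
  \<comment> \<open>\<open>\<sigma>\<close> is the signed arc length of \<open>\<delta>\<close>,
    normalized so that both curves are at the pole when \<open>t = t0\<close>.\<close>
  obtain \<sigma> where \<sigma>0: "\<sigma> t0 = s0" and d\<sigma>: "\<And>t. (\<sigma> has_vector_derivative v t) (at t)"
    using antiderivative_exists[OF contv] by blast
  have horiz: "snd w = 0 \<and> cmod (fst w) = 1" if "w \<bullet> w = 1" "(0, 1) \<bullet> w = 0" for w :: "complex \<times> real"
    using that by (simp add: inner_prod_def norm_eq_sqrt_inner)
  have T0: "snd (T t0) = 0" "cmod (fst (T t0)) = 1"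
    using horiz[of "T t0"] fr[of t0] unfolding t0 by blast+
  have q0: "snd (q s0) = 0" "cmod (fst (q s0)) = 1"
    using horiz[of "q s0"] trajectory_deriv(2)[OF tr, of s0] unfolding orthonormal_pair_def fst_conv snd_conv pole by blast+
  define \<alpha> where "\<alpha> = Arg (fst (T t0) / fst (q s0))"
  have "cis \<alpha> = fst (T t0) / fst (q s0)"
    using rcis_cmod_Arg[of "fst (T t0) / fst (q s0)"] T0 q0 by (simp add: \<alpha>_def rcis_def norm_divide)
  then have \<alpha>: "cis \<alpha> * fst (q s0) = fst (T t0)" using q0 by auto
  define Y where "Y t = (rotate_curve \<alpha> (p (\<sigma> t)), rotate_curve \<alpha> (q (\<sigma> t)))" for t
  have "bounded_linear (\<lambda>Y. (rotate_curve \<alpha> (fst Y), rotate_curve \<alpha> (snd Y)))"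
    by (intro bounded_linear_Pair bounded_linear_compose[OF bounded_linear_rotate]
        bounded_linear_fst bounded_linear_snd)
  note bl = bounded_linear.has_vector_derivative[OF this]
  have dY2: "(Y has_vector_derivative v t *\<^sub>R field (Y t)) (at t)" for t
  proof -
    obtain x1 x2 where X: "field (p (\<sigma> t), q (\<sigma> t)) = (x1, x2)" by (rule prod.exhaust)
    have "((\<lambda>t. (p (\<sigma> t), q (\<sigma> t))) has_vector_derivative v t *\<^sub>R (x1, x2)) (at t)"
      using vector_diff_chain_at[OF d\<sigma>[of t] trajectory_deriv(1)[OF tr, of "\<sigma> t"]] unfolding X o_def .
    note * = bl[OF this]
    have "field (Y t) = (rotate_curve \<alpha> x1, rotate_curve \<alpha> x2)"
      unfolding Y_def curve_field_rotate X by simp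
    then show ?thesis using * unfolding Y_def[abs_def] by (simp add: rotate_linear)
  qed
  have "(\<lambda>t. (\<delta> t, T t)) = Y"
  proof (rule curve_field_unique[OF dY dY2 contv])
    show "(\<delta> t0, T t0) = Y t0"
      using T0 q0 \<alpha> by (simp add: Y_def \<sigma>0 pole t0 rotate_curve_def prod_eq_iff)
    show "snd (fst (\<delta> t, T t)) > 0" for t using fr by simp
    show "snd (fst (Y t)) > 0" for t using trajectory_deriv(3)[OF tr] by (simp add: Y_def rotate_linear)
  qed
  from fun_cong[OF this] have \<delta>_eq: "\<delta> t = rotate_curve \<alpha> (p (\<sigma> t))" for t
    unfolding Y_def prod.inject by blast
  have speed: "norm (vector_derivative \<delta> (at t)) = \<bar>v t\<bar>" for t
    using fr[of t] vector_derivative_at[OF d\<delta>[of t]] by (simp add: norm_eq_sqrt_inner)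
  have d\<sigma>': "(\<sigma> has_real_derivative v t) (at t)" for t
    using d\<sigma> by (simp add: has_real_derivative_iff_has_vector_derivative)
  have "bij \<sigma>"
    using nonvanishing_continuous_sign[OF contv v(3)]
  proof
    assume pos: "\<forall>t. v t > 0"
    then have "(\<lambda>t. norm (vector_derivative \<delta> (at t))) = v" by (intro ext) (simp add: speed abs_of_pos)
    then show ?thesis using inf pos by (intro antiderivative_surj[OF d\<sigma>' contv]) simp_all
  next
    assume neg: "\<forall>t. v t < 0"
    then have abs: "(\<lambda>t. norm (vector_derivative \<delta> (at t))) = (\<lambda>t. - v t)" by (intro ext) (simp add: speed abs_of_neg)
    \<comment> \<open>For negative \<open>v\<close> the speed of \<open>\<delta>\<close> is
      \<open>- v\<close>, so it is \<open>- \<sigma>\<close> that increases.\<close>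
    have "bij (\<lambda>t. - \<sigma> t)"
      by (rule antiderivative_surj[OF DERIV_minus[OF d\<sigma>']])
        (use neg inf in \<open>auto simp: abs intro!: continuous_intros contv\<close>)
    then have "bij (uminus \<circ> (\<lambda>t. - \<sigma> t))" using bij_uminus by (rule bij_comp)
    then show ?thesis by (simp add: o_def)
  qed
  moreover have "regular_C2_curve UNIV \<sigma>"
    unfolding regular_C2_real_iff using d\<sigma>' v by blast
  ultimately have "reparametrization UNIV UNIV \<sigma>" by (simp add: reparametrization_def)
  with \<delta>_eq show ?thesis by blast
qed

end

section \<open>Continuity in the parameter\<close>

context delaunay_field begin

lemma flower_interval:
  shows "\<exists>s\<^sub>0. 0 < s\<^sub>0 \<and> s\<^sub>0 < sU \<and> U s\<^sub>0 = a \<and> J a = {s\<^sub>0<..<pi / 2}"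
proof -
  obtain s0 s1 where s: "0 < s0" "s0 < s1" "s0 < sU" "U s0 = a" and s1: "s1 = pi / 2"
    and adm: "\<And>s. 0 < s \<Longrightarrow> s < pi / 2 \<Longrightarrow> a < U s \<and> W s < a \<longleftrightarrow> s0 < s \<and> s < s1"
    using admissible_interval[OF a_pos a_less_C_crit] by (elim exE conjE) blast
  have "J a = {s0<..<pi / 2}"
    using adm s unfolding s1 set_eq_iff mem_J_set_iff greaterThanLessThan_iff by (meson less_trans)
  with s show ?thesis by blast
qed

lemma Sup_J_flower: "Sup (J a) = pi / 2"
proof -
  obtain s0 where "s0 < sU" "J a = {s0<..<pi / 2}" using flower_interval by blast
  then show ?thesis using sU_sW by simp
qed

lemma J_eventually:
  assumes "s \<in> J C0"
  shows "\<forall>\<^sub>F C in at C0. s \<in> J C"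
proof -
  have s: "0 < s" "s < pi / 2" "C0 < U s" "W s < C0" using assms unfolding mem_J_set_iff by blast+
  from order_tendstoD(2)[OF tendsto_ident_at s(3)] order_tendstoD(1)[OF tendsto_ident_at s(4)]
  show ?thesis by eventually_elim (use s in \<open>simp only: mem_J_set_iff\<close>)
qed

lemma J_set_bounds: "bdd_below (J_set n C k)" "bdd_above (J_set n C k)"
proof -
  have "J_set n C k \<subseteq> {0..pi / 2}" unfolding J_set_def by auto
  then show "bdd_below (J_set n C k)" "bdd_above (J_set n C k)"
    by (meson bdd_below_mono bdd_below_Icc, meson bdd_above_mono bdd_above_Icc)
qed

text \<open>Points of \<open>J a\<close> remain admissible for \<open>C\<close> near
  \<open>a\<close>, which bounds the infimum from above and the supremum from below. In the other
  direction, monotonicity of \<open>U\<close> on the left of \<open>s0\<close> bounds the infimum,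
  and \<open>pi / 2\<close> bounds the supremum.\<close>

lemma J_endpoints_continuous:
  shows "((\<lambda>C. Inf (J C)) \<longlongrightarrow> Inf (J a)) (at a)"
    and "((\<lambda>C. Sup (J C)) \<longlongrightarrow> Sup (J a)) (at a)"
proof -
  obtain s0 where s0: "0 < s0" "s0 < sU" "U s0 = a" and J: "J a = {s0<..<pi / 2}"
    using flower_interval by blast
  have lt: "s0 < pi / 2" using s0 sU_sW by simp
  have Inf: "Inf (J a) = s0" unfolding J using lt by simp
  show "((\<lambda>C. Inf (J C)) \<longlongrightarrow> Inf (J a)) (at a)"
    unfolding Inf
  proof (rule order_tendstoI)
    fix u assume "s0 < u"
    with lt have "s0 < min u (pi / 2)" by simp
    from dense[OF this] obtain s where s: "s0 < s" "s < min u (pi / 2)" by blast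
    then have "s \<in> J a" unfolding J by simp
    from J_eventually[OF this] show "\<forall>\<^sub>F C in at a. Inf (J C) < u"
    proof eventually_elim
      case (elim C)
      from cInf_lower[OF this J_set_bounds(1)] s show ?case by simp
    qed
  next
    fix l assume "l < s0"
    with s0 have "max l 0 < s0" by simp
    from dense[OF this] obtain r where r: "max l 0 < r" "r < s0" by blast
    have "U r < a" using U_increasing[of r s0] r s0 by simp
    then have 1: "\<forall>\<^sub>F C in at a. U r < C" by (rule order_tendstoD(1)[OF tendsto_ident_at])
    have "(s0 + pi / 2) / 2 \<in> J a" unfolding J using lt by simp
    from J_eventually[OF this] 1 show "\<forall>\<^sub>F C in at a. l < Inf (J C)"
    proof eventually_elim
      case (elim C)
      have "r \<le> s" if "s \<in> J C" for s
      proof (rule ccontr)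
        assume "\<not> r \<le> s"
        moreover have "0 < s" "C < U s" using that unfolding mem_J_set_iff by blast+
        ultimately show False using U_increasing[of s r] r s0 elim(2) by simp
      qed
      then have "r \<le> Inf (J C)" using elim(1) by (intro cInf_greatest) auto
      then show ?case using r by simp
    qed
  qed
  show "((\<lambda>C. Sup (J C)) \<longlongrightarrow> Sup (J a)) (at a)"
    unfolding Sup_J_flower
  proof (rule order_tendstoI)
    fix l assume "l < pi / 2"
    with lt have "max l s0 < pi / 2" by simp
    from dense[OF this] obtain s where s: "max l s0 < s" "s < pi / 2" by blast
    then have "s \<in> J a" unfolding J by simp
    from J_eventually[OF this] show "\<forall>\<^sub>F C in at a. l < Sup (J C)"
    proof eventually_elim
      case (elim C)
      from cSup_upper[OF this J_set_bounds(2)] s show ?case by simp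
    qed
  next
    fix u :: real assume u: "pi / 2 < u"
    have "(s0 + pi / 2) / 2 \<in> J a" unfolding J using lt by simp
    from J_eventually[OF this] show "\<forall>\<^sub>F C in at a. Sup (J C) < u"
    proof eventually_elim
      case (elim C)
      have "Sup (J C) \<le> pi / 2"
      proof (rule cSup_least)
        show "J C \<noteq> {}" using elim by blast
        show "x \<le> pi / 2" if "x \<in> J C" for x
          using that unfolding J_set_def by simp
      qed
      then show ?case using u by simp
    qed
  qed
qed

lemma J_eventually_Icc:
  assumes "{x..y} \<subseteq> J C0"
  shows "\<exists>d>0. \<forall>C. \<bar>C - C0\<bar> < d \<longrightarrow> {x..y} \<subseteq> J C"
proof (cases "{x..y} = {}")
  case False
  have s: "0 < s" "s < pi / 2" "C0 < U s" "W s < C0" if "s \<in> {x..y}" for s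
    using subsetD[OF assms that] unfolding mem_J_set_iff by blast+
  obtain u where u: "u \<in> {x..y}" "\<And>s. s \<in> {x..y} \<Longrightarrow> U u \<le> U s"
    using continuous_attains_inf[OF compact_Icc False continuous_U] by blast
  obtain w where w: "w \<in> {x..y}" "\<And>s. s \<in> {x..y} \<Longrightarrow> W s \<le> W w"
    using continuous_attains_sup[OF compact_Icc False continuous_W] by blast
  have "{x..y} \<subseteq> J C" if "\<bar>C - C0\<bar> < min (U u - C0) (C0 - W w)" for C
  proof
    fix z assume z: "z \<in> {x..y}"
    have "C < U u" "W w < C" using that by (simp_all add: abs_less_iff)
    then have "C < U z" "W z < C" using u(2)[OF z] w(2)[OF z] by simp_all
    then show "z \<in> J C" using s[OF z] unfolding mem_J_set_iff by blast
  qed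
  moreover have "min (U u - C0) (C0 - W w) > 0" using s(3)[OF u(1)] s(4)[OF w(1)] by simp
  ultimately show ?thesis by blast
qed (auto intro: exI[of _ 1])

definition phase_rate :: "real \<Rightarrow> real \<Rightarrow> real" where
  "phase_rate C s = R s C / (cos s * sqrt ((L s)\<^sup>2 - (R s C)\<^sup>2))"

text \<open>The rate is jointly continuous in \<open>C\<close> and \<open>s\<close> on a compact
  rectangle of admissible pairs, hence uniformly continuous there.\<close>

lemma phase_rate_uniform:
  assumes J: "{x..y} \<subseteq> J C0" and e: "e > 0"
  shows "\<exists>d>0. \<forall>C. \<bar>C - C0\<bar> < d \<longrightarrow> {x..y} \<subseteq> J C \<and>
    (\<forall>s\<in>{x..y}. \<bar>phase_rate C s - phase_rate C0 s\<bar> \<le> e)"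
proof -
  obtain d where d: "d > 0" "\<And>C. \<bar>C - C0\<bar> < d \<Longrightarrow> {x..y} \<subseteq> J C"
    using J_eventually_Icc[OF J] by blast
  \<comment> \<open>Half the radius makes the closed parameter interval fit into the open range
    where \<open>{x..y}\<close> stays admissible.\<close>
  define S where "S = {C0 - d / 2..C0 + d / 2} \<times> {x..y}"
  have inJ: "s \<in> J C" if "(C, s) \<in> S" for C s
  proof -
    have "\<bar>C - C0\<bar> < d" using that d(1) by (auto simp: S_def abs_less_iff)
    then show ?thesis using d(2)[of C] that by (auto simp: S_def)
  qed
  have "continuous_on S (\<lambda>z. phase_rate (fst z) (snd z))"
    unfolding phase_rate_def R_fun_def L_fun_def
  proof (intro continuous_intros ballI)
    fix z assume "z \<in> S"
    then have s: "snd z \<in> J_set (\<mu> + 2) (fst z) (- h)" using inJ[of "fst z" "snd z"] by simp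
    then have c: "cos (snd z) > 0" and "\<bar>R (snd z) (fst z)\<bar> < L (snd z)"
      by (auto simp: J_set_def intro!: cos_gt_zero)
    then have "\<bar>R (snd z) (fst z)\<bar>\<^sup>2 < (L (snd z))\<^sup>2"
      by (intro power_strict_mono) auto
    then have "sqrt ((L (snd z))\<^sup>2 - (R (snd z) (fst z))\<^sup>2) > 0" by simp
    then show "cos (snd z) * sqrt ((cos (snd z) * sin (snd z) ^ (\<mu> + 2 - 2))\<^sup>2 -
        (fst z + - h / (real (\<mu> + 2) - 1) * sin (snd z) ^ (\<mu> + 2 - 1))\<^sup>2) \<noteq> 0"
      using c unfolding R_fun_def L_fun_def by simp
  qed
  moreover have "compact S" unfolding S_def by (intro compact_Times compact_Icc)
  ultimately have "uniformly_continuous_on S (\<lambda>z. phase_rate (fst z) (snd z))"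
    by (rule compact_uniformly_continuous)
  then obtain d' where d': "d' > 0" "\<And>z z'. z \<in> S \<Longrightarrow> z' \<in> S \<Longrightarrow> dist z' z < d' \<Longrightarrow>
      dist (phase_rate (fst z') (snd z')) (phase_rate (fst z) (snd z)) < e"
    unfolding uniformly_continuous_on_def using e by meson
  have "{x..y} \<subseteq> J C \<and> (\<forall>s\<in>{x..y}. \<bar>phase_rate C s - phase_rate C0 s\<bar> \<le> e)"
    if C: "\<bar>C - C0\<bar> < min (d / 2) d'" for C
  proof (intro conjI ballI)
    show "{x..y} \<subseteq> J C" using d C by simp
    fix s assume s: "s \<in> {x..y}"
    have "\<bar>C - C0\<bar> < d / 2" using C by simp
    then have "C0 - d / 2 \<le> C" "C \<le> C0 + d / 2" by linarith+
    then have z: "(C0, s) \<in> S" "(C, s) \<in> S" using s d(1) by (simp_all add: S_def)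
    have "dist (C, s) (C0, s) < d'" using C by (simp add: dist_Pair_Pair dist_real_def)
    from d'(2)[OF z this] show "\<bar>phase_rate C s - phase_rate C0 s\<bar> \<le> e" by (simp add: dist_real_def)
  qed
  moreover have "min (d / 2) d' > 0" using d(1) d'(1) by simp
  ultimately show ?thesis by blast
qed

text \<open>Between \<open>s0\<close> and \<open>s\<close> the phases for \<open>C\<close> and
  \<open>C0\<close> have uniformly close derivatives, so by the mean value inequality their
  increments are close.\<close>

lemma local_curve_phase_continuous:
  assumes J: "is_interval (J C0)"
    and s: "s0 \<in> J C0" "s \<in> J C0"
    and \<sigma>: "\<And>C s. s \<in> J C \<Longrightarrow> (\<sigma> C has_real_derivative phase_rate C s) (at s)"
  shows "((\<lambda>C. \<sigma> C s - \<sigma> C s0) \<longlongrightarrow> \<sigma> C0 s - \<sigma> C0 s0) (at C0)"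
proof (rule tendstoI)
  fix e :: real assume e: "e > 0"
  define x y where "x = min s s0" and "y = max s s0"
  have sub: "{x..y} \<subseteq> J C0"
  proof
    fix r assume "r \<in> {x..y}"
    then show "r \<in> J C0"
      using mem_is_interval_1_I[OF J s(1,2), of r] mem_is_interval_1_I[OF J s(2,1), of r]
      by (auto simp: x_def y_def min_def max_def split: if_splits)
  qed
  \<comment> \<open>The added 1 covers the case \<open>s = s0\<close> and makes the final estimate
    strict.\<close>
  define e' where "e' = e / (\<bar>s - s0\<bar> + 1)"
  have e': "e' > 0" "e' * \<bar>s - s0\<bar> < e" using e by (simp_all add: e'_def field_simps add_pos_nonneg)
  obtain d where d: "d > 0" "\<And>C. \<bar>C - C0\<bar> < d \<Longrightarrow> {x..y} \<subseteq> J C \<and>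
    (\<forall>s\<in>{x..y}. \<bar>phase_rate C s - phase_rate C0 s\<bar> \<le> e')"
    using phase_rate_uniform[OF sub e'(1)] by blast
  show "\<forall>\<^sub>F C in at C0. dist (\<sigma> C s - \<sigma> C s0) (\<sigma> C0 s - \<sigma> C0 s0) < e"
    unfolding eventually_at
  proof (intro exI conjI ballI impI)
    show "d > 0" by (rule d(1))
    fix C assume "C \<noteq> C0 \<and> dist C C0 < d"
    then have C: "\<bar>C - C0\<bar> < d" by (simp add: dist_real_def)
    note d2 = d(2)[OF C]
    have "norm ((\<sigma> C s - \<sigma> C0 s) - (\<sigma> C s0 - \<sigma> C0 s0)) \<le> e' * norm (s - s0)"
    proof (rule field_differentiable_bound[where S = "{x..y}" and f = "\<lambda>r. \<sigma> C r - \<sigma> C0 r"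
          and f' = "\<lambda>r. phase_rate C r - phase_rate C0 r"])
      fix r assume r: "r \<in> {x..y}"
      show "((\<lambda>r. \<sigma> C r - \<sigma> C0 r) has_field_derivative phase_rate C r - phase_rate C0 r) (at r within {x..y})"
        using DERIV_diff[OF \<sigma> \<sigma>, of r C C0] subsetD[OF sub r] subsetD[OF conjunct1[OF d2] r]
        by (blast intro: has_field_derivative_at_within)
      show "norm (phase_rate C r - phase_rate C0 r) \<le> e'" using d2 r by simp
    qed (auto simp: x_def y_def)
    then show "dist (\<sigma> C s - \<sigma> C s0) (\<sigma> C0 s - \<sigma> C0 s0) < e"
      using e'(2) by (simp add: dist_real_def algebra_simps)
  qed
qed

text \<open>The chosen phases \<open>\<sigma> C\<close> carry unknown constants. Prescribing the
  curve at \<open>s0\<close> gives \<open>cis (\<sigma> C s0) = 1\<close>, so only the increment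
  \<open>\<sigma> C s - \<sigma> C s0\<close> enters, and that one is continuous in
  \<open>C\<close>.\<close>

theorem local_curves_continuous_at_flower: "local_curves_continuous_at (\<mu> + 2) (- h) a"
  unfolding local_curves_continuous_at_def
proof (intro conjI ballI allI impI J_endpoints_continuous)
  fix s0 s \<Lambda>
  assume s0: "s0 \<in> J a" and s: "s \<in> J a"
    and \<Lambda>: "\<forall>C. local_k_curve (\<mu> + 2) (- h) C (\<Lambda> C) \<and>
      (s0 \<in> J C \<longrightarrow> \<Lambda> C s0 = (of_real (cos s0), sin s0))"
  have "\<forall>C. \<exists>\<sigma>. \<forall>s\<in>J C. (\<sigma> has_real_derivative phase_rate C s) (at s) \<and>
      \<Lambda> C s = (of_real (cos s) * cis (\<sigma> s), sin s)"
    using \<Lambda> unfolding local_k_curve_def phase_rate_def by blast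
  then obtain \<sigma> where \<sigma>: "\<And>C s. s \<in> J C \<Longrightarrow> (\<sigma> C has_real_derivative phase_rate C s) (at s)"
    and \<Lambda>_eq: "\<And>C s. s \<in> J C \<Longrightarrow> \<Lambda> C s = (of_real (cos s) * cis (\<sigma> C s), sin s)"
    by metis
  have "cos s0 > 0" using s0 by (auto simp: J_set_def intro!: cos_gt_zero)
  have one: "cis (\<sigma> C s0) = 1" if "s0 \<in> J C" for C
  proof -
    have "(of_real (cos s0) * cis (\<sigma> C s0), sin s0) = (of_real (cos s0), sin s0)"
      using \<Lambda> \<Lambda>_eq[OF that] that by metis
    then show ?thesis using \<open>cos s0 > 0\<close> by simp
  qed
  have norm: "\<Lambda> C s = (of_real (cos s) * cis (\<sigma> C s - \<sigma> C s0), sin s)"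
    if "s0 \<in> J C" "s \<in> J C" for C
    using \<Lambda>_eq[OF that(2)] one[OF that(1)] by (simp add: cis_divide[symmetric])
  obtain l where "J a = {l<..<pi / 2}" using flower_interval by blast
  then have J: "is_interval (J a)" by (simp add: is_interval_oo)
  have "((\<lambda>C. \<sigma> C s - \<sigma> C s0) \<longlongrightarrow> \<sigma> a s - \<sigma> a s0) (at a)"
    by (rule local_curve_phase_continuous[OF J s0 s \<sigma>])
  then have "((\<lambda>C. cis (\<sigma> C s - \<sigma> C s0)) \<longlongrightarrow> cis (\<sigma> a s - \<sigma> a s0)) (at a)"
    by (rule tendsto_cis)
  from tendsto_Pair[OF tendsto_mult[OF tendsto_const this] tendsto_const]
  have "((\<lambda>C. (of_real (cos s) * cis (\<sigma> C s - \<sigma> C s0), sin s)) \<longlongrightarrow> \<Lambda> a s) (at a)"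
    unfolding norm[OF s0 s] .
  moreover have "\<forall>\<^sub>F C in at a. (of_real (cos s) * cis (\<sigma> C s - \<sigma> C s0), sin s) = \<Lambda> C s"
    using J_eventually[OF s0] J_eventually[OF s] by eventually_elim (rule norm[symmetric])
  ultimately show "((\<lambda>C. \<Lambda> C s) \<longlongrightarrow> \<Lambda> a s) (at a)" by (rule Lim_transform_eventually)
qed

end

theorem theorem4p10:
  fixes n :: nat and h :: real
  assumes "n = CARD('m::finite) + 1" and "n \<ge> 3" and "h > 0"
  shows "(\<exists>\<gamma>. flower_curve TYPE('m) h \<gamma> \<and>
            (\<forall>\<delta>. flower_curve TYPE('m) h \<delta> \<longrightarrow> equivalent_curves \<gamma> \<delta>)) \<and>
         (\<forall>\<gamma>. flower_curve TYPE('m) h \<gamma> \<longrightarrow>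
            (generated_hypersurface UNIV \<gamma> :: (complex \<times> (real ^ 'm)) set)
              \<in> delaunay_hypersurfaces (-h) - (unduloid_type h \<union> nodoid_type h) \<and>
            has_local_pieces n (-h) (h / (real n - 1)) \<gamma>) \<and>
         0 < h / (real n - 1) \<and> h / (real n - 1) < C_crit n (-h) \<and>
         (\<forall>C\<in>unduloid_params n h \<union> nodoid_params n h.
            \<exists>\<gamma>. complete_k_curve TYPE('m) (-h) \<gamma> \<and> repeated_reflection n (-h) C \<gamma>) \<and>
         Sup (J_set n (h / (real n - 1)) (-h)) = pi / 2 \<and>
         local_curves_continuous_at n (-h) (h / (real n - 1))"
proof -
  define \<mu> where "\<mu> = n - 2"
  have n: "n = \<mu> + 2" and \<mu>: "\<mu> \<ge> 1" and m: "\<mu> + 1 = CARD('m)" using assms by (auto simp: \<mu>_def)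
  interpret delaunay_field h \<mu> by unfold_locales (use assms \<mu> in auto)
  have a: "h / (real n - 1) = a" by (simp add: n a_def)
  have crit: "C_crit n (- h) = U sU" unfolding n by (rule C_crit_eq)
  obtain p q T where tr: "trajectory p q" and T: "T > 0" and piece: "local_piece n (- h) a p {0<..<T}"
    and zeros: "\<And>j::int. snd (q (of_int j * T)) = 0" and pole: "p T = (0, 1)"
    using standard_trajectory[OF a_pos a_less_C_crit] unfolding n by blast
  have pieces: "has_local_pieces n (- h) a p"
    using trajectory_has_local_pieces[OF tr T piece[unfolded n] zeros] unfolding n .
  have flower: "flower_curve TYPE('m) h p"
    unfolding flower_curve_def using trajectory_complete[OF tr m] pole by (metis rangeI)
  have unique: "\<exists>\<alpha> \<phi>. reparametrization UNIV UNIV \<phi> \<and> (\<forall>t. \<delta> t = rotate_curve \<alpha> (p (\<phi> t)))"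
    if "flower_curve TYPE('m) h \<delta>" for \<delta>
    using that trajectory_through_pole_unique[OF tr pole m] unfolding flower_curve_def by blast
  \<comment> \<open>Equal hypersurfaces would force the generating curve of the reflected type
    through the pole, which a parameter other than \<open>a\<close> excludes.\<close>
  have not_reflected: "(generated_hypersurface UNIV \<gamma> :: (complex \<times> (real ^ 'm)) set) \<notin> reflected_type h P"
    if \<gamma>: "flower_curve TYPE('m) h \<gamma>" and P: "a \<notin> P" for \<gamma> P
  proof
    assume "(generated_hypersurface UNIV \<gamma> :: (complex \<times> (real ^ 'm)) set) \<in> reflected_type h P"
    then obtain \<delta> C where eq: "(generated_hypersurface UNIV \<gamma> :: (complex \<times> (real ^ 'm)) set) = generated_hypersurface UNIV \<delta>"
      and \<delta>: "complete_k_curve TYPE('m) (- h) \<delta>" and C: "C \<in> P" and refl: "repeated_reflection n (- h) C \<delta>"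
      unfolding reflected_type_def assms(1)[symmetric] by blast
    have "\<And>t. snd (\<delta> t) > 0" using \<delta> unfolding complete_k_curve_def k_curve_def by blast
    moreover have "(0, 1) \<in> range \<gamma>" using \<gamma> unfolding flower_curve_def by blast
    ultimately have "(0, 1) \<in> range \<delta>" using eq by (rule generated_hypersurface_pole)
    moreover have "C + - h / (real n - 1) \<noteq> 0" using C P a by auto
    ultimately show False using reflected_avoids_pole[OF refl assms(2)] by blast
  qed
  have "a \<notin> unduloid_params n h" "a \<notin> nodoid_params n h"
    by (simp_all add: unduloid_params_def nodoid_params_def a)
  note not_type = this[THEN not_reflected[rotated]]
  have types: "(generated_hypersurface UNIV \<gamma> :: (complex \<times> (real ^ 'm)) set)
      \<in> delaunay_hypersurfaces (- h) - (unduloid_type h \<union> nodoid_type h)"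
    if \<gamma>: "flower_curve TYPE('m) h \<gamma>" for \<gamma>
  proof -
    have "k_curve TYPE('m) (- h) UNIV \<gamma>" using \<gamma> unfolding flower_curve_def complete_k_curve_def by blast
    then have "(generated_hypersurface UNIV \<gamma> :: (complex \<times> (real ^ 'm)) set) \<in> delaunay_hypersurfaces (- h)"
      unfolding delaunay_hypersurfaces_def by blast
    then show ?thesis
      using not_type[OF \<gamma>] unfolding unduloid_type_def nodoid_type_def assms(1)[symmetric] by blast
  qed
  have local: "has_local_pieces n (- h) a \<gamma>" if "flower_curve TYPE('m) h \<gamma>" for \<gamma>
    using unique[OF that] has_local_pieces_equivalent[OF pieces] by blast
  have other: "\<exists>\<gamma>. complete_k_curve TYPE('m) (- h) \<gamma> \<and> repeated_reflection n (- h) C \<gamma>"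
    if "C \<in> unduloid_params n h \<union> nodoid_params n h" for C
  proof -
    have C: "0 < C" "C < U sU" "C \<noteq> a"
      using that a_pos a_less_C_crit by (auto simp: unduloid_params_def nodoid_params_def a crit)
    obtain p q T where tr: "trajectory p q" and T: "T > 0" and piece: "local_piece (\<mu> + 2) (- h) C p {0<..<T}"
      and zeros: "\<And>j::int. snd (q (of_int j * T)) = 0" and nz: "\<And>t. fst (p t) \<noteq> 0"
      using standard_trajectory[OF C(1,2)] C(3) by blast
    show ?thesis
      using trajectory_complete[OF tr m] trajectory_repeated_reflection[OF tr T piece zeros nz] unfolding n by blast
  qed
  show ?thesis
    unfolding a crit equivalent_curves_def
    using flower unique types local a_pos a_less_C_crit other
      Sup_J_flower[folded n] local_curves_continuous_at_flower[folded n] by blast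
qed

end
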